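(* Suppose that $Y$ is $(q+1)$-regular and that $\Gamma$ is a cuspidal tree lattice acting on $Y$, with $X=\Gamma\backslash Y$. Write $T$ also for the matrix of the operator $T$ with respect to the basis of $C_1(X)=\bigoplus_{e\in\mathrm{OE}(X)}\mathbb C e$ consisting of all oriented edges. Then: (a) If $X$ is a finite graph, then the matrix $T$ has only non-negative entries and is connected, i.e. whenever $\mathrm{OE}(X)=M\cup N$ with disjoint $T$-stable subsets $M,N$, then $M=\emptyset$ or $N=\emptyset$. (b) $\max_{j=1}^r|a_j|=q$. (c) (Prime Geodesic Theorem) There exists $\Delta\in\mathbb N$ such that for $m\to\infty$ we have $$N_m=\Delta\,\mathbf 1_{\Delta\mathbb Z}(m)\,q^m+O\left((q-\varepsilon)^m\right)$$ for some $\varepsilon>0$.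
   Context: Graphs: an oriented edge $e$ has origin $o(e)$, terminus $t(e)$ and reverse $e^{-1}$; $\mathrm{OE}(X)$ is the set of oriented edges of $X$. A path is a sequence $(e_1,\dots,e_n)$ of oriented edges with $t(e_j)=o(e_{j+1})$ for $1\le j\le n-1$; it is reduced if $e_{j+1}\ne e_j^{-1}$ for all $1\le j\le n-1$. Tree lattices: a tree lattice is a group $\Gamma$ with an action on a locally finite tree $Y$ such that all edge stabilizers $\Gamma_e$ are finite and $\sum_{e \bmod \Gamma} 1/|\Gamma_e|<\infty$. Throughout, $Y$ is uniform, i.e. $G\backslash Y$ is finite where $G=\mathrm{Aut}(Y)$, and $\Gamma$ acts orientation preservingly, so that the oriented edges of $X=\Gamma\backslash Y$ are the $\Gamma$-orbits of oriented edges of $Y$. Cusps: a ray in $Y$ is an infinite reduced path; two rays $r,s$ are equivalent if there are $N\in\mathbb N$, $k\in\mathbb Z$ with $r_{j+k}=s_j$ for all $j\ge N$; the set of equivalence classes is the boundary $\partial Y$. For $c\in\partial Y$, two vertices $x,y$ lie in the same horocycle with respect to $c$ if there are rays in $c$ starting at $x$ and $y$ and an $n\ge 0$ such that the two rays have the same $n$-th vertex. Let $P_c$ be the stabilizer of $c$ in $G$ and $N_c\subset P_c$ the subgroup of elements stabilizing one (hence every) horocycle with respect to $c$. The point $c$ is a cusp of $\Gamma$ if $\Gamma\cap P_c=\Gamma\cap N_c$ and $\Gamma\cap N_c$ acts transitively on some horocycle with respect to $c$; then a ray in $c$, or rather its image in $X$, is called a cusp section. The cusp is periodic if the sequence of valencies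 (in $Y$) of the vertices along a ray in $c$ is eventually periodic. $\Gamma$ is cuspidal if $X$ is the union of a finite graph and finitely many periodic cusp sections. Cycles, weights, zeta function: a path $(e_1,\dots,e_n)$ in $X$ is closed if $t(e_n)=o(e_1)$; a cycle is an equivalence class of closed paths under cyclic shifts; $l(c)$ is its length. A cycle is prime if it is not a power of a shorter one; every cycle $c$ is a power of a unique prime cycle $c_0$. For an oriented edge $e$ of $Y$ put $w(e)=|\Gamma_{o(e)}e|$, and for an edge $e$ of $X$ put $w(e)=w(\tilde e)$ for any preimage $\tilde e$ in $Y$. For edges $e,e'$ of $X$ with $t(e)=o(e')$ put $w(e,e')=w(e')$ if $e'\neq e^{-1}$ and $w(e,e')=w(e')-1$ if $e'=e^{-1}$. For a closed path $p=(e_1,\dots,e_n)$ let $w(p)=\prod_{j \bmod n}w(e_j,e_{j+1})$; it depends only on the cycle. The Bass-Ihara zeta function is $Z(u)=\prod_c(1-w(c)u^{l(c)})^{-1}$ (for small $|u|$), the product over all prime cycles in $X$; it is a rational function. The operator $T:C_1(X)\to C_1(X)$ is $Te=\sum_{e':o(e')=t(e)}w(e,e')e'$. A subset $M\subset\mathrm{OE}(X)$ is $T$-stable if for every $e\in M$ all edges occurring with nonzero coefficient in $Te$ lie in $M$. The numbers $N_m$ are defined by $u\frac{Z'}{Z}(u)=\sum_{m\ge1}N_mu^m$, equivalently $N_m=\sum_{c:l(c)=m}w(c)l(c_0)$, the sum running over all cycles of length $m$. The numbers $a_1,\dots,a_r\in\mathbb C$ come from writing the rational function as $Z(u)=\prod_{k=1}^t(1-b_ku)\big/\prod_{j=1}^r(1-a_ju)$,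 so that $N_m=\sum_{j=1}^ra_j^m-\sum_{k=1}^tb_k^m$. In the present case ($Y$ $(q+1)$-regular and $X$ with $s\geq 0$ cusps) the $b_k$ are $\pm\sqrt q$ and $N_m=\sum_{j=1}^ra_j^m-2sq^{m/2}\mathbf 1_{2\mathbb Z}(m)$. $\mathbf 1_{S}$ denotes the indicator function of $S$.
   Formalization: The formal theorem assumes q ≥ 2. For q = 1 the statement fails: if Y is a line and Γ = ℤ translates by n, then T is not connected and N_m = 2n·1_{nℤ}(m), contradicting (a) and (c); for q = 0 (a single edge) T = 0 and there are no a_j. *)

theory Defs
  imports
    "HOL-Complex_Analysis.Complex_Analysis"
    "HOL-Algebra.Group_Action"
    "HOL-Library.Landau_Symbols"
    "HOL-Library.Multiset"
    "HOL-Library.Poly_Mapping"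
    "Graph_Theory.Digraph_Component"
begin

text \<open>
  A graph in the sense of Serre is given by a \<open>pre_digraph\<close>, whose arcs are the oriented edges,
  together with the reversal of arcs.  A tree has neither loops nor multiple edges, so its oriented
  edges are pairs of vertices and reversal is \<^const>\<open>prod.swap\<close>.
  In the quotient \<open>X\<close> of a tree the vertices and oriented edges are orbits, i.e. sets of vertices
  and sets of pairs of vertices, and the reverse of an edge \<open>E\<close> is \<^term>\<open>converse E\<close>.
  \<open>X\<close> may have loops and multiple edges.
\<close>

definition graph_path :: "('a, 'b) pre_digraph \<Rightarrow> 'b list \<Rightarrow> bool" where
  "graph_path G p \<longleftrightarrow>
     p \<noteq> [] \<and> set p \<subseteq> arcs G \<and> successively (\<lambda>e e'. head G e = tail G e') p"

definition reduced :: "('v \<times> 'v) list \<Rightarrow> bool" where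
  "reduced p \<longleftrightarrow> successively (\<lambda>e e'. e' \<noteq> prod.swap e) p"

text \<open>The library predicate \<open>tree\<close> is of no use here: in a symmetric digraph it counts the
  backtracking \<open>e, e\<^sup>-\<^sup>1\<close> as a cycle.\<close>

definition is_tree :: "'v pair_pre_digraph \<Rightarrow> bool" where
  "is_tree Y \<longleftrightarrow>
     pair_bidirected_digraph Y \<and> Digraph_Component.connected (with_proj Y) \<and>
     (\<forall>p. graph_path (with_proj Y) p \<and> reduced p \<longrightarrow> fst (hd p) \<noteq> snd (last p))"

definition locally_finite :: "'v pair_pre_digraph \<Rightarrow> bool" where
  "locally_finite Y \<longleftrightarrow> (\<forall>x\<in>pverts Y. finite (out_arcs (with_proj Y) x))"

definition valency :: "'v pair_pre_digraph \<Rightarrow> 'v \<Rightarrow> nat" where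
  "valency Y x = out_degree (with_proj Y) x"

definition regular :: "nat \<Rightarrow> 'v pair_pre_digraph \<Rightarrow> bool" where
  "regular d Y \<longleftrightarrow> locally_finite Y \<and> (\<forall>x\<in>pverts Y. valency Y x = d)"


section \<open>Tree lattices\<close>

definition aut_group :: "'v pair_pre_digraph \<Rightarrow> ('v \<Rightarrow> 'v) monoid" where
  "aut_group Y = BijGroup (pverts Y)
     \<lparr>carrier := {g \<in> Bij (pverts Y).
        \<forall>x\<in>pverts Y. \<forall>y\<in>pverts Y. (g x, g y) \<in> parcs Y \<longleftrightarrow> (x, y) \<in> parcs Y}\<rparr>"

definition edge_act :: "('g \<Rightarrow> 'v \<Rightarrow> 'v) \<Rightarrow> 'g \<Rightarrow> 'v \<times> 'v \<Rightarrow> 'v \<times> 'v" where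
  "edge_act \<phi> g = map_prod (\<phi> g) (\<phi> g)"

definition quotient_graph ::
    "('g, 'm) monoid_scheme \<Rightarrow> 'v pair_pre_digraph \<Rightarrow> ('g \<Rightarrow> 'v \<Rightarrow> 'v)
      \<Rightarrow> ('v set, ('v \<times> 'v) set) pre_digraph" where
  "quotient_graph \<Gamma> Y \<phi> =
     \<lparr>verts = orbits \<Gamma> (pverts Y) \<phi>,
      arcs = orbits \<Gamma> (parcs Y) (edge_act \<phi>),
      tail = (\<lambda>E. fst ` E),
      head = (\<lambda>E. snd ` E)\<rparr>"

definition uniform :: "'v pair_pre_digraph \<Rightarrow> bool" where
  "uniform Y \<longleftrightarrow> fin_digraph (quotient_graph (aut_group Y) Y (\<lambda>g. g))"

text \<open>The action need not be faithful. On an edge it is the diagonal action on pairs.\<close>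

definition tree_lattice ::
    "('g, 'm) monoid_scheme \<Rightarrow> 'v pair_pre_digraph \<Rightarrow> ('g \<Rightarrow> 'v \<Rightarrow> 'v) \<Rightarrow> bool" where
  "tree_lattice \<Gamma> Y \<phi> \<longleftrightarrow>
     is_tree Y \<and> locally_finite Y \<and> group_hom \<Gamma> (aut_group Y) \<phi> \<and>
     (\<forall>e\<in>parcs Y. finite (stabilizer \<Gamma> (edge_act \<phi>) e)) \<and>
     (\<lambda>E. 1 / real (card (stabilizer \<Gamma> (edge_act \<phi>) (SOME e. e \<in> E))))
       summable_on orbits \<Gamma> (parcs Y) (edge_act \<phi>)"

definition orientation_preserving ::
    "('g, 'm) monoid_scheme \<Rightarrow> 'v pair_pre_digraph \<Rightarrow> ('g \<Rightarrow> 'v \<Rightarrow> 'v) \<Rightarrow> bool" where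
  "orientation_preserving \<Gamma> Y \<phi> \<longleftrightarrow>
     (\<forall>g\<in>carrier \<Gamma>. \<forall>e\<in>parcs Y. edge_act \<phi> g e \<noteq> prod.swap e)"


section \<open>Cusps\<close>

definition rays :: "'v pair_pre_digraph \<Rightarrow> (nat \<Rightarrow> 'v \<times> 'v) set" where
  "rays Y = {r. \<forall>j. r j \<in> parcs Y \<and> snd (r j) = fst (r (Suc j)) \<and> r (Suc j) \<noteq> prod.swap (r j)}"

definition ray_equiv ::
    "'v pair_pre_digraph \<Rightarrow> ((nat \<Rightarrow> 'v \<times> 'v) \<times> (nat \<Rightarrow> 'v \<times> 'v)) set" where
  "ray_equiv Y = {(r, s). r \<in> rays Y \<and> s \<in> rays Y \<and>
     (\<exists>N::nat. \<exists>k::int. \<forall>j\<ge>N. int j + k \<ge> 0 \<and> r (nat (int j + k)) = s j)}"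

definition tree_boundary :: "'v pair_pre_digraph \<Rightarrow> (nat \<Rightarrow> 'v \<times> 'v) set set" where
  "tree_boundary Y = rays Y // ray_equiv Y"

definition same_horocycle :: "(nat \<Rightarrow> 'v \<times> 'v) set \<Rightarrow> ('v \<times> 'v) set" where
  "same_horocycle c = {(x, y). \<exists>r\<in>c. \<exists>s\<in>c. fst (r 0) = x \<and> fst (s 0) = y \<and>
     (\<exists>n. fst (r n) = fst (s n))}"

definition horocycles :: "'v pair_pre_digraph \<Rightarrow> (nat \<Rightarrow> 'v \<times> 'v) set \<Rightarrow> 'v set set" where
  "horocycles Y c = pverts Y // same_horocycle c"

definition P_stab :: "'v pair_pre_digraph \<Rightarrow> (nat \<Rightarrow> 'v \<times> 'v) set \<Rightarrow> ('v \<Rightarrow> 'v) set" where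
  "P_stab Y c = {g \<in> carrier (aut_group Y). (\<lambda>r j. map_prod g g (r j)) ` c = c}"

definition N_stab :: "'v pair_pre_digraph \<Rightarrow> (nat \<Rightarrow> 'v \<times> 'v) set \<Rightarrow> ('v \<Rightarrow> 'v) set" where
  "N_stab Y c = {g \<in> P_stab Y c. \<exists>H\<in>horocycles Y c. g ` H = H}"

definition is_cusp ::
    "('g, 'm) monoid_scheme \<Rightarrow> 'v pair_pre_digraph \<Rightarrow> ('g \<Rightarrow> 'v \<Rightarrow> 'v)
      \<Rightarrow> (nat \<Rightarrow> 'v \<times> 'v) set \<Rightarrow> bool" where
  "is_cusp \<Gamma> Y \<phi> c \<longleftrightarrow>
     c \<in> tree_boundary Y \<and>
     {g \<in> carrier \<Gamma>. \<phi> g \<in> P_stab Y c} = {g \<in> carrier \<Gamma>. \<phi> g \<in> N_stab Y c} \<and>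
     (\<exists>H\<in>horocycles Y c. \<forall>x\<in>H. \<forall>y\<in>H. \<exists>g\<in>carrier \<Gamma>. \<phi> g \<in> N_stab Y c \<and> \<phi> g x = y)"

text \<open>Whether the valencies are eventually periodic does not depend on the ray in \<open>c\<close>.\<close>

definition periodic_end :: "'v pair_pre_digraph \<Rightarrow> (nat \<Rightarrow> 'v \<times> 'v) set \<Rightarrow> bool" where
  "periodic_end Y c \<longleftrightarrow>
     (\<exists>r\<in>c. \<exists>d>0. \<exists>N. \<forall>n\<ge>N. valency Y (fst (r (n + d))) = valency Y (fst (r n)))"

definition cuspidal ::
    "('g, 'm) monoid_scheme \<Rightarrow> 'v pair_pre_digraph \<Rightarrow> ('g \<Rightarrow> 'v \<Rightarrow> 'v) \<Rightarrow> bool" where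
  "cuspidal \<Gamma> Y \<phi> \<longleftrightarrow>
     (\<exists>F S. fin_digraph F \<and> subgraph F (quotient_graph \<Gamma> Y \<phi>) \<and>
        (\<forall>E\<in>arcs F. converse E \<in> arcs F) \<and>
        finite S \<and> (\<forall>r\<in>S. \<exists>c. r \<in> c \<and> is_cusp \<Gamma> Y \<phi> c \<and> periodic_end Y c) \<and>
        verts (quotient_graph \<Gamma> Y \<phi>) =
          verts F \<union> (\<Union>r\<in>S. \<Union>j. {orbit \<Gamma> \<phi> (fst (r j))}) \<and>
        arcs (quotient_graph \<Gamma> Y \<phi>) =
          arcs F \<union> (\<Union>r\<in>S. \<Union>j. {orbit \<Gamma> (edge_act \<phi>) (r j),
                                     converse (orbit \<Gamma> (edge_act \<phi>) (r j))}))"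


section \<open>Weights and the operator \<open>T\<close>\<close>

definition tree_edge_weight ::
    "('g, 'm) monoid_scheme \<Rightarrow> ('g \<Rightarrow> 'v \<Rightarrow> 'v) \<Rightarrow> 'v \<times> 'v \<Rightarrow> nat" where
  "tree_edge_weight \<Gamma> \<phi> e =
     card (orbit (\<Gamma>\<lparr>carrier := stabilizer \<Gamma> \<phi> (fst e)\<rparr>) (edge_act \<phi>) e)"

text \<open>The choice of the preimage is immaterial, as the weight of a tree edge is constant on
  \<open>\<Gamma>\<close>-orbits; the same holds for the representatives chosen in \<open>tree_lattice\<close>,
  \<open>cycle_length\<close> and \<open>cycle_weight\<close>.\<close>

definition edge_weight ::
    "('g, 'm) monoid_scheme \<Rightarrow> ('g \<Rightarrow> 'v \<Rightarrow> 'v) \<Rightarrow> ('v \<times> 'v) set \<Rightarrow> nat" where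
  "edge_weight \<Gamma> \<phi> E = tree_edge_weight \<Gamma> \<phi> (SOME e. e \<in> E)"

definition trans_weight ::
    "('g, 'm) monoid_scheme \<Rightarrow> ('g \<Rightarrow> 'v \<Rightarrow> 'v) \<Rightarrow> ('v \<times> 'v) set \<Rightarrow> ('v \<times> 'v) set \<Rightarrow> int"
  where
  "trans_weight \<Gamma> \<phi> E E' =
     (if E' = converse E then int (edge_weight \<Gamma> \<phi> E') - 1 else int (edge_weight \<Gamma> \<phi> E'))"

text \<open>\<open>C\<^sub>1(X)\<close> consists of the finitely supported functions \<open>('v \<times> 'v) set \<Rightarrow>\<^sub>0 complex\<close> whose
  support lies in the arcs of \<open>X\<close>; \<^term>\<open>Poly_Mapping.single E 1\<close> is the basis element \<open>E\<close>.\<close>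

definition T_edge ::
    "('g, 'm) monoid_scheme \<Rightarrow> 'v pair_pre_digraph \<Rightarrow> ('g \<Rightarrow> 'v \<Rightarrow> 'v)
      \<Rightarrow> ('v \<times> 'v) set \<Rightarrow> (('v \<times> 'v) set \<Rightarrow>\<^sub>0 complex)" where
  "T_edge \<Gamma> Y \<phi> E =
     (\<Sum>E' \<in> out_arcs (quotient_graph \<Gamma> Y \<phi>) (head (quotient_graph \<Gamma> Y \<phi>) E).
        Poly_Mapping.single E' (of_int (trans_weight \<Gamma> \<phi> E E')))"

definition T_op ::
    "('g, 'm) monoid_scheme \<Rightarrow> 'v pair_pre_digraph \<Rightarrow> ('g \<Rightarrow> 'v \<Rightarrow> 'v)
      \<Rightarrow> (('v \<times> 'v) set \<Rightarrow>\<^sub>0 complex) \<Rightarrow> (('v \<times> 'v) set \<Rightarrow>\<^sub>0 complex)" where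
  "T_op \<Gamma> Y \<phi> f =
     (\<Sum>E \<in> Poly_Mapping.keys f.
        Poly_Mapping.map ((*) (Poly_Mapping.lookup f E)) (T_edge \<Gamma> Y \<phi> E))"

definition T_matrix ::
    "('g, 'm) monoid_scheme \<Rightarrow> 'v pair_pre_digraph \<Rightarrow> ('g \<Rightarrow> 'v \<Rightarrow> 'v)
      \<Rightarrow> ('v \<times> 'v) set \<Rightarrow> ('v \<times> 'v) set \<Rightarrow> complex" where
  "T_matrix \<Gamma> Y \<phi> E' E = Poly_Mapping.lookup (T_op \<Gamma> Y \<phi> (Poly_Mapping.single E 1)) E'"

definition T_stable ::
    "('g, 'm) monoid_scheme \<Rightarrow> 'v pair_pre_digraph \<Rightarrow> ('g \<Rightarrow> 'v \<Rightarrow> 'v)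
      \<Rightarrow> ('v \<times> 'v) set set \<Rightarrow> bool" where
  "T_stable \<Gamma> Y \<phi> M \<longleftrightarrow>
     M \<subseteq> arcs (quotient_graph \<Gamma> Y \<phi>) \<and>
     (\<forall>E\<in>M. Poly_Mapping.keys (T_op \<Gamma> Y \<phi> (Poly_Mapping.single E 1)) \<subseteq> M)"

definition T_connected ::
    "('g, 'm) monoid_scheme \<Rightarrow> 'v pair_pre_digraph \<Rightarrow> ('g \<Rightarrow> 'v \<Rightarrow> 'v) \<Rightarrow> bool" where
  "T_connected \<Gamma> Y \<phi> \<longleftrightarrow>
     (\<forall>M N. T_stable \<Gamma> Y \<phi> M \<and> T_stable \<Gamma> Y \<phi> N \<and>
            arcs (quotient_graph \<Gamma> Y \<phi>) = M \<union> N \<and> M \<inter> N = {} \<longrightarrow> M = {} \<or> N = {})"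


section \<open>Cycles and the Bass-Ihara zeta function\<close>

definition closed_path :: "('a, 'b) pre_digraph \<Rightarrow> 'b list \<Rightarrow> bool" where
  "closed_path G p \<longleftrightarrow> graph_path G p \<and> head G (last p) = tail G (hd p)"

definition cycles :: "('a, 'b) pre_digraph \<Rightarrow> 'b list set set" where
  "cycles G = {range (\<lambda>k. rotate k p) | p. closed_path G p}"

definition cycle_length :: "'b list set \<Rightarrow> nat" where
  "cycle_length c = length (SOME p. p \<in> c)"

definition cycle_power :: "nat \<Rightarrow> 'b list set \<Rightarrow> 'b list set" where
  "cycle_power k c = (\<lambda>p. concat (replicate k p)) ` c"

definition prime_cycles :: "('a, 'b) pre_digraph \<Rightarrow> 'b list set set" where
  "prime_cycles G = {c \<in> cycles G.
     \<not> (\<exists>c'\<in>cycles G. \<exists>k. cycle_length c' < cycle_length c \<and> c = cycle_power k c')}"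

definition path_weight ::
    "('g, 'm) monoid_scheme \<Rightarrow> ('g \<Rightarrow> 'v \<Rightarrow> 'v) \<Rightarrow> ('v \<times> 'v) set list \<Rightarrow> int" where
  "path_weight \<Gamma> \<phi> p =
     (\<Prod>j<length p. trans_weight \<Gamma> \<phi> (p ! j) (p ! (Suc j mod length p)))"

definition cycle_weight ::
    "('g, 'm) monoid_scheme \<Rightarrow> ('g \<Rightarrow> 'v \<Rightarrow> 'v) \<Rightarrow> ('v \<times> 'v) set list set \<Rightarrow> int" where
  "cycle_weight \<Gamma> \<phi> c = path_weight \<Gamma> \<phi> (SOME p. p \<in> c)"

text \<open>The product over all prime cycles is the unconditional one, i.e. the limit of the finite
  subproducts, in analogy to \<^const>\<open>infsum\<close>.\<close>

definition zeta ::
    "('g, 'm) monoid_scheme \<Rightarrow> 'v pair_pre_digraph \<Rightarrow> ('g \<Rightarrow> 'v \<Rightarrow> 'v) \<Rightarrow> complex \<Rightarrow> complex"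
  where
  "zeta \<Gamma> Y \<phi> u =
     Lim (finite_subsets_at_top (prime_cycles (quotient_graph \<Gamma> Y \<phi>)))
       (\<lambda>C. \<Prod>c\<in>C. inverse (1 - of_int (cycle_weight \<Gamma> \<phi> c) * u ^ cycle_length c))"

definition N_coeff ::
    "('g, 'm) monoid_scheme \<Rightarrow> 'v pair_pre_digraph \<Rightarrow> ('g \<Rightarrow> 'v \<Rightarrow> 'v) \<Rightarrow> nat \<Rightarrow> complex" where
  "N_coeff \<Gamma> Y \<phi> m =
     fps_nth (fps_expansion (\<lambda>u. u * deriv (zeta \<Gamma> Y \<phi>) u / zeta \<Gamma> Y \<phi> u) 0) m"

text \<open>\<open>A\<close> and \<open>B\<close> are the families \<open>(a\<^sub>j)\<close> and \<open>(b\<^sub>k)\<close> with multiplicities. They are determined by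
  the zeta function only if zeros and common entries are excluded.\<close>

definition zeta_factorization ::
    "('g, 'm) monoid_scheme \<Rightarrow> 'v pair_pre_digraph \<Rightarrow> ('g \<Rightarrow> 'v \<Rightarrow> 'v)
      \<Rightarrow> complex multiset \<Rightarrow> complex multiset \<Rightarrow> bool" where
  "zeta_factorization \<Gamma> Y \<phi> A B \<longleftrightarrow>
     0 \<notin># A \<and> 0 \<notin># B \<and> A \<inter># B = {#} \<and>
     (\<forall>\<^sub>F u in nhds 0. zeta \<Gamma> Y \<phi> u = (\<Prod>b\<in>#B. 1 - b * u) / (\<Prod>a\<in>#A. 1 - a * u))"

end

theory Submission
  imports Defs "Jordan_Normal_Form.Schur_Decomposition"
begin

text \<open>
  The matrix \<open>w\<close> of \<open>T\<close> has non-negative entries and all its row sums are \<open>q\<close>, because the weights of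
  the edges of \<open>X\<close> at a vertex count the \<open>q + 1\<close> edges of \<open>Y\<close> at a preimage (\<open>weight_sum\<close>) and
  backtracking is counted once less. So \<open>w / q\<close> is the transition matrix of a Markov chain, the image of
  the non-backtracking random walk on \<open>Y\<close>. This chain is irreducible (\<open>irreducible_X\<close>), for two
  reasons. Every vertex of the tree has at least three neighbours, so the edges of \<open>X\<close> cannot be
  partitioned into two non-empty sets that are closed under the steps of the chain
  (\<open>stable_partition_trivial\<close>); this is the connectedness in (a). And \<open>E \<mapsto> 1 / |\<Gamma>\<^sub>E|\<close> is an invariant
  measure of finite total mass, so no mass can flow into a set that no mass leaves: the complement of
  a stable set is stable (\<open>stable_complement\<close>).

  If there are cusps, the matrix is infinite. Far out in a cusp, transitivity on the horocycles forces
  the edge leading outwards to have weight \<open>1\<close> and the edge leading back to have weight \<open>q\<close>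
  (\<open>cusp_section_weights\<close>), so \<open>X\<close> consists of finitely many edges and finitely many disjoint chains of
  such edges (\<open>cusp_decomposition\<close>). An excursion that goes \<open>k\<close> steps deeper into a cusp, turns and comes
  back has length \<open>2 k + 2\<close> and weight \<open>(q - 1) q\<^sup>k\<close>. The same lengths and weights arise if the cusp is replaced by
  a loop of length \<open>2\<close> and weight \<open>q\<close>, which is run through \<open>k\<close> times. This replacement creates closed
  walks that run around the loop only, two for each even length and each cusp. Hence \<open>N\<^sub>m\<close> is the trace of
  the \<open>m\<close>-th power of the resulting finite matrix, minus \<open>2 s q\<^sup>m\<^sup>/\<^sup>2\<close> for even \<open>m\<close>, where \<open>s\<close> is the number
  of chains (\<open>closed_walks_count\<close>).

  The zeta function is the exponential of a sum over all closed paths (\<open>zeta_eq_exp\<close>), so it equals the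
  product of the \<open>1 - b u\<close> over the \<open>2 s\<close> numbers \<open>b = \<plusminus>\<surd>q\<close>, divided by the product of the \<open>1 - a u\<close> over the
  eigenvalues \<open>a\<close> of the finite matrix (\<open>zeta_main\<close>). The finite matrix is again non-negative and
  irreducible with row sums \<open>q\<close>. Therefore its eigenvalues have modulus at most \<open>q\<close>, and \<open>q\<close> is one of
  them (\<open>trace_eigenvalues\<close>); it survives the cancellation of common factors since \<open>q > \<surd>q\<close>. This gives (b).
  For (c), let \<open>\<Delta>\<close> be the period of the matrix. The trace of the \<open>m\<close>-th power vanishes unless
  \<open>\<Delta>\<close> divides \<open>m\<close>, and then it is \<open>\<Delta> q\<^sup>m\<close> up to an exponentially smaller error, because the powers of the
  normalised matrix contract on each of the \<open>\<Delta>\<close> cyclic classes (\<open>trace_asymptotics\<close>).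
\<close>

section \<open>Powers and primitive roots of words\<close>

abbreviation word_power :: "nat \<Rightarrow> 'a list \<Rightarrow> 'a list" where
  "word_power k r \<equiv> concat (replicate k r)"

definition primitive :: "'a list \<Rightarrow> bool" where
  "primitive p \<longleftrightarrow> p \<noteq> [] \<and> (\<forall>r k. word_power k r = p \<longrightarrow> r = p)"

lemma length_word_power [simp]: "length (word_power k r) = k * length r"
  by (induction k) auto

lemma word_power_mult: "word_power k (word_power l r) = word_power (k * l) r"
proof (induction k)
  case (Suc k)
  then show ?case by (simp add: replicate_add)
qed simp

lemma nth_word_power:
  "i < k * length r \<Longrightarrow> word_power k r ! i = r ! (i mod length r)"
proof (induction k arbitrary: i)
  case (Suc k)
  show ?case
  proof (cases "i < length r")
    case True
    then show ?thesis by (simp add: nth_append)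
  next
    case False
    then have "i - length r < k * length r" using Suc.prems by simp
    then show ?thesis using Suc.IH False by (simp add: nth_append le_mod_geq)
  qed
qed simp

lemma rotate_word_power: "rotate n (word_power k r) = word_power k (rotate n r)"
proof (cases "k * length r = 0")
  case True
  then have "length (word_power k r) = 0" "length (word_power k (rotate n r)) = 0" by simp_all
  then show ?thesis by (metis length_0_conv length_rotate)
next
  case False
  then have pos: "0 < length r" "0 < k" by auto
  show ?thesis
  proof (rule nth_equalityI)
    fix i assume "i < length (rotate n (word_power k r))"
    then have i: "i < k * length r" by simp
    have lt: "(n + i) mod (k * length r) < k * length r" using pos by simp
    have "rotate n (word_power k r) ! i = r ! ((n + i) mod length r)"
    proof -
      have "((n + i) mod (k * length r)) mod length r = (n + i) mod length r"
        by (rule mod_mod_cancel) simp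
      then show ?thesis using i nth_word_power[OF lt] by (simp add: nth_rotate)
    qed
    also have "\<dots> = word_power k (rotate n r) ! i"
      using i pos by (simp add: nth_word_power nth_rotate mod_simps)
    finally show "rotate n (word_power k r) ! i = word_power k (rotate n r) ! i" .
  qed simp
qed

lemma primitive_root_exists:
  "p \<noteq> [] \<Longrightarrow> \<exists>r k. k > 0 \<and> primitive r \<and> p = word_power k r"
proof (induction "length p" arbitrary: p rule: less_induct)
  case less
  show ?case
  proof (cases "primitive p")
    case True
    then show ?thesis by (intro exI[of _ p] exI[of _ "1::nat"]) auto
  next
    case False
    then obtain r k where rk: "word_power k r = p" "r \<noteq> p"
      using less.prems unfolding primitive_def by blast
    have k: "k \<noteq> 0" "k \<noteq> 1" "r \<noteq> []" using rk less.prems by (cases "k = 0"; cases "k = 1"; auto)+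
    have "length p = k * length r" using rk(1) by auto
    then have "length r < length p" using k by (cases k) auto
    from less.hyps[OF this k(3)] obtain s l where "l > 0" "primitive s" "r = word_power l s"
      by blast
    then show ?thesis using rk(1) k(1) word_power_mult[of k l s]
      by (intro exI[of _ s] exI[of _ "k * l"]) auto
  qed
qed

text \<open>Both words are prefixes of the same infinite periodic word, so they commute; commuting words
  are powers of a common one.\<close>

lemma primitive_root_unique:
  assumes "primitive r" "primitive s" "word_power k r = word_power l s" "k > 0" "l > 0"
  shows "r = s" "k = l"
proof -
  have ne: "r \<noteq> []" "s \<noteq> []" using assms unfolding primitive_def by auto
  have len: "k * length r = l * length s" using arg_cong[OF assms(3), of length] by simp
  have per: "r ! (i mod length r) = s ! (i mod length s)" for i
  proof -
    define j where "j = i mod (k * length r)"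
    have j: "j < k * length r" "j < l * length s" unfolding j_def using ne assms(4,5) len by (metis length_greater_0_conv mod_less_divisor nat_0_less_mult_iff)+
    have "j mod length r = i mod length r" unfolding j_def by (simp add: mod_mod_cancel)
    moreover have "j mod length s = i mod length s" unfolding j_def len by (simp add: mod_mod_cancel)
    ultimately show ?thesis
      using nth_word_power[OF j(1)] nth_word_power[OF j(2)] assms(3) by simp
  qed
  have "r @ s = s @ r"
  proof (rule nth_equalityI)
    fix i assume i: "i < length (r @ s)"
    have 1: "(r @ s) ! i = r ! (i mod length r)"
    proof (cases "i < length r")
      case False
      then have "(r @ s) ! i = s ! ((i - length r) mod length s)" using i by (simp add: nth_append)
      also have "\<dots> = r ! ((i - length r) mod length r)" using per by simp
      finally show ?thesis using False by (simp add: le_mod_geq)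
    qed (simp add: nth_append)
    have 2: "(s @ r) ! i = s ! (i mod length s)"
    proof (cases "i < length s")
      case False
      then have "(s @ r) ! i = r ! ((i - length s) mod length r)" using i by (simp add: nth_append)
      also have "\<dots> = s ! ((i - length s) mod length s)" using per by simp
      finally show ?thesis using False by (simp add: le_mod_geq)
    qed (simp add: nth_append)
    show "(r @ s) ! i = (s @ r) ! i" using 1 2 per by simp
  qed simp
  then obtain m n zs where "word_power m zs = r" "word_power n zs = s"
    using comm_append_are_replicate by metis
  then show "r = s" using assms(1,2) unfolding primitive_def by metis
  then show "k = l" using len ne by simp
qed

lemma rotate_inverse: "\<exists>m. rotate m (rotate n p) = p"
proof (cases "p = []")
  case False
  have "n \<le> n * length p" using False by (cases p) auto
  then have "rotate (n * length p - n) (rotate n p) = rotate (n * length p) p"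
    by (simp add: rotate_rotate)
  also have "\<dots> = p" by (subst rotate_conv_mod) simp
  finally show ?thesis by blast
qed simp

lemma primitive_rotate: "primitive p \<Longrightarrow> primitive (rotate n p)"
proof -
  assume p: "primitive p"
  have ne: "p \<noteq> []" using p unfolding primitive_def by auto
  obtain m where m: "rotate m (rotate n p) = p" using rotate_inverse by blast
  show "primitive (rotate n p)" unfolding primitive_def
  proof (intro conjI allI impI)
    fix r k assume r: "word_power k r = rotate n p"
    then have "word_power k (rotate m r) = p" using m rotate_word_power by metis
    then have "rotate m r = p" using p unfolding primitive_def by blast
    then have "length r = length p" by auto
    moreover have "k * length r = length p" using arg_cong[OF r, of length] by simp
    ultimately have "k = 1" using ne by simp
    then show "r = rotate n p" using r by simp
  qed (use ne in simp)
qed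

lemma inj_rotate_primitive:
  assumes "primitive p"
  shows "inj_on (\<lambda>k. rotate k p) {..<length p}"
proof -
  have False if ij: "i < j" "j < length p" "rotate i p = rotate j p" for i j
  proof -
    define d where "d = j - i"
    define r where "r = rotate i p"
    have d: "0 < d" "d < length p" using ij unfolding d_def by auto
    have len: "length r = length p" unfolding r_def by simp
    have "rotate d r = r" using ij unfolding r_def d_def by (subst rotate_rotate) simp
    then have "drop d r @ take d r = r" using d len by (simp add: rotate_drop_take)
    then have "drop d r @ take d r = take d r @ drop d r" by simp
    moreover have "drop d r \<noteq> []" "take d r \<noteq> []" using d len by auto
    ultimately obtain n zs where n: "n > 1" "word_power n zs = drop d r @ take d r"
      using comm_append_is_replicate by metis
    then have "word_power n zs = r" using \<open>drop d r @ take d r = r\<close> by simp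
    moreover have "primitive r" unfolding r_def using assms by (rule primitive_rotate)
    ultimately have "zs = r" "r \<noteq> []" unfolding primitive_def by auto
    then have "n * length r = length r" using \<open>word_power n zs = r\<close> length_word_power by metis
    then show False using \<open>r \<noteq> []\<close> n(1) by simp
  qed
  then show ?thesis unfolding inj_on_def by (metis lessThan_iff linorder_neqE_nat)
qed

abbreviation rotations :: "'a list \<Rightarrow> 'a list set" where
  "rotations p \<equiv> range (\<lambda>k. rotate k p)"

lemma rotations_eq: "p \<noteq> [] \<Longrightarrow> rotations p = (\<lambda>k. rotate k p) ` {..<length p}"
proof (intro equalityI subsetI)
  fix x assume "p \<noteq> []" "x \<in> rotations p"
  then obtain k where "x = rotate (k mod length p) p" using rotate_conv_mod by (metis rangeE)
  then show "x \<in> (\<lambda>k. rotate k p) ` {..<length p}" using \<open>p \<noteq> []\<close> by auto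
qed auto

lemma card_rotations: "primitive p \<Longrightarrow> card (rotations p) = length p"
  using inj_rotate_primitive[of p] rotations_eq[of p]
  by (simp add: card_image primitive_def)

lemma rotations_rotate: "rotations (rotate n p) = rotations p"
proof -
  obtain m where m: "rotate m (rotate n p) = p" using rotate_inverse by blast
  have "rotate k p = rotate (k + m) (rotate n p)" for k
    using m by (metis rotate_rotate)
  then show ?thesis by (auto simp: rotate_rotate)
qed

lemma rotations_cong: "p' \<in> rotations p \<Longrightarrow> rotations p' = rotations p"
  using rotations_rotate by (metis rangeE)

section \<open>Closed paths and prime cycles\<close>

lemma closed_path_iff:
  "closed_path G p \<longleftrightarrow> p \<noteq> [] \<and> set p \<subseteq> arcs G \<and>
     (\<forall>i<length p. head G (p ! i) = tail G (p ! (Suc i mod length p)))"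
proof -
  have "(\<forall>i<length p. head G (p ! i) = tail G (p ! (Suc i mod length p))) \<longleftrightarrow>
     (\<forall>i. Suc i < length p \<longrightarrow> head G (p ! i) = tail G (p ! Suc i)) \<and>
      head G (last p) = tail G (hd p)" (is "?l \<longleftrightarrow> ?r") if ne: "p \<noteq> []"
  proof
    assume l: ?l
    show ?r
    proof (intro conjI allI impI)
      fix i assume "Suc i < length p"
      then show "head G (p ! i) = tail G (p ! Suc i)" using l by (metis Suc_lessD mod_less)
    next
      have "head G (p ! (length p - 1)) = tail G (p ! (Suc (length p - 1) mod length p))"
        using l ne by simp
      then show "head G (last p) = tail G (hd p)" using ne by (simp add: last_conv_nth hd_conv_nth)
    qed
  next
    assume r: ?r
    show ?l
    proof (intro allI impI)
      fix i assume i: "i < length p"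
      show "head G (p ! i) = tail G (p ! (Suc i mod length p))"
      proof (cases "Suc i < length p")
        case False
        then have "Suc i = length p" using i by simp
        then show ?thesis using r ne by (metis diff_Suc_1 hd_conv_nth last_conv_nth mod_self)
      qed (use r in simp)
    qed
  qed
  then show ?thesis
    unfolding closed_path_def graph_path_def successively_conv_nth by auto
qed

lemma closed_path_rotate: "closed_path G p \<Longrightarrow> closed_path G (rotate n p)"
  unfolding closed_path_iff
proof (intro conjI allI impI; (elim conjE)?)
  fix i assume ne: "p \<noteq> []" and "i < length (rotate n p)"
    and h: "\<forall>i<length p. head G (p ! i) = tail G (p ! (Suc i mod length p))"
  then have i: "i < length p" by simp
  have "(n + i) mod length p < length p" using ne by simp
  then show "head G (rotate n p ! i) = tail G (rotate n p ! (Suc i mod length (rotate n p)))"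
    using h i ne by (simp add: nth_rotate mod_simps)
qed auto

lemma closed_path_word_power_iff:
  assumes "k > 0"
  shows "closed_path G (word_power k r) \<longleftrightarrow> closed_path G r"
proof (cases "r = []")
  case False
  have set: "set (word_power k r) = set r" using assms by auto
  have ne: "word_power k r \<noteq> []" using assms False by auto
  have eq: "word_power k r ! (Suc i mod (k * length r)) = r ! (Suc i mod length r)" for i
  proof -
    have "Suc i mod (k * length r) < k * length r" using False assms by simp
    then show ?thesis by (simp add: nth_word_power mod_mod_cancel)
  qed
  have "(\<forall>i<k * length r. head G (word_power k r ! i) = tail G (word_power k r ! (Suc i mod (k * length r))))
    \<longleftrightarrow> (\<forall>i<length r. head G (r ! i) = tail G (r ! (Suc i mod length r)))" (is "?l \<longleftrightarrow> ?r")
  proof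
    assume l: ?l
    show ?r
    proof (intro allI impI)
      fix i assume i: "i < length r"
      have "length r \<le> k * length r" using assms by simp
      then have ik: "i < k * length r" using i by linarith
      show "head G (r ! i) = tail G (r ! (Suc i mod length r))"
        using l[rule_format, OF ik] eq i nth_word_power[OF ik] by simp
    qed
  next
    assume r: ?r
    show ?l
    proof (intro allI impI)
      fix i assume i: "i < k * length r"
      have "i mod length r < length r" using False by simp
      from r[rule_format, OF this] show "head G (word_power k r ! i) = tail G (word_power k r ! (Suc i mod (k * length r)))"
        unfolding eq using i by (simp add: nth_word_power mod_Suc_eq)
    qed
  qed
  then show ?thesis unfolding closed_path_iff length_word_power using set ne False by simp
qed (auto simp: closed_path_iff)

lemma cyclesD:
  assumes "c \<in> cycles G" "p \<in> c"
  shows "closed_path G p" "c = rotations p" "p \<noteq> []"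
proof -
  obtain p0 where p0: "c = rotations p0" "closed_path G p0"
    using assms(1) unfolding cycles_def by auto
  then show "closed_path G p" using assms(2) closed_path_rotate by auto
  then show "p \<noteq> []" by (simp add: closed_path_iff)
  show "c = rotations p" using p0(1) assms(2) rotations_cong by metis
qed

lemma cycle_length_eq:
  assumes "c \<in> cycles G" "p \<in> c"
  shows "cycle_length c = length p"
proof -
  have "(SOME p. p \<in> c) \<in> c" using assms(2) by (rule someI)
  then show ?thesis unfolding cycle_length_def using cyclesD(2)[OF assms] by auto
qed

lemma cycle_power_rotations: "cycle_power k (rotations r) = rotations (word_power k r)"
  unfolding cycle_power_def by (simp add: image_image rotate_word_power)

text \<open>Powers of a cycle are the rotation classes of powers of its closed paths.\<close>

lemma prime_cycle_iff_primitive: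
  assumes "closed_path G p"
  shows "rotations p \<in> prime_cycles G \<longleftrightarrow> primitive p"
proof
  have c: "rotations p \<in> cycles G" using assms unfolding cycles_def by auto
  have pin: "p \<in> rotations p" using rangeI[of "\<lambda>k. rotate k p" 0] by simp
  have ne: "p \<noteq> []" using assms by (simp add: closed_path_iff)
  {
    assume prime: "rotations p \<in> prime_cycles G"
    show "primitive p" unfolding primitive_def
    proof (intro conjI allI impI)
      fix r k assume r: "word_power k r = p"
      then have k: "k > 0" using ne by (cases k) auto
      have cr: "closed_path G r" using r assms closed_path_word_power_iff[OF k] by metis
      then have rc: "rotations r \<in> cycles G" unfolding cycles_def by auto
      have "rotations p = cycle_power k (rotations r)" using cycle_power_rotations r by metis
      then have "\<not> cycle_length (rotations r) < cycle_length (rotations p)"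
        using prime rc unfolding prime_cycles_def by blast
      moreover have "r \<in> rotations r" using rangeI[of "\<lambda>k. rotate k r" 0] by simp
      ultimately have "length p \<le> length r"
        using cycle_length_eq[OF rc] cycle_length_eq[OF c pin] by simp
      then have "k * length r \<le> length r" using r by auto
      moreover have "length r > 0" using cr by (auto simp: closed_path_iff)
      ultimately have "k = 1" using k by (cases k) auto
      then show "r = p" using r by simp
    qed (use ne in simp)
  }
  {
    assume prim: "primitive p"
    have False if c': "c' \<in> cycles G" "cycle_length c' < cycle_length (rotations p)"
      "rotations p = cycle_power k c'" for c' k
    proof -
      obtain r where r: "r \<in> c'" "p = word_power k r"
        using c'(3) pin unfolding cycle_power_def by auto
      then have "length r < length p"
        using c' cycle_length_eq[OF c'(1)] cycle_length_eq[OF c pin] by simp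
      then show False using prim r(2) unfolding primitive_def by (metis less_irrefl)
    qed
    then show "rotations p \<in> prime_cycles G" unfolding prime_cycles_def using c by blast
  }
qed

text \<open>This is the unique factorisation that turns the product over prime cycles into a sum over closed
  paths: a prime cycle together with one of its starting points is a primitive closed path.\<close>

lemma closed_paths_powers_bij:
  "bij_betw (\<lambda>((c, p), k). word_power k p)
     ((SIGMA c:prime_cycles G. c) \<times> {0<..}) {p. closed_path G p}"
proof -
  have prim: "primitive p" "closed_path G p" "c = rotations p" if "c \<in> prime_cycles G" "p \<in> c" for c p
  proof -
    have c: "c \<in> cycles G" using that unfolding prime_cycles_def by auto
    show "closed_path G p" "c = rotations p" using cyclesD[OF c that(2)] by auto
    then show "primitive p" using that prime_cycle_iff_primitive by metis
  qed
  show ?thesis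
  proof (rule bij_betw_imageI)
    show "inj_on (\<lambda>((c, p), k). word_power k p) ((SIGMA c:prime_cycles G. c) \<times> {0<..})"
    proof (rule inj_onI)
      fix x y
      assume x: "x \<in> ((SIGMA c:prime_cycles G. c) \<times> {0<..})" and y: "y \<in> ((SIGMA c:prime_cycles G. c) \<times> {0<..})"
        and eq: "(\<lambda>((c, p), k). word_power k p) x = (\<lambda>((c, p), k). word_power k p) y"
      obtain c p k c' p' k' where xy: "x = ((c, p), k)" "y = ((c', p'), k')" by (metis surj_pair)
      have h: "c \<in> prime_cycles G" "p \<in> c" "k > 0" "c' \<in> prime_cycles G" "p' \<in> c'" "k' > 0"
        "word_power k p = word_power k' p'"
        using x y eq unfolding xy by auto
      then show "x = y"
        using primitive_root_unique[OF prim(1)[OF h(1,2)] prim(1)[OF h(4,5)] h(7,3,6)]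
          prim(3)[OF h(1,2)] prim(3)[OF h(4,5)] unfolding xy by simp
    qed
    show "(\<lambda>((c, p), k). word_power k p) ` ((SIGMA c:prime_cycles G. c) \<times> {0<..}) = {p. closed_path G p}"
    proof (intro equalityI subsetI)
      fix p assume "p \<in> {p. closed_path G p}"
      then have p: "closed_path G p" by simp
      then obtain r k where r: "k > 0" "primitive r" "p = word_power k r"
        using primitive_root_exists[of p] by (auto simp: closed_path_iff)
      then have "closed_path G r" using p closed_path_word_power_iff by metis
      then have "rotations r \<in> prime_cycles G" using r prime_cycle_iff_primitive by metis
      moreover have "r \<in> rotations r" using rangeI[of "\<lambda>k. rotate k r" 0] by simp
      ultimately show "p \<in> (\<lambda>((c, p), k). word_power k p) ` ((SIGMA c:prime_cycles G. c) \<times> {0<..})"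
        using r by (intro image_eqI[of _ _ "((rotations r, r), k)"]) auto
    next
      fix x assume "x \<in> (\<lambda>((c, p), k). word_power k p) ` ((SIGMA c:prime_cycles G. c) \<times> {0<..})"
      then obtain c p k where x: "c \<in> prime_cycles G" "p \<in> c" "k > 0" "x = word_power k p" by auto
      show "x \<in> {p. closed_path G p}"
        using prim(2)[OF x(1,2)] closed_path_word_power_iff[OF x(3)] x(4) by blast
    qed
  qed
qed

section \<open>Cyclic weights\<close>

definition cyclic_weight :: "('a \<Rightarrow> 'a \<Rightarrow> 'b::comm_monoid_mult) \<Rightarrow> 'a list \<Rightarrow> 'b" where
  "cyclic_weight w p = (\<Prod>j<length p. w (p ! j) (p ! (Suc j mod length p)))"

lemma prod_mod_shift:
  fixes g :: "nat \<Rightarrow> 'b::comm_monoid_mult"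
  assumes "l > 0"
  shows "(\<Prod>j<l. g ((n + j) mod l)) = (\<Prod>j<l. g j)"
proof (rule prod.reindex_bij_betw)
  have "inj_on (\<lambda>j. (n + j) mod l) {..<l}"
  proof (rule inj_onI)
    have *: "x = y" if "x \<le> y" "y < l" "(n + x) mod l = (n + y) mod l" for x y
    proof -
      have "l dvd (n + y) - (n + x)" using that mod_eq_dvd_iff_nat[of "n + x" "n + y" l] by simp
      then show "x = y" using that by (auto dest: dvd_imp_le)
    qed
    fix x y assume "x \<in> {..<l}" "y \<in> {..<l}" "(n + x) mod l = (n + y) mod l"
    then show "x = y" using *[of x y] *[of y x] by (cases "x \<le> y") auto
  qed
  moreover have "(\<lambda>j. (n + j) mod l) ` {..<l} \<subseteq> {..<l}" using assms by auto
  ultimately show "bij_betw (\<lambda>j. (n + j) mod l) {..<l} {..<l}"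
    by (simp add: bij_betw_def endo_inj_surj)
qed

lemma cyclic_weight_rotate: "cyclic_weight w (rotate n p) = cyclic_weight w p"
proof (cases "p = []")
  case False
  have "cyclic_weight w (rotate n p) =
     (\<Prod>j<length p. (\<lambda>i. w (p ! i) (p ! (Suc i mod length p))) ((n + j) mod length p))"
    unfolding cyclic_weight_def using False
    by (intro prod.cong) (auto simp: nth_rotate mod_simps)
  then show ?thesis using prod_mod_shift[of "length p"] False unfolding cyclic_weight_def by simp
qed (simp add: cyclic_weight_def)

lemma prod_mod_power:
  fixes g :: "nat \<Rightarrow> 'b::comm_monoid_mult"
  assumes "l > 0"
  shows "(\<Prod>j<k * l. g (j mod l)) = (\<Prod>j<l. g j) ^ k"
proof (induction k)
  case (Suc k)
  have "(\<Prod>j<Suc k * l. g (j mod l)) = (\<Prod>j<k * l. g (j mod l)) * (\<Prod>j=k*l..<k*l+l. g (j mod l))"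
    by (simp add: lessThan_atLeast0 prod.atLeastLessThan_concat add.commute)
  also have "(\<Prod>j=k*l..<k*l+l. g (j mod l)) = (\<Prod>j<l. g j)"
    using prod.shift_bounds_nat_ivl[of "\<lambda>j. g (j mod l)" 0 "k*l" l]
    by (simp add: lessThan_atLeast0 add.commute)
  finally show ?case using Suc by (simp add: mult.commute)
qed simp

lemma cyclic_weight_word_power: "cyclic_weight w (word_power k p) = cyclic_weight w p ^ k"
proof (cases "p = [] \<or> k = 0")
  case False
  then have "cyclic_weight w (word_power k p) =
     (\<Prod>j<k * length p. (\<lambda>i. w (p ! i) (p ! (Suc i mod length p))) (j mod length p))"
    unfolding cyclic_weight_def length_word_power
    by (intro prod.cong) (auto simp: nth_word_power mod_mod_cancel mod_Suc_eq)
  also have "\<dots> = cyclic_weight w p ^ k"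
    using False unfolding cyclic_weight_def by (intro prod_mod_power) simp
  finally show ?thesis .
next
  case True
  then have "{..<length (word_power k p)} = {}" by auto
  then have "cyclic_weight w (word_power k p) = 1"
    unfolding cyclic_weight_def by (simp only: prod.empty)
  moreover have "cyclic_weight w p ^ k = 1"
    using True by (cases "k = 0") (simp_all add: cyclic_weight_def)
  ultimately show ?thesis by (simp only:)
qed

section \<open>The zeta function as an exponential\<close>

lemma has_sum_minus_Ln:
  fixes z :: complex
  assumes "cmod z < 1"
  shows "((\<lambda>k. z ^ k / of_nat k) has_sum (- Ln (1 - z))) {0<..}"
proof -
  have "(\<lambda>n. - ((- (- z)) ^ n) / of_nat n) sums ln (1 + (- z))"
    by (rule Ln_series') (use assms in simp)
  then have "(\<lambda>n. z ^ n / of_nat n) sums (- Ln (1 - z))"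
    using sums_minus by fastforce
  moreover have "summable (\<lambda>n. norm (z ^ n / of_nat n))"
  proof (rule summable_comparison_test')
    show "summable (\<lambda>n. cmod z ^ n)" using assms by (simp add: summable_geometric)
    show "norm (norm (z ^ n / of_nat n)) \<le> cmod z ^ n" if "n \<ge> 1" for n
    proof -
      have "cmod z ^ n / real n \<le> cmod z ^ n / 1" using that by (intro divide_left_mono) auto
      then show ?thesis by (simp add: norm_divide norm_power)
    qed
  qed
  ultimately have "((\<lambda>n. z ^ n / of_nat n) has_sum (- Ln (1 - z))) UNIV"
    by (intro norm_summable_imp_has_sum)
  then show ?thesis by (rule has_sum_cong_neutral[THEN iffD1, rotated -1]) auto
qed

lemma cycle_weight_eq:
  assumes "c \<in> cycles G" "p \<in> c"
  shows "cycle_weight \<Gamma> \<phi> c = path_weight \<Gamma> \<phi> p"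
proof -
  have pw: "path_weight \<Gamma> \<phi> = cyclic_weight (trans_weight \<Gamma> \<phi>)"
    by (rule ext) (simp add: path_weight_def cyclic_weight_def)
  have "(SOME p. p \<in> c) \<in> c" using assms(2) by (rule someI)
  then obtain n where "(SOME p. p \<in> c) = rotate n p" using cyclesD(2)[OF assms] by auto
  then show ?thesis unfolding cycle_weight_def pw by (simp add: cyclic_weight_rotate)
qed

text \<open>The logarithm of the factor of a prime cycle \<open>c\<close> is the sum of \<open>z\<^sup>k / k\<close> over all \<open>k > 0\<close>, where
  \<open>z\<close> is its term. A prime cycle consists of exactly \<open>l(c)\<close> closed paths, so the sum of
  \<open>z\<^sup>k / (k l(c))\<close> over these paths and over \<open>k\<close> gives the same logarithm, and the paths \<open>p\<^sup>k\<close> are all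
  closed paths.\<close>

lemma zeta_eq_exp:
  fixes \<Gamma> :: "('g, 'm) monoid_scheme"
  defines "W \<equiv> \<lambda>\<phi> p. of_int (path_weight \<Gamma> \<phi> p) :: complex"
  assumes sum: "((\<lambda>p. W \<phi> p * u ^ length p / of_nat (length p)) has_sum S)
                  {p. closed_path (quotient_graph \<Gamma> Y \<phi>) p}"
    and lt: "\<And>p. closed_path (quotient_graph \<Gamma> Y \<phi>) p \<Longrightarrow> cmod (W \<phi> p * u ^ length p) < 1"
  shows "zeta \<Gamma> Y \<phi> u = exp S"
proof -
  define G where "G = quotient_graph \<Gamma> Y \<phi>"
  define PC where "PC = prime_cycles G"
  define z where "z c = of_int (cycle_weight \<Gamma> \<phi> c) * u ^ cycle_length c" for c
  have cyc: "c \<in> cycles G" "\<exists>p. p \<in> c \<and> primitive p \<and> closed_path G p \<and> c = rotations p"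
    if c: "c \<in> PC" for c
  proof -
    show "c \<in> cycles G" using c unfolding PC_def prime_cycles_def by auto
    then obtain p where p: "closed_path G p" "c = rotations p" unfolding cycles_def by auto
    then have "primitive p" using c prime_cycle_iff_primitive unfolding PC_def by metis
    moreover have "p \<in> rotations p" using rangeI[of "\<lambda>k. rotate k p" 0] by simp
    ultimately show "\<exists>p. p \<in> c \<and> primitive p \<and> closed_path G p \<and> c = rotations p" using p by blast
  qed
  have zp: "z c = W \<phi> p * u ^ length p" "cycle_length c = length p" if "c \<in> PC" "p \<in> c" for c p
    using cycle_weight_eq[OF cyc(1)[OF that(1)] that(2), of \<Gamma> \<phi>] cycle_length_eq[OF cyc(1)[OF that(1)] that(2)]
    unfolding z_def W_def by simp_all
  have zlt: "cmod (z c) < 1" if c: "c \<in> PC" for c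
  proof -
    obtain p where p: "p \<in> c" "closed_path G p" using cyc(2)[OF c] by blast
    then show ?thesis using zp(1)[OF c p(1)] lt[of p] unfolding G_def by simp
  qed
  have cardc: "finite c" "card c = cycle_length c" "cycle_length c > 0" if c: "c \<in> PC" for c
  proof -
    obtain p where p: "p \<in> c" "primitive p" "c = rotations p" using cyc(2)[OF c] by blast
    then have "p \<noteq> []" unfolding primitive_def by simp
    then show "finite c" using p(3) rotations_eq[of p] by simp
    show "card c = cycle_length c" using card_rotations[OF p(2)] p(3) zp(2)[OF c p(1)] by simp
    show "cycle_length c > 0" using \<open>p \<noteq> []\<close> zp(2)[OF c p(1)] by simp
  qed
  have pw: "W \<phi> (word_power k p) = W \<phi> p ^ k" for k p
  proof -
    have "path_weight \<Gamma> \<phi> = cyclic_weight (trans_weight \<Gamma> \<phi>)"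
      by (rule ext) (simp add: path_weight_def cyclic_weight_def)
    then show ?thesis unfolding W_def by (simp add: cyclic_weight_word_power)
  qed
  \<comment> \<open>Every closed path is a power of a unique primitive one, so the sum may be taken over
    prime cycles, their closed paths, and exponents.\<close>
  define f where "f p = W \<phi> p * u ^ length p / of_nat (length p)" for p
  have "((\<lambda>x. f ((\<lambda>((c, p), k). word_power k p) x)) has_sum S) ((SIGMA c:PC. c) \<times> {0<..})"
    using has_sum_reindex_bij_betw[OF closed_paths_powers_bij[of G], of f S] sum
    unfolding f_def G_def PC_def by blast
  then have "((\<lambda>cp. - Ln (1 - z (fst cp)) / of_nat (cycle_length (fst cp))) has_sum S) (SIGMA c:PC. c)"
  proof (rule has_sum_SigmaD)
    fix cp assume "cp \<in> (SIGMA c:PC. c)"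
    then obtain c p where cp: "cp = (c, p)" "c \<in> PC" "p \<in> c" by auto
    have "((\<lambda>k. (z c ^ k / of_nat k) * (1 / of_nat (cycle_length c))) has_sum
       (- Ln (1 - z c)) * (1 / of_nat (cycle_length c))) {0<..}"
      by (intro has_sum_cmult_left has_sum_minus_Ln zlt cp)
    moreover have "W \<phi> (word_power k p) * u ^ (k * length p) / of_nat (k * length p) =
        (z c ^ k / of_nat k) * (1 / of_nat (cycle_length c))" for k
      using zp[OF cp(2,3)] pw[of k p]
      by (simp add: power_mult_distrib power_mult mult.commute[of k])
    ultimately show "((\<lambda>y. f ((\<lambda>((c, p), k). word_power k p) (cp, y))) has_sum
       - Ln (1 - z (fst cp)) / of_nat (cycle_length (fst cp))) {0<..}"
      unfolding cp(1) f_def by (simp del: length_concat)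
  qed
  then have logs: "((\<lambda>c. - Ln (1 - z c)) has_sum S) PC"
  proof (rule has_sum_SigmaD)
    fix c assume c: "c \<in> PC"
    show "((\<lambda>y. - Ln (1 - z (fst (c, y))) / of_nat (cycle_length (fst (c, y)))) has_sum - Ln (1 - z c)) c"
      using cardc[OF c] by (intro has_sum_finiteI) (auto simp: field_simps)
  qed
  have "((\<lambda>C. exp (\<Sum>c\<in>C. - Ln (1 - z c))) \<longlongrightarrow> exp S) (finite_subsets_at_top PC)"
    using logs unfolding has_sum_def by (rule tendsto_exp)
  moreover have "exp (\<Sum>c\<in>C. - Ln (1 - z c)) = (\<Prod>c\<in>C. inverse (1 - z c))" if "finite C" "C \<subseteq> PC" for C
  proof -
    have "exp (\<Sum>c\<in>C. - Ln (1 - z c)) = (\<Prod>c\<in>C. exp (- Ln (1 - z c)))" using that by (simp add: exp_sum)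
    also have "\<dots> = (\<Prod>c\<in>C. inverse (1 - z c))"
    proof (rule prod.cong)
      fix c assume "c \<in> C"
      then have "1 - z c \<noteq> 0" using zlt[of c] that by (metis norm_one right_minus_eq less_irrefl subsetD)
      then show "exp (- Ln (1 - z c)) = inverse (1 - z c)" by (simp add: exp_minus)
    qed simp
    finally show ?thesis .
  qed
  ultimately have "((\<lambda>C. \<Prod>c\<in>C. inverse (1 - z c)) \<longlongrightarrow> exp S) (finite_subsets_at_top PC)"
    by (rule Lim_transform_eventually[OF _ eventually_finite_subsets_at_top_weakI])
  then show ?thesis unfolding zeta_def PC_def z_def G_def
    by (intro tendsto_Lim) auto
qed

lemma exp_sum_mset: "exp (\<Sum>x\<in>#A. f x) = (\<Prod>x\<in>#A. exp (f x :: complex))"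
  by (induction A) (auto simp: exp_add)

lemma has_sum_sum_mset:
  fixes f :: "'i \<Rightarrow> 'b \<Rightarrow> complex"
  assumes "\<And>i. i \<in># A \<Longrightarrow> (f i has_sum s i) X"
  shows "((\<lambda>x. \<Sum>i\<in>#A. f i x) has_sum (\<Sum>i\<in>#A. s i)) X"
  using assms by (induction A) (auto intro: has_sum_add)

text \<open>The closed paths of length \<open>m\<close> contribute the \<open>m\<close>-th term of the logarithm of the zeta
  function, so if their weighted number is a difference of power sums, then the logarithm is
  a combination of logarithms of linear factors.\<close>

lemma zeta_rational:
  fixes \<Gamma> :: "('g, 'm) monoid_scheme" and A B :: "complex multiset" and q :: real
  defines "P \<equiv> \<lambda>\<phi> Y m. {p. closed_path (quotient_graph \<Gamma> Y \<phi>) p \<and> length p = m \<and> path_weight \<Gamma> \<phi> p \<noteq> 0}"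
  assumes fin: "\<And>m. m > 0 \<Longrightarrow> finite (P \<phi> Y m)"
    and nonneg: "\<And>p. closed_path (quotient_graph \<Gamma> Y \<phi>) p \<Longrightarrow> path_weight \<Gamma> \<phi> p \<ge> 0"
    and bound: "\<And>p. closed_path (quotient_graph \<Gamma> Y \<phi>) p \<Longrightarrow> path_weight \<Gamma> \<phi> p \<le> q ^ length p"
    and count: "\<And>m. m > 0 \<Longrightarrow>
       of_int (\<Sum>p\<in>P \<phi> Y m. path_weight \<Gamma> \<phi> p) = (\<Sum>a\<in>#A. a ^ m) - (\<Sum>b\<in>#B. b ^ m)"
    and roots: "\<And>a. a \<in># A + B \<Longrightarrow> cmod a \<le> q"
    and q: "q > 0" and u: "cmod u * q < 1"
  shows "zeta \<Gamma> Y \<phi> u = (\<Prod>b\<in>#B. 1 - b * u) / (\<Prod>a\<in>#A. 1 - a * u)"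
proof -
  define C where "C = {p. closed_path (quotient_graph \<Gamma> Y \<phi>) p}"
  define W where "W p = (of_int (path_weight \<Gamma> \<phi> p) :: complex)" for p
  define f where "f p = W p * u ^ length p / of_nat (length p)" for p
  define N where "N m = (of_int (\<Sum>p\<in>P \<phi> Y m. path_weight \<Gamma> \<phi> p) :: complex)" for m
  define t where "t = cmod u * q"
  define D where "D = real (size A + size B)"
  have t: "0 \<le> t" "t < 1" unfolding t_def using u q by auto
  have pos: "length p > 0" if "p \<in> C" for p using that unfolding C_def by (auto simp: closed_path_iff)
  have root_bd: "cmod (\<Sum>a\<in>#X. a ^ m) \<le> real (size X) * q ^ m" if "X \<subseteq># A + B" for X m
  proof -
    have "\<forall>a\<in>#X. cmod a \<le> q" using that roots by (meson mset_subset_eqD)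
    then show ?thesis
    proof (induction X)
      case (add x X)
      then have "cmod (x ^ m) \<le> q ^ m" by (simp add: norm_power power_mono)
      then show ?case using add norm_triangle_ineq[of "x ^ m" "\<Sum>a\<in>#X. a ^ m"]
        by (auto simp: algebra_simps)
    qed simp
  qed
  have Nbd: "cmod (N m) \<le> D * q ^ m" if "m > 0" for m
  proof -
    have "cmod (N m) \<le> cmod (\<Sum>a\<in>#A. a ^ m) + cmod (\<Sum>b\<in>#B. b ^ m)"
      unfolding N_def count[OF that] by (rule norm_triangle_ineq4)
    also have "\<dots> \<le> real (size A) * q ^ m + real (size B) * q ^ m"
      by (intro add_mono root_bd) auto
    finally show ?thesis unfolding D_def by (simp add: algebra_simps)
  qed
  have Nreal: "(\<Sum>p\<in>P \<phi> Y m. cmod (f p)) \<le> D * t ^ m" if m: "m > 0" for m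
  proof -
    have "(\<Sum>p\<in>P \<phi> Y m. cmod (f p)) = (\<Sum>p\<in>P \<phi> Y m. cmod u ^ m / real m * of_int (path_weight \<Gamma> \<phi> p))"
      by (intro sum.cong) (auto simp: P_def f_def W_def norm_mult norm_divide norm_power nonneg)
    also have "\<dots> = cmod u ^ m / real m * cmod (N m)"
    proof -
      have "(\<Sum>p\<in>P \<phi> Y m. path_weight \<Gamma> \<phi> p) \<ge> 0"
        by (rule sum_nonneg) (auto simp: P_def nonneg)
      then have "cmod (N m) = of_int (\<Sum>p\<in>P \<phi> Y m. path_weight \<Gamma> \<phi> p)"
        unfolding N_def by (metis norm_of_int abs_of_nonneg of_int_0_le_iff)
      then show ?thesis by (simp add: sum_distrib_left)
    qed
    also have "\<dots> \<le> cmod u ^ m / 1 * (D * q ^ m)"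
      using Nbd[OF m] m by (intro mult_mono divide_left_mono) auto
    finally show ?thesis unfolding t_def by (simp add: power_mult_distrib algebra_simps)
  qed
  define C' where "C' = {p \<in> C. W p \<noteq> 0}"
  have PC': "P \<phi> Y m = {p \<in> C'. length p = m}" for m unfolding P_def C'_def C_def W_def by auto
  have "(\<lambda>p. norm (f p)) summable_on C'"
  proof (rule nonneg_bdd_above_summable_on)
    have "sum (\<lambda>p. norm (f p)) F \<le> D * (1 / (1 - t))" if F: "F \<subseteq> C'" "finite F" for F
    proof -
      define M where "M = Suc (Max (insert 0 (length ` F)))"
      have M: "length p < M" if "p \<in> F" for p
        unfolding M_def using that F(2) by (auto simp: less_Suc_eq_le)
      have "sum (\<lambda>p. norm (f p)) F \<le> sum (\<lambda>p. norm (f p)) (\<Union>m\<in>{0<..<M}. P \<phi> Y m)"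
      proof (rule sum_mono2)
        show "finite (\<Union>m\<in>{0<..<M}. P \<phi> Y m)" using fin by auto
        show "F \<subseteq> (\<Union>m\<in>{0<..<M}. P \<phi> Y m)" using M F(1) pos by (auto simp: PC' C'_def)
      qed simp
      also have "\<dots> = (\<Sum>m\<in>{0<..<M}. \<Sum>p\<in>P \<phi> Y m. norm (f p))"
        by (rule sum.UNION_disjoint) (auto simp: fin, auto simp: P_def)
      also have "\<dots> \<le> (\<Sum>m\<in>{0<..<M}. D * t ^ m)" by (intro sum_mono Nreal) auto
      also have "\<dots> = D * (\<Sum>m\<in>{0<..<M}. t ^ m)" by (simp add: sum_distrib_left)
      also have "\<dots> \<le> D * (\<Sum>m<M. t ^ m)"
        using t unfolding D_def by (intro mult_left_mono sum_mono2) auto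
      also have "\<dots> \<le> D * (1 / (1 - t))"
        using t unfolding D_def by (intro mult_left_mono) (auto simp: sum_gp_strict divide_right_mono)
      finally show ?thesis .
    qed
    then show "bdd_above (sum (\<lambda>p. norm (f p)) ` {F. F \<subseteq> C' \<and> finite F})"
      by (auto simp: bdd_above_def)
  qed simp
  then have "f summable_on C'" by (rule abs_summable_summable)
  then obtain S where S: "(f has_sum S) C'" unfolding summable_on_def by blast
  have bij: "bij_betw snd (SIGMA m:{0<..}. P \<phi> Y m) C'"
  proof (rule bij_betw_imageI)
    show "inj_on snd (SIGMA m:{0<..}. P \<phi> Y m)" by (auto simp: inj_on_def PC')
    show "snd ` (SIGMA m:{0<..}. P \<phi> Y m) = C'"
      using pos by (force simp: PC' C'_def image_iff)
  qed
  have "((\<lambda>x. f (snd x)) has_sum S) (SIGMA m:{0<..}. P \<phi> Y m)"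
    unfolding has_sum_reindex_bij_betw[OF bij] by (rule S)
  then have "((\<lambda>m. N m * u ^ m / of_nat m) has_sum S) {0<..}"
  proof (rule has_sum_SigmaD)
    fix m :: nat assume "m \<in> {0<..}"
    then show "((\<lambda>y. f (snd (m, y))) has_sum (N m * u ^ m / of_nat m)) (P \<phi> Y m)"
      using fin by (intro has_sum_finiteI)
        (auto simp: N_def f_def W_def P_def sum_divide_distrib sum_distrib_right intro!: sum.cong)
  qed
  moreover have "((\<lambda>m. N m * u ^ m / of_nat m) has_sum
     ((\<Sum>a\<in>#A. - Ln (1 - a * u)) - (\<Sum>b\<in>#B. - Ln (1 - b * u)))) {0<..}"
  proof (rule has_sum_cong[THEN iffD1])
    have lt: "cmod (a * u) < 1" if "a \<in># A + B" for a
    proof -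
      have "cmod (a * u) \<le> q * cmod u" unfolding norm_mult using roots[OF that] by (intro mult_right_mono) auto
      then show ?thesis using u by (simp add: mult.commute)
    qed
    have "((\<lambda>m. \<Sum>b\<in>#B. (b * u) ^ m / of_nat m) has_sum (\<Sum>b\<in>#B. - Ln (1 - b * u))) {0<..}"
      by (intro has_sum_sum_mset has_sum_minus_Ln lt) auto
    then have "((\<lambda>m. - (\<Sum>b\<in>#B. (b * u) ^ m / of_nat m)) has_sum (- (\<Sum>b\<in>#B. - Ln (1 - b * u)))) {0<..}"
      by (simp only: has_sum_uminus minus_minus)
    moreover have "((\<lambda>m. \<Sum>a\<in>#A. (a * u) ^ m / of_nat m) has_sum (\<Sum>a\<in>#A. - Ln (1 - a * u))) {0<..}"
      by (intro has_sum_sum_mset has_sum_minus_Ln lt) auto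
    ultimately show "((\<lambda>m. (\<Sum>a\<in>#A. (a * u) ^ m / of_nat m) - (\<Sum>b\<in>#B. (b * u) ^ m / of_nat m)) has_sum
      ((\<Sum>a\<in>#A. - Ln (1 - a * u)) - (\<Sum>b\<in>#B. - Ln (1 - b * u)))) {0<..}"
      using has_sum_add by fastforce
    fix m :: nat assume "m \<in> {0<..}"
    then have Nm: "N m = (\<Sum>a\<in>#A. a ^ m) - (\<Sum>b\<in>#B. b ^ m)" unfolding N_def using count by simp
    then show "(\<Sum>a\<in>#A. (a * u) ^ m / of_nat m) - (\<Sum>b\<in>#B. (b * u) ^ m / of_nat m) =
        N m * u ^ m / of_nat m"
    proof -
      have "(\<Sum>a\<in>#X. (a * u) ^ m / of_nat m) = (\<Sum>a\<in>#X. a ^ m) * (u ^ m / of_nat m)" for X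
        unfolding sum_mset_distrib_right by (simp add: power_mult_distrib)
      then show ?thesis using Nm by (simp only: left_diff_distrib diff_divide_distrib times_divide_eq_right)
    qed
  qed
  ultimately have S_eq: "S = (\<Sum>a\<in>#A. - Ln (1 - a * u)) - (\<Sum>b\<in>#B. - Ln (1 - b * u))"
    by (rule has_sum_unique)
  have "(f has_sum S) C"
    using S by (rule has_sum_cong_neutral[THEN iffD1, rotated -1]) (auto simp: C'_def f_def)
  moreover have "cmod (W p * u ^ length p) < 1" if p: "p \<in> C" for p
  proof -
    have "cmod (W p) \<le> q ^ length p"
      using bound nonneg p unfolding W_def C_def by simp
    then have "cmod (W p * u ^ length p) \<le> q ^ length p * cmod u ^ length p"
      unfolding norm_mult norm_power by (intro mult_right_mono) auto
    also have "\<dots> = t ^ length p" unfolding t_def by (simp add: power_mult_distrib)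
    also have "\<dots> < 1" using t pos[OF p] by (simp add: power_less_one_iff)
    finally show ?thesis .
  qed
  ultimately have "zeta \<Gamma> Y \<phi> u = exp S"
    unfolding f_def W_def C_def by (intro zeta_eq_exp) auto
  also have "\<dots> = (\<Prod>b\<in>#B. exp (Ln (1 - b * u))) / (\<Prod>a\<in>#A. exp (Ln (1 - a * u)))"
  proof -
    have "(\<Sum>a\<in>#X. - Ln (1 - a * u)) = - (\<Sum>a\<in>#X. Ln (1 - a * u))" for X
      by (induction X) auto
    then show ?thesis unfolding S_eq by (simp add: exp_diff exp_minus exp_sum_mset divide_simps)
  qed
  also have "\<dots> = (\<Prod>b\<in>#B. 1 - b * u) / (\<Prod>a\<in>#A. 1 - a * u)"
  proof -
    have "1 - a * u \<noteq> 0" if "a \<in># A + B" for a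
    proof
      assume "1 - a * u = 0"
      then have "cmod (a * u) = 1" by simp
      moreover have "cmod (a * u) \<le> q * cmod u" unfolding norm_mult using roots[OF that] by (intro mult_right_mono) auto
      ultimately show False using u by (simp add: mult.commute)
    qed
    then have "image_mset (\<lambda>a. exp (Ln (1 - a * u))) X = image_mset (\<lambda>a. 1 - a * u) X" if "X \<subseteq># A + B" for X
      using that by (intro image_mset_cong) (meson exp_Ln mset_subset_eqD)
    then show ?thesis by simp
  qed
  finally show ?thesis .
qed

section \<open>Logarithmic derivatives and factorisations of rational functions\<close>

lemma eventually_small:
  fixes A :: "complex multiset"
  shows "\<forall>\<^sub>F u in nhds 0. \<forall>a\<in>#A. cmod (a * u) < 1"
proof -
  have "\<forall>\<^sub>F u in nhds 0. cmod (a * u) < 1" for a :: complex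
  proof -
    have "((\<lambda>u. cmod (a * u)) \<longlongrightarrow> cmod (a * 0)) (nhds 0)"
      by (intro tendsto_intros filterlim_ident)
    then show ?thesis by (intro order_tendstoD(2)) auto
  qed
  then show ?thesis by (intro eventually_ball_finite) auto
qed

lemma one_minus_nonzero: "cmod z < 1 \<Longrightarrow> 1 - z \<noteq> 0"
  by auto

lemma linear_prod_nonzero:
  fixes A :: "complex multiset"
  shows "(\<forall>a\<in>#A. cmod (a * u) < 1) \<Longrightarrow> (\<Prod>a\<in>#A. 1 - a * u) \<noteq> 0"
  by (induction A) (auto dest: one_minus_nonzero)

lemma linear_prod_deriv:
  fixes A :: "complex multiset"
  assumes "\<forall>a\<in>#A. cmod (a * u) < 1"
  shows "((\<lambda>u. \<Prod>a\<in>#A. 1 - a * u) has_field_derivative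
     (- (\<Sum>a\<in>#A. a / (1 - a * u)) * (\<Prod>a\<in>#A. 1 - a * u))) (at u)"
  using assms
proof (induction A)
  case (add x A)
  have nz: "1 - x * u \<noteq> 0" using add.prems by (intro one_minus_nonzero) simp
  have "((\<lambda>u. (1 - x * u) * (\<Prod>a\<in>#A. 1 - a * u)) has_field_derivative
     (- x * (\<Prod>a\<in>#A. 1 - a * u) + - (\<Sum>a\<in>#A. a / (1 - a * u)) * (\<Prod>a\<in>#A. 1 - a * u) * (1 - x * u))) (at u)"
  proof (rule DERIV_mult)
    show "((\<lambda>u. 1 - x * u) has_field_derivative - x) (at u)" by (auto intro!: derivative_eq_intros)
    show "((\<lambda>u. \<Prod>a\<in>#A. 1 - a * u) has_field_derivative
       - (\<Sum>a\<in>#A. a / (1 - a * u)) * (\<Prod>a\<in>#A. 1 - a * u)) (at u)"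
      using add.prems by (intro add.IH) simp
  qed
  moreover have "- x * (\<Prod>a\<in>#A. 1 - a * u) + - (\<Sum>a\<in>#A. a / (1 - a * u)) * (\<Prod>a\<in>#A. 1 - a * u) * (1 - x * u) =
     - (\<Sum>a\<in>#add_mset x A. a / (1 - a * u)) * (\<Prod>a\<in>#add_mset x A. 1 - a * u)"
  proof -
    have "- x * p + - s * p * d = - (x / d + s) * (d * p)" if "d \<noteq> 0" for s p d :: complex
      using that by (simp add: field_simps)
    then show ?thesis using nz by simp
  qed
  ultimately show ?case by simp
qed simp

lemma sums_sum_mset:
  fixes f :: "'i \<Rightarrow> nat \<Rightarrow> complex"
  assumes "\<And>i. i \<in># A \<Longrightarrow> f i sums s i"
  shows "(\<lambda>n. \<Sum>i\<in>#A. f i n) sums (\<Sum>i\<in>#A. s i)"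
  using assms by (induction A) (auto intro: sums_add)

lemma power_sums_series:
  fixes A :: "complex multiset"
  assumes "\<forall>a\<in>#A. cmod (a * u) < 1"
  shows "(\<lambda>n. (if n = 0 then 0 else \<Sum>a\<in>#A. a ^ n) * u ^ n) sums (\<Sum>a\<in>#A. a * u / (1 - a * u))"
proof -
  have "(\<lambda>n. if n = 0 then 0 else (a * u) ^ n) sums (a * u / (1 - a * u))" if "a \<in># A" for a
  proof -
    have "(\<lambda>n. (a * u) * (a * u) ^ n) sums ((a * u) * (1 / (1 - a * u)))"
      using assms that by (intro sums_mult geometric_sums) auto
    then show ?thesis by (subst sums_Suc_iff[symmetric, where f = "\<lambda>n. if n = 0 then 0 else (a * u) ^ n", simplified]) simp
  qed
  then have "(\<lambda>n. \<Sum>a\<in>#A. if n = 0 then 0 else (a * u) ^ n) sums (\<Sum>a\<in>#A. a * u / (1 - a * u))"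
    by (rule sums_sum_mset)
  moreover have "(\<Sum>a\<in>#A. if n = 0 then 0 else (a * u) ^ n) = (if n = 0 then 0 else \<Sum>a\<in>#A. a ^ n) * u ^ n" for n
    by (simp add: power_mult_distrib sum_mset_distrib_right)
  ultimately show ?thesis by simp
qed

text \<open>The logarithmic derivative of \<open>1 - a u\<close> is \<open>- a / (1 - a u)\<close>, a geometric series.\<close>

lemma log_derivative_coefficients:
  fixes A B :: "complex multiset"
  assumes ev: "\<forall>\<^sub>F u in nhds 0. f u = (\<Prod>b\<in>#B. 1 - b * u) / (\<Prod>a\<in>#A. 1 - a * u)" and m: "m > 0"
  shows "fps_nth (fps_expansion (\<lambda>u. u * deriv f u / f u) 0) m = (\<Sum>a\<in>#A. a ^ m) - (\<Sum>b\<in>#B. b ^ m)"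
proof -
  let ?P = "\<lambda>A u. \<Prod>a\<in>#A. 1 - a * u" and ?S = "\<lambda>A u. \<Sum>a\<in>#A. a / (1 - a * u)"
  define F where "F = Abs_fps (\<lambda>n. (if n = 0 then 0 else \<Sum>a\<in>#A. a ^ n) - (if n = 0 then 0 else \<Sum>b\<in>#B. b ^ n))"
  have ev2: "\<forall>\<^sub>F u in nhds 0. \<forall>\<^sub>F v in nhds u. f v = ?P B v / ?P A v"
    using ev by (simp add: eventually_eventually)
  have "\<forall>\<^sub>F u in nhds 0. (\<lambda>n. fps_nth F n * u ^ n) sums (u * deriv f u / f u)"
    using ev2 eventually_small[of A] eventually_small[of B]
  proof eventually_elim
    case (elim u)
    have nz: "?P A u \<noteq> 0" "?P B u \<noteq> 0" using linear_prod_nonzero elim by blast+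
    have "((\<lambda>u. ?P B u / ?P A u) has_field_derivative
        ((- ?S B u * ?P B u) * ?P A u - ?P B u * (- ?S A u * ?P A u)) / (?P A u * ?P A u)) (at u)"
      by (intro DERIV_divide linear_prod_deriv elim nz)
    then have "deriv (\<lambda>u. ?P B u / ?P A u) u =
        ((- ?S B u * ?P B u) * ?P A u - ?P B u * (- ?S A u * ?P A u)) / (?P A u * ?P A u)"
      by (rule DERIV_imp_deriv)
    also have "\<dots> = (?S A u - ?S B u) * (?P B u / ?P A u)"
    proof -
      have "((- x * p) * p' - p * (- y * p')) / (p' * p') = (y - x) * (p / p')" if "p' \<noteq> 0" for x y p p' :: complex
        using that by (simp add: field_simps)
      then show ?thesis using nz(1) by blast
    qed
    also have "deriv (\<lambda>u. ?P B u / ?P A u) u = deriv f u"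
      by (rule deriv_cong_ev[symmetric]) (use elim in auto)
    finally have "deriv f u = (?S A u - ?S B u) * f u"
      using eventually_nhds_x_imp_x[OF elim(1)] by simp
    moreover have "f u \<noteq> 0" using eventually_nhds_x_imp_x[OF elim(1)] nz by simp
    ultimately have "u * deriv f u / f u = (?S A u - ?S B u) * u" by simp
    also have "\<dots> = (\<Sum>a\<in>#A. a * u / (1 - a * u)) - (\<Sum>b\<in>#B. b * u / (1 - b * u))"
      by (simp add: left_diff_distrib sum_mset_distrib_right)
    finally show ?case
      using sums_diff[OF power_sums_series[OF elim(2)] power_sums_series[OF elim(3)]]
      unfolding F_def by (simp add: left_diff_distrib)
  qed
  then have "(\<lambda>u. u * deriv f u / f u) has_fps_expansion F" by (rule has_fps_expansionI)
  then have "fps_expansion (\<lambda>u. u * deriv f u / f u) 0 = F" by (rule fps_expansion_eqI)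
  then show ?thesis using m unfolding F_def by simp
qed

text \<open>The entries are the inverses of the roots, so they can be split off one at a time.\<close>

lemma linear_poly_prod_inject:
  fixes M M' :: "complex multiset"
  assumes "0 \<notin># M" "0 \<notin># M'" "(\<Prod>a\<in>#M. [:1, - a:]) = (\<Prod>a\<in>#M'. [:1, - a:])"
  shows "M = M'"
  using assms
proof (induction M arbitrary: M')
  case empty
  show ?case
  proof (rule ccontr)
    assume "{#} \<noteq> M'"
    then obtain a N where a: "M' = add_mset a N" by (metis multiset_cases)
    then have "poly (\<Prod>a\<in>#M'. [:1, - a:]) (1 / a) = 0" using empty(2) by simp
    then show False using empty(3) by (metis image_mset_empty one_neq_zero poly_1 prod_mset_empty)
  qed
next
  case (add x M)
  have "poly (\<Prod>a\<in>#M'. [:1, - a:]) (1 / x) = 0"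
    unfolding add.prems(3)[symmetric] using add.prems(1) by simp
  then obtain a where a: "a \<in># M'" "poly [:1, - a:] (1 / x) = 0"
    by (auto simp: poly_prod_mset image_iff)
  have "a = x" using a(2) add.prems(1) by (simp add: field_simps)
  then obtain N where N: "M' = add_mset x N" using a(1) by (metis multi_member_split)
  have "[:1, - x:] * (\<Prod>a\<in>#M. [:1, - a:]) = [:1, - x:] * (\<Prod>a\<in>#N. [:1, - a:])"
    using add.prems(3) unfolding N by simp
  then have "(\<Prod>a\<in>#M. [:1, - a:]) = (\<Prod>a\<in>#N. [:1, - a:])"
    by (subst (asm) mult_left_cancel) simp_all
  then have "M = N" using add.prems unfolding N by (intro add.IH) auto
  then show ?case unfolding N by simp
qed

text \<open>Polynomials that agree near \<open>0\<close> agree at infinitely many points.\<close>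

lemma linear_prod_inject:
  fixes M M' :: "complex multiset"
  assumes "0 \<notin># M" "0 \<notin># M'" "\<forall>\<^sub>F u in nhds 0. (\<Prod>a\<in>#M. 1 - a * u) = (\<Prod>a\<in>#M'. 1 - a * u)"
  shows "M = M'"
proof (rule linear_poly_prod_inject[OF assms(1,2)], rule ccontr)
  let ?p = "\<lambda>M. \<Prod>a\<in>#M. [:1, - a:]"
  assume "?p M \<noteq> ?p M'"
  then have "finite {u. poly (?p M - ?p M') u = 0}" by (intro poly_roots_finite) simp
  moreover have "poly (?p M) u = (\<Prod>a\<in>#M. 1 - a * u)" for M and u :: complex
    by (induction M) (auto simp: algebra_simps)
  then have "\<forall>\<^sub>F u in nhds 0. poly (?p M - ?p M') u = 0" using assms(3) by simp
  then obtain e where e: "e > 0" "\<And>u. dist u 0 < e \<Longrightarrow> poly (?p M - ?p M') u = 0"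
    unfolding eventually_nhds_metric by blast
  have "(\<lambda>n. of_real (e / real (n + 2))) ` (UNIV :: nat set) \<subseteq> {u. poly (?p M - ?p M') u = 0}"
  proof (rule image_subsetI, rule CollectI, rule e(2))
    fix n :: nat
    define r where "r = e / real (n + 2)"
    have "0 < r" "r < e" unfolding r_def using e(1) by (simp_all add: divide_less_eq)
    then show "dist (of_real (e / real (n + 2)) :: complex) 0 < e" unfolding r_def[symmetric] by simp
  qed
  moreover have "inj (\<lambda>n. of_real (e / real (n + 2)) :: complex)"
    using e(1) by (intro injI) (simp add: field_simps)
  ultimately show False using finite_subset finite_imageD infinite_UNIV_nat by metis
qed

text \<open>Common factors cancel, and zero entries contribute the factor \<open>1\<close>.\<close>

lemma reduce_factorization:
  fixes A B :: "complex multiset"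
  assumes ev: "\<forall>\<^sub>F u in nhds 0. f u = (\<Prod>b\<in>#B. 1 - b * u) / (\<Prod>a\<in>#A. 1 - a * u)"
  defines "A1 \<equiv> filter_mset (\<lambda>a. a \<noteq> 0) A" and "B1 \<equiv> filter_mset (\<lambda>a. a \<noteq> 0) B"
  shows "\<forall>\<^sub>F u in nhds 0. f u = (\<Prod>b\<in>#B1 - A1 \<inter># B1. 1 - b * u) / (\<Prod>a\<in>#A1 - A1 \<inter># B1. 1 - a * u)"
proof -
  let ?P = "\<lambda>A u. \<Prod>a\<in>#A. 1 - a * u"
  have filt: "?P (filter_mset (\<lambda>a. a \<noteq> 0) M) u = ?P M u" for M and u :: complex
    by (induction M) auto
  show ?thesis
    using ev eventually_small[of "A1 \<inter># B1"]
  proof eventually_elim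
    case (elim u)
    have nz: "?P (A1 \<inter># B1) u \<noteq> 0" using linear_prod_nonzero elim(2) by blast
    have "?P A u = ?P ((A1 - A1 \<inter># B1) + A1 \<inter># B1) u" "?P B u = ?P ((B1 - A1 \<inter># B1) + A1 \<inter># B1) u"
    proof -
      have split: "A1 = (A1 - A1 \<inter># B1) + A1 \<inter># B1" "B1 = (B1 - A1 \<inter># B1) + A1 \<inter># B1"
        by (simp_all only: subset_mset.diff_add subset_mset.inf_le1 subset_mset.inf_le2)
      show "?P A u = ?P ((A1 - A1 \<inter># B1) + A1 \<inter># B1) u"
        unfolding split(1)[symmetric] unfolding A1_def filt ..
      show "?P B u = ?P ((B1 - A1 \<inter># B1) + A1 \<inter># B1) u"
        unfolding split(2)[symmetric] unfolding B1_def filt ..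
    qed
    then show ?case using elim(1) nz by simp
  qed
qed

text \<open>Cross multiplication gives \<open>B + A' = B' + A\<close>. An entry of \<open>A\<close> is not in \<open>B\<close>, and one of
  \<open>A'\<close> is not in \<open>B'\<close>, so \<open>A\<close> and \<open>A'\<close> can be read off from this equation.\<close>

lemma reduced_factorization_unique:
  fixes A B A' B' :: "complex multiset"
  assumes "0 \<notin># A" "0 \<notin># B" "0 \<notin># A'" "0 \<notin># B'" "A \<inter># B = {#}" "A' \<inter># B' = {#}"
    and ev: "\<forall>\<^sub>F u in nhds 0. f u = (\<Prod>b\<in>#B. 1 - b * u) / (\<Prod>a\<in>#A. 1 - a * u)"
    and ev': "\<forall>\<^sub>F u in nhds 0. f u = (\<Prod>b\<in>#B'. 1 - b * u) / (\<Prod>a\<in>#A'. 1 - a * u)"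
  shows "A = A'"
proof -
  have "B + A' = B' + A"
  proof (rule linear_prod_inject)
    show "\<forall>\<^sub>F u in nhds 0. (\<Prod>a\<in>#B + A'. 1 - a * u) = (\<Prod>a\<in>#B' + A. 1 - a * u)"
      using ev ev' eventually_small[of A] eventually_small[of A']
    proof eventually_elim
      case (elim u)
      have "(\<Prod>a\<in>#A. 1 - a * u) \<noteq> 0" "(\<Prod>a\<in>#A'. 1 - a * u) \<noteq> 0" using linear_prod_nonzero elim(3,4) by blast+
      then show ?case using elim(1,2) by (simp add: frac_eq_eq)
    qed
  qed (use assms in auto)
  then have c: "count B x + count A' x = count B' x + count A x" for x by (metis count_union)
  show ?thesis
  proof (rule multiset_eqI)
    fix x
    have "min (count A x) (count B x) = 0" "min (count A' x) (count B' x) = 0"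
      using assms(5,6) by (metis count_empty count_inter_mset)+
    then show "count A x = count A' x" using c[of x] by (simp add: min_def split: if_splits)
  qed
qed

section \<open>Weighted sums over walks\<close>

text \<open>The entries of the powers of a matrix whose index set may be infinite: the sum over the nonzero
  entries of a row makes sense without a carrier set, as long as rows are finite.\<close>

fun walk_sum :: "('a \<Rightarrow> 'a \<Rightarrow> real) \<Rightarrow> nat \<Rightarrow> 'a \<Rightarrow> 'a \<Rightarrow> real" where
  "walk_sum w 0 x y = (if x = y then 1 else 0)"
| "walk_sum w (Suc n) x y = (\<Sum>z | w x z \<noteq> 0. w x z * walk_sum w n z y)"

declare walk_sum.simps(2) [simp del]

lemma walk_sum_Suc:
  assumes "finite U" "\<And>z. w x z \<noteq> 0 \<Longrightarrow> z \<in> U"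
  shows "walk_sum w (Suc n) x y = (\<Sum>z\<in>U. w x z * walk_sum w n z y)"
  unfolding walk_sum.simps(2) using assms by (intro sum.mono_neutral_left) auto

section \<open>Asymptotics of the trace of an irreducible matrix with constant row sums\<close>

text \<open>The least positive difference \<open>d\<close> of two elements divides every element, by division with
  remainder, so it is the greatest common divisor. If \<open>d \<beta>\<close> and \<open>d \<beta> + d\<close> are elements and
  \<open>n = Q \<beta> + r\<close> with \<open>r < \<beta> \<le> Q\<close>, then \<open>d n\<close> is the sum of \<open>Q - r\<close> copies of the first and \<open>r\<close> copies of
  the second.\<close>

lemma semigroup_contains_large_multiples:
  fixes L :: "nat set"
  assumes zero: "0 \<in> L" and add: "\<And>a b. a \<in> L \<Longrightarrow> b \<in> L \<Longrightarrow> a + b \<in> L"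
    and pos: "l0 \<in> L" "l0 > 0"
  shows "\<exists>N. \<forall>n\<ge>N. Gcd L * n \<in> L"
proof -
  have mult: "k * a \<in> L" if "a \<in> L" for k a
    by (induction k) (use zero add that in auto)
  define P where "P d \<longleftrightarrow> d > 0 \<and> (\<exists>a\<in>L. \<exists>b\<in>L. a = b + d)" for d
  have "P l0" unfolding P_def using pos zero by (metis add_0)
  define d where "d = (LEAST d. P d)"
  have "P d" unfolding d_def using \<open>P l0\<close> by (rule LeastI)
  then obtain a b where ab: "d > 0" "a \<in> L" "b \<in> L" "a = b + d" unfolding P_def by auto
  have "d dvd l" if l: "l \<in> L" for l
  proof (rule ccontr)
    assume "\<not> d dvd l"
    then have r: "l mod d > 0" by (simp add: mod_greater_zero_iff_not_dvd)
    have "l + (l div d) * b \<in> L" "(l div d) * a \<in> L" using l ab mult add by auto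
    moreover have "l + (l div d) * b = (l div d) * a + l mod d"
      unfolding ab(4) by (simp add: algebra_simps)
    ultimately have "P (l mod d)" unfolding P_def using r by blast
    then have "d \<le> l mod d" unfolding d_def by (rule Least_le)
    then show False using mod_less_divisor[OF ab(1), of l] by linarith
  qed
  then have "d dvd Gcd L" by (intro Gcd_greatest)
  moreover have "Gcd L dvd d"
  proof -
    have "Gcd L dvd a" "Gcd L dvd b" using ab by (auto intro: Gcd_dvd)
    then show ?thesis using ab(4) by (simp add: dvd_add_right_iff)
  qed
  ultimately have h: "Gcd L = d" by (simp add: dvd_antisym)
  \<comment> \<open>Adding \<open>l0\<close> makes the smaller element positive.\<close>
  define b' where "b' = b + l0"
  have b': "b' \<in> L" "b' + d \<in> L" "b' > 0" unfolding b'_def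
    using add[OF ab(3) pos(1)] add[OF ab(2) pos(1)] ab(4) pos(2) by (auto simp: add_ac)
  obtain \<beta> where \<beta>: "b' = d * \<beta>" using \<open>\<And>l. l \<in> L \<Longrightarrow> d dvd l\<close>[OF b'(1)] by (auto elim: dvdE)
  have "\<beta> > 0" using b'(3) \<beta> by (cases \<beta>) auto
  have "d * n \<in> L" if n: "n \<ge> \<beta> * \<beta>" for n
  proof -
    define Q r where "Q = n div \<beta>" and "r = n mod \<beta>"
    have "\<beta> \<le> Q" unfolding Q_def using n \<open>\<beta> > 0\<close> by (simp add: less_eq_div_iff_mult_less_eq)
    moreover have "r < \<beta>" unfolding r_def using \<open>\<beta> > 0\<close> by simp
    ultimately obtain s where s: "Q = r + s" by (metis less_imp_le le_trans le_Suc_ex)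
    have "s * b' + r * (b' + d) \<in> L" using b' mult add by auto
    moreover have "n = Q * \<beta> + r" unfolding Q_def r_def by simp
    then have "s * b' + r * (b' + d) = d * n" unfolding \<beta> s by (simp add: algebra_simps)
    ultimately show ?thesis by simp
  qed
  then show ?thesis unfolding h by blast
qed

locale irreducible_row_constant =
  fixes U :: "'a set" and w :: "'a \<Rightarrow> 'a \<Rightarrow> real" and q :: real
  assumes finite_U: "finite U" and nonempty: "U \<noteq> {}"
    and support: "\<And>x y. w x y \<noteq> 0 \<Longrightarrow> x \<in> U \<and> y \<in> U"
    and nonneg: "\<And>x y. w x y \<ge> 0"
    and row_sum: "\<And>x. x \<in> U \<Longrightarrow> (\<Sum>y\<in>U. w x y) = q"
    and q_pos: "q > 0"
    and irreducible: "\<And>x y. x \<in> U \<Longrightarrow> y \<in> U \<Longrightarrow> \<exists>n. walk_sum w n x y > 0"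
begin

lemma walk_Suc: "walk_sum w (Suc n) x y = (\<Sum>z\<in>U. w x z * walk_sum w n z y)"
  using support by (intro walk_sum_Suc finite_U) auto

lemma walk_nonneg: "walk_sum w n x y \<ge> 0"
  by (induction n arbitrary: x) (auto simp: walk_Suc nonneg intro!: sum_nonneg)

lemma walk_add: "x \<in> U \<Longrightarrow> walk_sum w (m + n) x y = (\<Sum>z\<in>U. walk_sum w m x z * walk_sum w n z y)"
proof (induction m arbitrary: x)
  case 0
  have "(\<Sum>z\<in>U. walk_sum w 0 x z * walk_sum w n z y) = (\<Sum>z\<in>U. if z = x then walk_sum w n z y else 0)"
    by (intro sum.cong) auto
  then show ?case using 0 finite_U by simp
next
  case (Suc m)
  have "walk_sum w (Suc m + n) x y = (\<Sum>u\<in>U. \<Sum>z\<in>U. w x u * (walk_sum w m u z * walk_sum w n z y))"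
    unfolding add_Suc walk_Suc using Suc by (intro sum.cong) (auto simp: sum_distrib_left)
  also have "\<dots> = (\<Sum>z\<in>U. \<Sum>u\<in>U. w x u * (walk_sum w m u z * walk_sum w n z y))" by (rule sum.swap)
  finally show ?case by (simp add: walk_Suc sum_distrib_right mult.assoc)
qed

lemma walk_pos_trans:
  assumes "x \<in> U" "y \<in> U" "walk_sum w m x y > 0" "walk_sum w n y z > 0"
  shows "walk_sum w (m + n) x z > 0"
  unfolding walk_add[OF assms(1)]
  using assms finite_U by (intro sum_pos2[of U y]) (auto intro: mult_pos_pos mult_nonneg_nonneg walk_nonneg)

lemma walk_row_sum: "x \<in> U \<Longrightarrow> (\<Sum>y\<in>U. walk_sum w n x y) = q ^ n"
proof (induction n arbitrary: x)
  case 0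
  then show ?case using finite_U by simp
next
  case (Suc n)
  have "(\<Sum>y\<in>U. walk_sum w (Suc n) x y) = (\<Sum>z\<in>U. \<Sum>y\<in>U. w x z * walk_sum w n z y)"
    unfolding walk_Suc by (rule sum.swap)
  also have "\<dots> = (\<Sum>z\<in>U. w x z * q ^ n)"
    by (intro sum.cong refl) (simp add: sum_distrib_left[symmetric] Suc.IH)
  also have "\<dots> = q * q ^ n" using row_sum[OF Suc.prems] by (simp add: sum_distrib_right[symmetric])
  finally show ?case by simp
qed

text \<open>The states split into cyclic classes modulo the period \<open>h\<close>, the greatest common divisor of the
  lengths of closed walks. On each class the matrix of the walks of length \<open>h N\<close> has positive entries for large \<open>N\<close>, so it
  contracts the oscillation of every function on the class by a fixed factor. Hence a diagonal
  entry of a power of the normalised matrix is close to the entry in the same column and in the row of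
  a fixed representative of the class, and the entries of this row add up to \<open>1\<close>.\<close>

theorem trace_asymptotics:
  "\<exists>h>0. \<exists>K \<rho>. 0 < \<rho> \<and> \<rho> < 1 \<and>
     (\<forall>m. \<bar>(\<Sum>x\<in>U. walk_sum w m x x) - (if h dvd m then real h * q ^ m else 0)\<bar> \<le> K * (\<rho> * q) ^ m)"
proof -
  obtain x0 where x0: "x0 \<in> U" using nonempty by blast
  define L where "L = {n. walk_sum w n x0 x0 > 0}"
  define h where "h = Gcd L"
  have L0: "0 \<in> L" unfolding L_def by simp
  have Ladd: "a + b \<in> L" if "a \<in> L" "b \<in> L" for a b
    using walk_pos_trans[OF x0 x0] that unfolding L_def by blast
  obtain l0 where l0: "l0 \<in> L" "l0 > 0"
  proof -
    have "(\<Sum>y\<in>U. w x0 y) > 0" using row_sum[OF x0] q_pos by simp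
    then obtain z where z: "z \<in> U" "w x0 z > 0"
      by (meson not_le sum_nonpos)
    obtain n where n: "walk_sum w n z x0 > 0" using irreducible z(1) x0 by blast
    have "walk_sum w (Suc n) x0 x0 > 0" unfolding walk_Suc
      using z n finite_U by (intro sum_pos2[of U z]) (auto intro: mult_nonneg_nonneg nonneg walk_nonneg)
    then show ?thesis using that[of "Suc n"] unfolding L_def by simp
  qed
  have hpos: "h > 0"
  proof -
    have "h dvd l0" unfolding h_def using l0(1) by (rule Gcd_dvd)
    then show ?thesis using l0(2) by (auto intro: dvd_pos_nat)
  qed
  have hdvd: "h dvd l" if "l \<in> L" for l using that unfolding h_def by (rule Gcd_dvd)
  obtain N0 where N0: "\<And>n. n \<ge> N0 \<Longrightarrow> h * n \<in> L"
    using semigroup_contains_large_multiples[OF L0 Ladd l0] unfolding h_def by blast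
  define t where "t x = (SOME n. walk_sum w n x0 x > 0)" for x
  have t: "walk_sum w (t x) x0 x > 0" if "x \<in> U" for x
    unfolding t_def using irreducible[OF x0 that] by (rule someI_ex)
  define c where "c x = t x mod h" for x
  have cstep: "(c x + n) mod h = c y" if xy: "x \<in> U" "y \<in> U" "walk_sum w n x y > 0" for x y n
  proof -
    obtain k where k: "walk_sum w k y x0 > 0" using irreducible xy(2) x0 by blast
    have "t x + n + k \<in> L" "t y + k \<in> L" unfolding L_def
      using walk_pos_trans[OF x0 xy(2) walk_pos_trans[OF x0 xy(1) t[OF xy(1)] xy(3)] k]
        walk_pos_trans[OF x0 xy(2) t[OF xy(2)] k] by auto
    then obtain a b where "t x + n + k = h * a" "t y + k = h * b" using hdvd by (metis dvdE)
    then have "(t x + n) + h * b = t y + h * a" by linarith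
    then have "(t x + n) mod h = t y mod h" using nat_mod_eq_iff by blast
    then show ?thesis unfolding c_def by (simp add: mod_simps)
  qed
  have c_lt: "c x < h" for x unfolding c_def using hpos by simp
  have c0: "c x0 = 0" using hdvd[of "t x0"] t[OF x0] unfolding c_def L_def by simp
  define cls where "cls x = {y \<in> U. c y = c x}" for x
  have fin_cls: "finite (cls x)" for x unfolding cls_def using finite_U by simp
  have same_class: "walk_sum w (h * n) x y = 0" if "x \<in> U" "y \<in> U" "c y \<noteq> c x" for n x y
  proof (rule ccontr)
    assume "walk_sum w (h * n) x y \<noteq> 0"
    then have "walk_sum w (h * n) x y > 0" using walk_nonneg[of "h * n" x y] by simp
    then have "(c x + h * n) mod h = c y" using cstep that by blast
    then show False using that(3) c_lt[of x] by simp
  qed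
  have "\<forall>\<^sub>F n in sequentially. walk_sum w (h * n) x y > 0" if xy: "x \<in> U" "y \<in> cls x" for x y
  proof -
    have yU: "y \<in> U" "c y = c x" using xy unfolding cls_def by auto
    obtain k l where k: "walk_sum w k x x0 > 0" and l: "walk_sum w l x0 y > 0"
      using irreducible xy(1) yU(1) x0 by meson
    have "(c x + k) mod h = 0" "l mod h = c x" using cstep[OF xy(1) x0 k] cstep[OF x0 yU(1) l] c0 yU(2) by auto
    then have "(k + l) mod h = 0" by (metis add.commute mod_add_right_eq)
    then obtain s where s: "k + l = h * s" by (auto simp: mod_eq_0_iff_dvd elim: dvdE)
    have "walk_sum w (h * n) x y > 0" if n: "n \<ge> N0 + s" for n
    proof -
      have "walk_sum w (h * (n - s)) x0 x0 > 0" using N0[of "n - s"] n unfolding L_def by simp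
      then have "walk_sum w (k + h * (n - s) + l) x y > 0"
        using walk_pos_trans[OF xy(1) x0 walk_pos_trans[OF xy(1) x0 k] l] by blast
      moreover have "k + h * (n - s) + l = h * n"
      proof -
        have "k + h * (n - s) + l = h * s + h * (n - s)" using s by simp
        also have "\<dots> = h * n" using n by (simp add: distrib_left[symmetric])
        finally show ?thesis .
      qed
      ultimately show ?thesis by simp
    qed
    then show ?thesis unfolding eventually_sequentially by blast
  qed
  then have "\<forall>\<^sub>F n in sequentially. \<forall>x\<in>U. \<forall>y\<in>cls x. walk_sum w (h * n) x y > 0"
    by (intro eventually_ball_finite ballI finite_U fin_cls) auto
  then obtain N where N: "\<forall>x\<in>U. \<forall>y\<in>cls x. walk_sum w (h * N) x y > 0" "N > 0"
    unfolding eventually_sequentially by (metis le_add1 le_add2 add.commute zero_less_Suc plus_1_eq_Suc less_le_trans zero_less_one)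
  define Q where "Q x y = walk_sum w (h * N) x y / q ^ (h * N)" for x y
  \<comment> \<open>Inserting \<open>1/2\<close> keeps the contraction factor \<open>1 - \<delta>\<close> positive.\<close>
  define \<delta> where "\<delta> = Min (insert (1/2) ((\<lambda>(x, y). Q x y) ` (SIGMA x:U. cls x)))"
  have fins: "finite (insert (1/2) ((\<lambda>(x, y). Q x y) ` (SIGMA x:U. cls x)))"
    using finite_U fin_cls by auto
  have \<delta>: "\<delta> > 0" "\<delta> \<le> 1/2"
  proof -
    show "\<delta> > 0" unfolding \<delta>_def
      by (subst Min_gr_iff[OF fins]) (use N(1) q_pos in \<open>auto simp: Q_def\<close>)
    show "\<delta> \<le> 1/2" unfolding \<delta>_def by (intro Min_le fins) simp
  qed
  have Q\<delta>: "Q x y \<ge> \<delta>" if "x \<in> U" "y \<in> cls x" for x y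
    unfolding \<delta>_def using that by (intro Min_le fins) auto
  define f where "f n x y = walk_sum w (h * n) x y / q ^ (h * n)" for n x y
  have f_row: "(\<Sum>y\<in>cls x. f n x y) = 1" if x: "x \<in> U" for n x
  proof -
    have "(\<Sum>y\<in>cls x. f n x y) = (\<Sum>y\<in>U. f n x y)"
      unfolding cls_def f_def using x finite_U by (intro sum.mono_neutral_left) (auto simp: same_class)
    also have "\<dots> = 1" unfolding f_def sum_divide_distrib[symmetric] walk_row_sum[OF x] using q_pos by simp
    finally show ?thesis .
  qed
  have f_bounds: "0 \<le> f n x y" "f n x y \<le> 1" if xy: "x \<in> U" "y \<in> U" for n x y
  proof -
    show "0 \<le> f n x y" unfolding f_def using walk_nonneg q_pos by simp
    have "walk_sum w (h * n) x y \<le> (\<Sum>y\<in>U. walk_sum w (h * n) x y)"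
      using xy finite_U walk_nonneg by (intro member_le_sum) auto
    then show "f n x y \<le> 1" unfolding f_def walk_row_sum[OF xy(1)] using q_pos by simp
  qed
  have f_step: "f (N + n) x y = (\<Sum>z\<in>cls x. Q x z * f n z y)" if x: "x \<in> U" for n x y
  proof -
    have "f (N + n) x y = (\<Sum>z\<in>U. Q x z * f n z y)"
      unfolding f_def Q_def distrib_left walk_add[OF x] power_add
      by (simp add: sum_divide_distrib)
    also have "\<dots> = (\<Sum>z\<in>cls x. Q x z * f n z y)"
      unfolding cls_def Q_def using x finite_U by (intro sum.mono_neutral_right) (auto simp: same_class)
    finally show ?thesis .
  qed
  have osc: "\<exists>l u. (\<forall>z\<in>cls x. l \<le> f (N * k + r) z y \<and> f (N * k + r) z y \<le> u) \<and> u - l \<le> (1 - \<delta>) ^ k"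
    if xy: "x \<in> U" "y \<in> U" for k r x y
  proof (induction k)
    case 0
    show ?case using f_bounds xy by (intro exI[of _ 0] exI[of _ 1]) (auto simp: cls_def)
  next
    case (Suc k)
    then obtain l u where lu: "\<And>z. z \<in> cls x \<Longrightarrow> l \<le> f (N * k + r) z y"
      "\<And>z. z \<in> cls x \<Longrightarrow> f (N * k + r) z y \<le> u" "u - l \<le> (1 - \<delta>) ^ k" by blast
    define g where "g z = f (N * k + r) z y" for z
    have xc: "x \<in> cls x" using xy unfolding cls_def by simp
    define l' u' where "l' = l + \<delta> * (g x - l)" and "u' = u - \<delta> * (u - g x)"
    have "l' \<le> f (N * Suc k + r) z y \<and> f (N * Suc k + r) z y \<le> u'" if z: "z \<in> cls x" for z
    proof -
      have zU: "z \<in> U" and clz: "cls z = cls x" using z unfolding cls_def by auto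
      have eq: "f (N * Suc k + r) z y = (\<Sum>v\<in>cls x. Q z v * g v)"
        using f_step[OF zU, of "N * k + r" y] unfolding clz g_def by (simp add: algebra_simps)
      have one: "(\<Sum>v\<in>cls x. Q z v) = 1" using f_row[OF zU, of N] unfolding clz f_def Q_def .
      have Qx: "Q z x \<ge> \<delta>" using Q\<delta>[OF zU] xc clz by auto
      have Qnn: "Q z v \<ge> 0" for v unfolding Q_def using walk_nonneg q_pos by simp
      have "u - f (N * Suc k + r) z y = (\<Sum>v\<in>cls x. Q z v * (u - g v))"
        unfolding eq using one by (simp add: right_diff_distrib sum_subtractf sum_distrib_right[symmetric])
      also have "\<dots> \<ge> Q z x * (u - g x)"
        using lu(2) Qnn xc fin_cls by (intro member_le_sum) (auto simp: g_def)
      also have "Q z x * (u - g x) \<ge> \<delta> * (u - g x)"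
        using Qx lu(2)[OF xc] by (intro mult_right_mono) (auto simp: g_def)
      finally have A: "f (N * Suc k + r) z y \<le> u'" unfolding u'_def by simp
      have "f (N * Suc k + r) z y - l = (\<Sum>v\<in>cls x. Q z v * (g v - l))"
        unfolding eq using one by (simp add: right_diff_distrib sum_subtractf sum_distrib_right[symmetric])
      also have "\<dots> \<ge> Q z x * (g x - l)"
        using lu(1) Qnn xc fin_cls by (intro member_le_sum) (auto simp: g_def)
      also have "Q z x * (g x - l) \<ge> \<delta> * (g x - l)"
        using Qx lu(1)[OF xc] by (intro mult_right_mono) (auto simp: g_def)
      finally have "l' \<le> f (N * Suc k + r) z y" unfolding l'_def by simp
      with A show ?thesis by simp
    qed
    moreover have "u' - l' = (1 - \<delta>) * (u - l)" unfolding u'_def l'_def by (simp add: algebra_simps)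
    then have "u' - l' \<le> (1 - \<delta>) ^ Suc k" using lu(3) \<delta> by (simp add: mult_left_mono)
    ultimately show ?case by blast
  qed
  \<comment> \<open>The classes are indexed by the residues modulo \<open>h\<close>.\<close>
  have surj: "\<exists>x\<in>U. c x = i" if i: "i < h" for i
  proof -
    have "(\<Sum>y\<in>U. walk_sum w i x0 y) > 0" unfolding walk_row_sum[OF x0] using q_pos by simp
    then obtain y where "y \<in> U" "walk_sum w i x0 y > 0" by (meson not_le sum_nonpos)
    then show ?thesis using cstep[OF x0] c0 i by fastforce
  qed
  define \<xi> where "\<xi> i = (SOME x. x \<in> U \<and> c x = i)" for i
  have \<xi>: "\<xi> i \<in> U" "c (\<xi> i) = i" if "i < h" for i
    using someI_ex[of "\<lambda>x. x \<in> U \<and> c x = i"] surj[OF that] unfolding \<xi>_def by auto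
  have near: "\<bar>(\<Sum>x\<in>U. f n x x) - real h\<bar> \<le> real (card U) * (1 - \<delta>) ^ (n div N)" for n
  proof -
    have "(\<Sum>x\<in>U. f n (\<xi> (c x)) x) = (\<Sum>i<h. \<Sum>x | x \<in> U \<and> c x = i. f n (\<xi> (c x)) x)"
      by (rule sum.group[symmetric]) (use finite_U c_lt in auto)
    also have "\<dots> = (\<Sum>i<h. 1)"
    proof (rule sum.cong)
      fix i assume "i \<in> {..<h}"
      then have i: "i < h" by simp
      have "(\<Sum>x | x \<in> U \<and> c x = i. f n (\<xi> (c x)) x) = (\<Sum>x\<in>cls (\<xi> i). f n (\<xi> i) x)"
        unfolding cls_def using \<xi>[OF i] by (intro sum.cong) auto
      then show "(\<Sum>x | x \<in> U \<and> c x = i. f n (\<xi> (c x)) x) = 1" using f_row[OF \<xi>(1)[OF i]] by simp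
    qed simp
    finally have "real h = (\<Sum>x\<in>U. f n (\<xi> (c x)) x)" by simp
    then have "\<bar>(\<Sum>x\<in>U. f n x x) - real h\<bar> = \<bar>\<Sum>x\<in>U. f n x x - f n (\<xi> (c x)) x\<bar>"
      by (simp add: sum_subtractf)
    also have "\<dots> \<le> (\<Sum>x\<in>U. \<bar>f n x x - f n (\<xi> (c x)) x\<bar>)" by (rule sum_abs)
    also have "\<dots> \<le> (\<Sum>x\<in>U. (1 - \<delta>) ^ (n div N))"
    proof (rule sum_mono)
      fix x assume x: "x \<in> U"
      obtain l u where lu: "\<forall>z\<in>cls x. l \<le> f n z x \<and> f n z x \<le> u" "u - l \<le> (1 - \<delta>) ^ (n div N)"
        using osc[OF x x, of "n div N" "n mod N"] by auto
      have "x \<in> cls x" "\<xi> (c x) \<in> cls x" unfolding cls_def using x \<xi>[OF c_lt] by auto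
      then have "l \<le> f n x x \<and> f n x x \<le> u" "l \<le> f n (\<xi> (c x)) x \<and> f n (\<xi> (c x)) x \<le> u"
        using lu(1) by auto
      then show "\<bar>f n x x - f n (\<xi> (c x)) x\<bar> \<le> (1 - \<delta>) ^ (n div N)" using lu(2) by linarith
    qed
    finally show ?thesis by simp
  qed
  define \<rho> where "\<rho> = root (h * N) (1 - \<delta>)"
  have hN: "h * N > 0" using hpos N(2) by simp
  have \<rho>: "0 < \<rho>" "\<rho> < 1" "\<rho> ^ (h * N) = 1 - \<delta>"
    unfolding \<rho>_def using \<delta> hN by (auto intro: real_root_gt_zero simp: real_root_lt_1_iff)
  \<comment> \<open>The division by \<open>1 - \<delta>\<close> makes up for rounding \<open>n / N\<close> down.\<close>
  define K where "K = real (card U) / (1 - \<delta>)"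
  have K0: "K \<ge> 0" unfolding K_def using \<delta> by simp
  have "\<bar>(\<Sum>x\<in>U. walk_sum w m x x) - (if h dvd m then real h * q ^ m else 0)\<bar> \<le> K * (\<rho> * q) ^ m" for m
  proof (cases "h dvd m")
    case True
    then obtain n where m: "m = h * n" by (auto elim: dvdE)
    have "(1 - \<delta>) ^ (n div N) * (1 - \<delta>) \<le> \<rho> ^ m"
    proof -
      have "h * (n mod N) \<le> h * N" using N(2) by (intro mult_left_mono) auto
      then have "\<rho> ^ (h * N) \<le> \<rho> ^ (h * (n mod N))" using \<rho> by (intro power_decreasing) auto
      then have "(1 - \<delta>) ^ (n div N) * \<rho> ^ (h * N) \<le> (1 - \<delta>) ^ (n div N) * \<rho> ^ (h * (n mod N))"
        using \<delta> by (intro mult_left_mono) auto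
      also have "\<dots> = \<rho> ^ (h * N * (n div N) + h * (n mod N))"
        by (simp only: power_add power_mult[of \<rho> "h * N"] \<rho>(3))
      also have "h * N * (n div N) + h * (n mod N) = h * (N * (n div N) + n mod N)"
        by (simp only: distrib_left mult.assoc)
      also have "\<dots> = h * n" by simp
      finally show ?thesis unfolding m \<rho>(3) by simp
    qed
    then have "(1 - \<delta>) ^ (n div N) \<le> \<rho> ^ m / (1 - \<delta>)" using \<delta> by (simp add: pos_le_divide_eq)
    then have "\<bar>(\<Sum>x\<in>U. f n x x) - real h\<bar> \<le> K * \<rho> ^ m"
      using near[of n] mult_left_mono[of "(1 - \<delta>) ^ (n div N)" "\<rho> ^ m / (1 - \<delta>)" "real (card U)"]
      unfolding K_def by simp
    moreover have "(\<Sum>x\<in>U. walk_sum w m x x) = q ^ m * (\<Sum>x\<in>U. f n x x)"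
      unfolding f_def m using q_pos by (simp add: sum_divide_distrib[symmetric])
    then have "(\<Sum>x\<in>U. walk_sum w m x x) - real h * q ^ m = q ^ m * ((\<Sum>x\<in>U. f n x x) - real h)"
      by (simp add: algebra_simps)
    ultimately have "\<bar>(\<Sum>x\<in>U. walk_sum w m x x) - real h * q ^ m\<bar> \<le> q ^ m * (K * \<rho> ^ m)"
      using q_pos by (simp add: abs_mult)
    then show ?thesis using True by (simp add: power_mult_distrib mult_ac)
  next
    case False
    have "walk_sum w m x x = 0" if x: "x \<in> U" for x
    proof (rule ccontr)
      assume "walk_sum w m x x \<noteq> 0"
      then have "(c x + m) mod h = c x" using cstep[OF x x, of m] walk_nonneg[of m x x] by simp
      then have "(c x + m) mod h = (c x + 0) mod h" using c_lt[of x] by simp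
      then have "m mod h = 0" by (metis add_diff_cancel_left' add.right_neutral dvd_eq_mod_eq_0 le_add1 mod_eq_dvd_iff_nat)
      then show False using False by (simp add: mod_eq_0_iff_dvd)
    qed
    then show ?thesis using False K0 \<rho> q_pos by simp
  qed
  then show ?thesis using hpos \<rho> by blast
qed

end

section \<open>Traces of powers and eigenvalues\<close>

lemma trace_mult_comm:
  fixes C D :: "complex mat"
  assumes "C \<in> carrier_mat n n" "D \<in> carrier_mat n n"
  shows "(\<Sum>i<n. (C * D) $$ (i, i)) = (\<Sum>i<n. (D * C) $$ (i, i))"
proof -
  have eq: "(\<Sum>i<n. (M * N) $$ (i, i)) = (\<Sum>i<n. \<Sum>j<n. M $$ (i, j) * N $$ (j, i))"
    if "M \<in> carrier_mat n n" "N \<in> carrier_mat n n" for M N :: "complex mat"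
    using that by (intro sum.cong) (auto simp: scalar_prod_def lessThan_atLeast0 intro!: sum.cong)
  show ?thesis unfolding eq[OF assms] eq[OF assms(2,1)]
    by (subst sum.swap) (simp add: mult.commute)
qed

lemma upper_triangular_power:
  fixes B :: "complex mat"
  assumes B: "B \<in> carrier_mat n n" "upper_triangular B"
  shows "upper_triangular (B ^\<^sub>m m) \<and> (\<forall>i<n. (B ^\<^sub>m m) $$ (i, i) = (B $$ (i, i)) ^ m)"
proof (induction m)
  case 0
  then show ?case using B by auto
next
  case (Suc m)
  have C: "B ^\<^sub>m m \<in> carrier_mat n n" using B by simp
  have zero: "(B ^\<^sub>m m) $$ (i, j) * B $$ (j, k) = 0"
    if "i < n" "j < n" "k < n" "k < i \<or> (k = i \<and> j \<noteq> i)" for i j k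
  proof (cases "j < i")
    case True
    then show ?thesis using Suc C that by (auto simp: upper_triangular_def)
  next
    case False
    then have "k < j" using that(4) by auto
    then show ?thesis using B that by (auto simp: upper_triangular_def)
  qed
  have entry: "(B ^\<^sub>m Suc m) $$ (i, k) = (\<Sum>j<n. (B ^\<^sub>m m) $$ (i, j) * B $$ (j, k))"
    if "i < n" "k < n" for i k
    using B C that by (simp add: scalar_prod_def lessThan_atLeast0)
  have "(B ^\<^sub>m Suc m) $$ (i, i) = (B $$ (i, i)) ^ Suc m" if i: "i < n" for i
  proof -
    have "(B ^\<^sub>m Suc m) $$ (i, i) = (\<Sum>j<n. if j = i then (B ^\<^sub>m m) $$ (i, i) * B $$ (i, i) else 0)"
      unfolding entry[OF i i] using zero i by (intro sum.cong) auto
    then show ?thesis using Suc i by (simp add: mult.commute)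
  qed
  moreover have "upper_triangular (B ^\<^sub>m Suc m)"
    using zero entry B by (intro upper_triangularI) (auto intro!: sum.neutral)
  ultimately show ?case by blast
qed

text \<open>A Schur decomposition makes the matrix triangular without changing the traces of its powers.\<close>

lemma power_traces_eigenvalues:
  fixes A :: "complex mat"
  assumes A: "A \<in> carrier_mat n n"
  obtains es where "\<And>m. (\<Sum>i<n. (A ^\<^sub>m m) $$ (i, i)) = (\<Sum>e\<leftarrow>es. e ^ m)"
    "\<And>e. e \<in> set es \<longleftrightarrow> eigenvalue A e"
proof -
  obtain es where es: "char_poly A = (\<Prod>a\<leftarrow>es. [:- a, 1:])"
    using char_poly_factorized[OF A] by blast
  obtain B P Q where "schur_decomposition A es = (B, P, Q)" by (cases "schur_decomposition A es")
  from schur_decomposition[OF A es this]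
  have sim: "similar_mat_wit A B P Q" and B: "upper_triangular B" "diag_mat B = es" by auto
  note wit = similar_mat_witD2[OF A sim]
  have "(\<Sum>i<n. (A ^\<^sub>m m) $$ (i, i)) = (\<Sum>e\<leftarrow>es. e ^ m)" for m
  proof -
    have Bm: "B ^\<^sub>m m \<in> carrier_mat n n" using wit by simp
    have "A ^\<^sub>m m = P * (B ^\<^sub>m m * Q)"
      using similar_mat_wit_pow_id[OF sim, of m] assoc_mult_mat[OF wit(6) Bm wit(7)] by simp
    then have "(\<Sum>i<n. (A ^\<^sub>m m) $$ (i, i)) = (\<Sum>i<n. (B ^\<^sub>m m * Q * P) $$ (i, i))"
      by (simp only:) (rule trace_mult_comm[OF wit(6)], use Bm wit(7) in simp)
    also have "B ^\<^sub>m m * Q * P = B ^\<^sub>m m"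
      using assoc_mult_mat[OF Bm wit(7) wit(6)] wit(2) right_mult_one_mat[OF Bm] by simp
    also have "(\<Sum>i<n. (B ^\<^sub>m m) $$ (i, i)) = (\<Sum>i<n. (B $$ (i, i)) ^ m)"
      using upper_triangular_power[OF wit(5) B(1), of m] by simp
    also have "\<dots> = (\<Sum>e\<leftarrow>es. e ^ m)"
      unfolding B(2)[symmetric] diag_mat_def using wit(5)
      by (simp add: o_def interv_sum_list_conv_sum_set_nat lessThan_atLeast0)
    finally show ?thesis .
  qed
  moreover have "e \<in> set es \<longleftrightarrow> eigenvalue A e" for e
    unfolding eigenvalue_root_char_poly[OF A] es by (simp add: poly_prod_list prod_list_zero_iff image_iff)
  ultimately show thesis using that by blast
qed

context irreducible_row_constant
begin

text \<open>The constant vectors are eigenvectors for the row sum \<open>q\<close>. An eigenvalue cannot exceed \<open>q\<close> in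
  modulus, as one sees from an entry of maximal modulus of an eigenvector.\<close>

lemma trace_eigenvalues:
  obtains \<Lambda> :: "complex multiset"
  where "\<And>m. of_real (\<Sum>x\<in>U. walk_sum w m x x) = (\<Sum>e\<in>#\<Lambda>. e ^ m)"
    "\<And>e. e \<in># \<Lambda> \<Longrightarrow> cmod e \<le> q" "of_real q \<in># \<Lambda>"
proof -
  define n where "n = card U"
  obtain e where e: "bij_betw e {..<n} U"
    using ex_bij_betw_nat_finite[OF finite_U] unfolding n_def lessThan_atLeast0 by blast
  have eU: "e i \<in> U" if "i < n" for i using e that by (auto dest: bij_betwE)
  define A where "A = mat n n (\<lambda>(i, j). complex_of_real (w (e i) (e j)))"
  have A: "A \<in> carrier_mat n n" unfolding A_def by simp
  have pow: "(A ^\<^sub>m m) $$ (i, j) = of_real (walk_sum w m (e i) (e j))" if "i < n" "j < n" for m i j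
    using that
  proof (induction m arbitrary: j)
    case 0
    then show ?case using A bij_betw_imp_inj_on[OF e] by (auto simp: inj_on_def)
  next
    case (Suc m)
    have "(A ^\<^sub>m Suc m) $$ (i, j) = (\<Sum>k<n. (A ^\<^sub>m m) $$ (i, k) * A $$ (k, j))"
      using A Suc.prems by (simp add: scalar_prod_def lessThan_atLeast0)
    also have "\<dots> = (\<Sum>k<n. of_real (walk_sum w m (e i) (e k) * w (e k) (e j)))"
      using Suc by (intro sum.cong) (auto simp: A_def)
    also have "\<dots> = of_real (\<Sum>z\<in>U. walk_sum w m (e i) z * w z (e j))"
      by (subst sum.reindex_bij_betw[OF e, where g = "\<lambda>z. of_real (walk_sum w m (e i) z * w z (e j))"]) simp
    also have "(\<Sum>z\<in>U. walk_sum w m (e i) z * w z (e j)) = walk_sum w (m + 1) (e i) (e j)"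
    proof -
      have "walk_sum w 1 z y = w z y" if "y \<in> U" for z y
      proof -
        have "walk_sum w 1 z y = (\<Sum>v\<in>U. if v = y then w z v else 0)"
          unfolding One_nat_def walk_Suc by (intro sum.cong) auto
        then show ?thesis using that finite_U by simp
      qed
      then show ?thesis unfolding walk_add[OF eU[OF Suc.prems(1)]] using eU[OF Suc.prems(2)] by simp
    qed
    finally show ?case by simp
  qed
  obtain es where es: "\<And>m. (\<Sum>i<n. (A ^\<^sub>m m) $$ (i, i)) = (\<Sum>e\<leftarrow>es. e ^ m)"
    "\<And>e. e \<in> set es \<longleftrightarrow> eigenvalue A e" using power_traces_eigenvalues[OF A] by blast
  have mulvec: "(A *\<^sub>v v) $ i = (\<Sum>j<n. of_real (w (e i) (e j)) * v $ j)"
    if "i < n" "v \<in> carrier_vec n" for i v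
    using that by (simp add: A_def scalar_prod_def lessThan_atLeast0)
  show thesis
  proof
    show "of_real (\<Sum>x\<in>U. walk_sum w m x x) = (\<Sum>e\<in>#mset es. e ^ m)" for m
    proof -
      have "(\<Sum>i<n. (A ^\<^sub>m m) $$ (i, i)) = (\<Sum>i<n. of_real (walk_sum w m (e i) (e i)))"
        by (intro sum.cong) (auto simp: pow)
      also have "\<dots> = of_real (\<Sum>x\<in>U. walk_sum w m x x)"
        by (subst sum.reindex_bij_betw[OF e, where g = "\<lambda>z. of_real (walk_sum w m z z)"]) simp
      finally show ?thesis unfolding es by (simp add: sum_mset_sum_list[symmetric])
    qed
    show "of_real q \<in># mset es"
    proof -
      have "n > 0" unfolding n_def using nonempty finite_U by (simp add: card_gt_0_iff)
      have "eigenvector A (vec n (\<lambda>_. 1 :: complex)) (of_real q)" unfolding eigenvector_def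
      proof (intro conjI)
        show "vec n (\<lambda>_. 1 :: complex) \<noteq> 0\<^sub>v (dim_row A)"
        proof
          assume "vec n (\<lambda>_. 1 :: complex) = 0\<^sub>v (dim_row A)"
          then have "vec n (\<lambda>_. 1 :: complex) $ 0 = 0\<^sub>v n $ 0" using A by simp
          then show False using \<open>n > 0\<close> by simp
        qed
        show "A *\<^sub>v vec n (\<lambda>_. 1) = of_real q \<cdot>\<^sub>v vec n (\<lambda>_. 1)"
        proof (rule eq_vecI)
          fix i assume "i < dim_vec (of_real q \<cdot>\<^sub>v vec n (\<lambda>_. 1) :: complex vec)"
          then have i: "i < n" by simp
          have "(\<Sum>j<n. w (e i) (e j)) = q" using sum.reindex_bij_betw[OF e, of "w (e i)"] row_sum[OF eU[OF i]] by simp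
          then have "(\<Sum>j<n. complex_of_real (w (e i) (e j))) = of_real q" by (metis of_real_sum)
          then show "(A *\<^sub>v vec n (\<lambda>_. 1)) $ i = (of_real q \<cdot>\<^sub>v vec n (\<lambda>_. 1)) $ i"
            using mulvec[OF i, of "vec n (\<lambda>_. 1)"] i by simp
        qed (use A in simp)
      qed (use A in simp)
      then show ?thesis using es(2) unfolding eigenvalue_def by auto
    qed
    show "cmod k \<le> q" if k: "k \<in># mset es" for k
    proof -
      obtain v where "eigenvector A v k" using k es(2) unfolding eigenvalue_def by auto
      then have v: "v \<in> carrier_vec n" "v \<noteq> 0\<^sub>v n" "A *\<^sub>v v = k \<cdot>\<^sub>v v"
        unfolding eigenvector_def using A by auto
      define M where "M = Max ((\<lambda>i. cmod (v $ i)) ` {..<n})"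
      obtain j where j: "j < n" "v $ j \<noteq> 0"
        using v(1,2) by (metis carrier_vecD eq_vecI index_zero_vec)
      have Mge: "cmod (v $ i) \<le> M" if "i < n" for i unfolding M_def using that by (intro Max_ge) auto
      have "M \<in> (\<lambda>i. cmod (v $ i)) ` {..<n}" unfolding M_def using j by (intro Max_in) auto
      then obtain i where i: "i < n" "M = cmod (v $ i)" by auto
      have "M > 0" using Mge[OF j(1)] j(2) by (meson less_le_trans zero_less_norm_iff)
      have "k * v $ i = (\<Sum>j<n. of_real (w (e i) (e j)) * v $ j)"
        using mulvec[OF i(1) v(1)] unfolding v(3) using i(1) v(1) by simp
      then have "cmod k * M = cmod (\<Sum>j<n. of_real (w (e i) (e j)) * v $ j)"
        using i(2) by (metis norm_mult)
      also have "\<dots> \<le> (\<Sum>j<n. w (e i) (e j) * M)"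
        using Mge nonneg by (intro sum_norm_le) (auto simp: norm_mult intro: mult_left_mono)
      also have "\<dots> = q * M"
        using sum.reindex_bij_betw[OF e, of "w (e i)"] row_sum[OF eU[OF i(1)]] by (simp add: sum_distrib_right[symmetric])
      finally show ?thesis using \<open>M > 0\<close> by simp
    qed
  qed
qed

end

section \<open>Closed walks as words\<close>

text \<open>The list contains the inner vertices of a walk between the two given vertices.\<close>

fun chain_weight :: "('a \<Rightarrow> 'a \<Rightarrow> real) \<Rightarrow> 'a \<Rightarrow> 'a list \<Rightarrow> 'a \<Rightarrow> real" where
  "chain_weight w x [] y = w x y"
| "chain_weight w x (z # zs) y = w x z * chain_weight w z zs y"

lemma chain_weight_conv_prod:
  "chain_weight w x zs y = (\<Prod>j<Suc (length zs). w ((x # zs) ! j) ((zs @ [y]) ! j))"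
proof (induction zs arbitrary: x)
  case (Cons z zs)
  show ?case
    unfolding chain_weight.simps(2) Cons.IH
    by (subst (2) prod.lessThan_Suc_shift) simp
qed simp

lemma cyclic_weight_Cons: "cyclic_weight w (x # zs) = chain_weight w x zs x"
proof -
  have "(x # zs) ! (Suc j mod length (x # zs)) = (zs @ [x]) ! j" if "j < Suc (length zs)" for j
    using that by (cases "j = length zs") (auto simp: nth_append)
  then show ?thesis unfolding cyclic_weight_def chain_weight_conv_prod
    by (intro prod.cong) auto
qed

lemma walk_sum_conv_chains:
  assumes rows: "\<And>x. finite {z. w x z \<noteq> 0}"
  shows "finite {zs. length zs = n \<and> chain_weight w x zs y \<noteq> 0} \<and>
    walk_sum w (Suc n) x y = (\<Sum>zs | length zs = n \<and> chain_weight w x zs y \<noteq> 0. chain_weight w x zs y)"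
proof (induction n arbitrary: x)
  case 0
  have "{zs. length zs = 0 \<and> chain_weight w x zs y \<noteq> 0} = (if w x y \<noteq> 0 then {[]} else {})" by auto
  moreover have "walk_sum w (Suc 0) x y = (\<Sum>z | w x z \<noteq> 0. if z = y then w x z else 0)"
    unfolding walk_sum.simps(2) by (intro sum.cong) auto
  ultimately show ?case using rows[of x] by (auto simp: sum.delta)
next
  case (Suc n)
  define C where "C z = {zs. length zs = n \<and> chain_weight w z zs y \<noteq> 0}" for z
  have eq: "{zs. length zs = Suc n \<and> chain_weight w x zs y \<noteq> 0} =
     (\<lambda>(z, zs). z # zs) ` (SIGMA z:{z. w x z \<noteq> 0}. C z)"
  proof (intro equalityI subsetI)
    fix l assume "l \<in> {zs. length zs = Suc n \<and> chain_weight w x zs y \<noteq> 0}"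
    then show "l \<in> (\<lambda>(z, zs). z # zs) ` (SIGMA z:{z. w x z \<noteq> 0}. C z)"
      by (cases l) (auto simp: C_def image_iff)
  qed (auto simp: C_def)
  have fin: "finite (SIGMA z:{z. w x z \<noteq> 0}. C z)" using rows Suc.IH unfolding C_def by auto
  have "walk_sum w (Suc (Suc n)) x y = (\<Sum>z | w x z \<noteq> 0. \<Sum>zs\<in>C z. chain_weight w x (z # zs) y)"
    unfolding walk_sum.simps(2)[of w "Suc n"] C_def using Suc.IH
    by (intro sum.cong) (auto simp: sum_distrib_left)
  also have "\<dots> = (\<Sum>(z, zs)\<in>(SIGMA z:{z. w x z \<noteq> 0}. C z). chain_weight w x (z # zs) y)"
    using rows Suc.IH by (intro sum.Sigma) (auto simp: C_def)
  also have "\<dots> = (\<Sum>zs | length zs = Suc n \<and> chain_weight w x zs y \<noteq> 0. chain_weight w x zs y)"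
    unfolding eq by (subst sum.reindex) (auto simp: inj_on_def case_prod_unfold)
  finally show ?case unfolding eq using fin by simp
qed

definition closed_walks :: "('a \<Rightarrow> 'a \<Rightarrow> real) \<Rightarrow> nat \<Rightarrow> 'a list set" where
  "closed_walks w m = {p. length p = m \<and> cyclic_weight w p \<noteq> 0}"

lemma walk_sum_conv_closed_walks:
  assumes rows: "\<And>x. finite {z. w x z \<noteq> 0}" and m: "m > 0"
  shows "finite {p \<in> closed_walks w m. hd p = x}"
    "(\<Sum>p | p \<in> closed_walks w m \<and> hd p = x. cyclic_weight w p) = walk_sum w m x x"
proof -
  obtain n where n: "m = Suc n" using m by (cases m) auto
  have eq: "{p \<in> closed_walks w m. hd p = x} = (#) x ` {zs. length zs = n \<and> chain_weight w x zs x \<noteq> 0}"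
  proof (intro equalityI subsetI)
    fix p assume "p \<in> {p \<in> closed_walks w m. hd p = x}"
    then show "p \<in> (#) x ` {zs. length zs = n \<and> chain_weight w x zs x \<noteq> 0}"
      unfolding closed_walks_def n by (cases p) (auto simp: cyclic_weight_Cons)
  qed (auto simp: closed_walks_def n cyclic_weight_Cons)
  show "finite {p \<in> closed_walks w m. hd p = x}"
    unfolding eq using walk_sum_conv_chains[OF rows] by simp
  show "(\<Sum>p | p \<in> closed_walks w m \<and> hd p = x. cyclic_weight w p) = walk_sum w m x x"
    unfolding eq using walk_sum_conv_chains[of w n x x, OF rows]
    by (subst sum.reindex) (auto simp: inj_on_def cyclic_weight_Cons n)
qed

lemma sum_closed_walks:
  assumes rows: "\<And>x. finite {z. w x z \<noteq> 0}" and m: "m > 0"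
    and fin: "finite U" and supp: "\<And>x z. w x z \<noteq> 0 \<Longrightarrow> x \<in> U"
  shows "finite (closed_walks w m)"
    "(\<Sum>p\<in>closed_walks w m. cyclic_weight w p) = (\<Sum>x\<in>U. walk_sum w m x x)"
proof -
  have hd: "hd p \<in> U" if "p \<in> closed_walks w m" for p
  proof -
    have "p \<noteq> []" "cyclic_weight w p \<noteq> 0" using that m unfolding closed_walks_def by auto
    then have "\<forall>j\<in>{..<length p}. w (p ! j) (p ! (Suc j mod length p)) \<noteq> 0"
      unfolding cyclic_weight_def by (simp add: prod_zero_iff)
    then have "w (p ! 0) (p ! (Suc 0 mod length p)) \<noteq> 0" using \<open>p \<noteq> []\<close> by blast
    then show ?thesis using supp \<open>p \<noteq> []\<close> by (simp add: hd_conv_nth)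
  qed
  have eq: "closed_walks w m = (\<Union>x\<in>U. {p \<in> closed_walks w m. hd p = x})" using hd by auto
  show fincw: "finite (closed_walks w m)"
    by (subst eq) (use fin walk_sum_conv_closed_walks(1)[OF rows m] in auto)
  have "(\<Sum>p\<in>closed_walks w m. cyclic_weight w p) =
      (\<Sum>x\<in>U. \<Sum>p | p \<in> closed_walks w m \<and> hd p = x. cyclic_weight w p)"
    by (rule sum.group[symmetric]) (use fincw fin hd in auto)
  then show "(\<Sum>p\<in>closed_walks w m. cyclic_weight w p) = (\<Sum>x\<in>U. walk_sum w m x x)"
    using walk_sum_conv_closed_walks(2)[OF rows m] by simp
qed

section \<open>Marking visits\<close>

definition marked :: "'a set \<Rightarrow> real \<Rightarrow> ('a \<Rightarrow> 'a \<Rightarrow> real) \<Rightarrow> 'a \<Rightarrow> 'a \<Rightarrow> real" where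
  "marked S t w x y = w x y * (if y \<in> S then t else 1)"

definition visits :: "'a set \<Rightarrow> 'a list \<Rightarrow> nat" where
  "visits S p = card {j. j < length p \<and> p ! j \<in> S}"

lemma cyclic_weight_marked: "cyclic_weight (marked S t w) p = cyclic_weight w p * t ^ visits S p"
proof (cases "p = []")
  case False
  have "(\<Prod>j<length p. if p ! (Suc j mod length p) \<in> S then t else 1) =
        (\<Prod>j<length p. (\<lambda>i. if p ! i \<in> S then t else 1) ((1 + j) mod length p))"
    by simp
  also have "\<dots> = (\<Prod>j<length p. if p ! j \<in> S then t else 1)"
    using False by (intro prod_mod_shift) simp
  also have "\<dots> = t ^ visits S p"
  proof -
    have "{..<length p} \<inter> {j. p ! j \<in> S} = {j. j < length p \<and> p ! j \<in> S}" by auto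
    then show ?thesis unfolding visits_def by (simp add: prod.If_cases)
  qed
  finally show ?thesis unfolding cyclic_weight_def marked_def by (simp add: prod.distrib)
qed (simp add: cyclic_weight_def visits_def)

text \<open>Double counting: rotating a closed walk moves each of its visits to the first position.\<close>

lemma sum_visits:
  fixes f :: "'a list \<Rightarrow> real"
  assumes fin: "finite (closed_walks w m)" and m: "m > 0"
    and inv: "\<And>p n. f (rotate n p) = f p"
  shows "(\<Sum>p\<in>closed_walks w m. real (visits S p) * f p) =
     real m * (\<Sum>p | p \<in> closed_walks w m \<and> hd p \<in> S. f p)"
proof -
  have "(\<Sum>p\<in>closed_walks w m. real (visits S p) * f p) =
      (\<Sum>p\<in>closed_walks w m. \<Sum>j<m. if p ! j \<in> S then f p else 0)"
  proof (rule sum.cong)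
    fix p assume p: "p \<in> closed_walks w m"
    then have "{..<m} \<inter> {j. p ! j \<in> S} = {j. j < length p \<and> p ! j \<in> S}"
      unfolding closed_walks_def by auto
    then show "real (visits S p) * f p = (\<Sum>j<m. if p ! j \<in> S then f p else 0)"
      unfolding visits_def by (simp add: sum.If_cases)
  qed simp
  also have "\<dots> = (\<Sum>j<m. \<Sum>p\<in>closed_walks w m. if p ! j \<in> S then f p else 0)" by (rule sum.swap)
  also have "\<dots> = (\<Sum>j<m. \<Sum>p\<in>closed_walks w m. if hd p \<in> S then f p else 0)"
  proof (rule sum.cong)
    fix j assume j: "j \<in> {..<m}"
    have "inj_on (rotate j) (closed_walks w m)" 
      unfolding rotate_def by (intro inj_on_subset[OF inj_fn[OF inj_rotate1]]) auto
    moreover have "rotate j ` closed_walks w m \<subseteq> closed_walks w m"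
      unfolding closed_walks_def by (auto simp: cyclic_weight_rotate)
    ultimately have "bij_betw (rotate j) (closed_walks w m) (closed_walks w m)"
      using fin by (simp add: bij_betw_def endo_inj_surj)
    then have "(\<Sum>p\<in>closed_walks w m. if hd p \<in> S then f p else 0) =
      (\<Sum>p\<in>closed_walks w m. if hd (rotate j p) \<in> S then f (rotate j p) else 0)"
      by (rule sum.reindex_bij_betw[symmetric])
    also have "\<dots> = (\<Sum>p\<in>closed_walks w m. if p ! j \<in> S then f p else 0)"
    proof (rule sum.cong)
      fix p assume "p \<in> closed_walks w m"
      then have "length p = m" unfolding closed_walks_def by simp
      then have "hd (rotate j p) = p ! j" using hd_rotate_conv_nth[of p j] j m by (cases p) auto
      then show "(if hd (rotate j p) \<in> S then f (rotate j p) else 0) = (if p ! j \<in> S then f p else 0)"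
        by (simp add: inv)
    qed simp
    finally show "(\<Sum>p\<in>closed_walks w m. if p ! j \<in> S then f p else 0) =
      (\<Sum>p\<in>closed_walks w m. if hd p \<in> S then f p else 0)" ..
  qed simp
  also have "\<dots> = real m * (\<Sum>p | p \<in> closed_walks w m \<and> hd p \<in> S. f p)"
    using fin by (simp add: sum.inter_filter)
  finally show ?thesis .
qed

lemma sum_visits_walk_sum:
  assumes fin: "finite (closed_walks w m)" and m: "m > 0" and S: "finite S"
    and rows: "\<And>x. finite {z. w x z \<noteq> 0}"
  shows "(\<Sum>p\<in>closed_walks w m. real (visits S p) * (cyclic_weight w p * t ^ visits S p)) =
     real m * (\<Sum>x\<in>S. walk_sum (marked S t w) m x x)"
proof -
  have rows': "finite {z. marked S t w x z \<noteq> 0}" for x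
    by (rule finite_subset[OF _ rows[of x]]) (auto simp: marked_def)
  have "(\<Sum>p\<in>closed_walks w m. real (visits S p) * (cyclic_weight w p * t ^ visits S p)) =
      real m * (\<Sum>p | p \<in> closed_walks w m \<and> hd p \<in> S. cyclic_weight (marked S t w) p)"
    unfolding cyclic_weight_marked[symmetric]
    by (intro sum_visits fin m cyclic_weight_rotate)
  also have "(\<Sum>p | p \<in> closed_walks w m \<and> hd p \<in> S. cyclic_weight (marked S t w) p) =
      (\<Sum>x\<in>S. \<Sum>p | p \<in> {p \<in> closed_walks w m. hd p \<in> S} \<and> hd p = x. cyclic_weight (marked S t w) p)"
    by (rule sum.group[symmetric]) (use fin S in auto)
  also have "\<dots> = (\<Sum>x\<in>S. walk_sum (marked S t w) m x x)"
  proof (rule sum.cong)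
    fix x assume x: "x \<in> S"
    have "(\<Sum>p | p \<in> {p \<in> closed_walks w m. hd p \<in> S} \<and> hd p = x. cyclic_weight (marked S t w) p) =
       (\<Sum>p | p \<in> closed_walks (marked S t w) m \<and> hd p = x. cyclic_weight (marked S t w) p)"
      using x by (intro sum.mono_neutral_right finite_subset[OF _ fin])
        (auto simp: closed_walks_def cyclic_weight_marked)
    then show "(\<Sum>p | p \<in> {p \<in> closed_walks w m. hd p \<in> S} \<and> hd p = x. cyclic_weight (marked S t w) p) =
       walk_sum (marked S t w) m x x"
      using walk_sum_conv_closed_walks(2)[of "marked S t w", OF rows' m] by simp
  qed simp
  finally show ?thesis .
qed

text \<open>Each marked closed walk, counted with its number of visits, can be rotated so that it starts in
  \<open>S\<close>. So the generating polynomials of the visits have the same derivative if the marked closed walks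
  that start in \<open>S\<close> have equal weights, and then only the constant terms, which count the walks that
  avoid \<open>S\<close>, can differ.\<close>

lemma closed_walks_compare:
  assumes fin: "finite (closed_walks w m)" "finite (closed_walks w' m)" and m: "m > 0" and S: "finite S"
    and rows: "\<And>x. finite {z. w x z \<noteq> 0}" "\<And>x. finite {z. w' x z \<noteq> 0}"
    and eq: "\<And>t x. x \<in> S \<Longrightarrow> walk_sum (marked S t w) m x x = walk_sum (marked S t w') m x x"
  shows "(\<Sum>p\<in>closed_walks w m. cyclic_weight w p) - (\<Sum>p\<in>closed_walks w m. cyclic_weight (marked S 0 w) p) =
    (\<Sum>p\<in>closed_walks w' m. cyclic_weight w' p) - (\<Sum>p\<in>closed_walks w' m. cyclic_weight (marked S 0 w') p)"
proof -
  define D where "D t = (\<Sum>p\<in>closed_walks w m. cyclic_weight w p * t ^ visits S p) -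
     (\<Sum>p\<in>closed_walks w' m. cyclic_weight w' p * t ^ visits S p)" for t
  have deriv: "DERIV D t :> 0" if t: "t > 0" for t
  proof -
    define D' where "D' = (\<Sum>p\<in>closed_walks w m. cyclic_weight w p * (real (visits S p) * t ^ (visits S p - 1))) -
     (\<Sum>p\<in>closed_walks w' m. cyclic_weight w' p * (real (visits S p) * t ^ (visits S p - 1)))"
    have "DERIV D t :> D'" unfolding D_def D'_def
      by (auto intro!: derivative_eq_intros sum.cong simp: mult.commute)
    moreover have "t * D' = 0"
    proof -
      have shift: "t * (c * (real v * t ^ (v - 1))) = real v * (c * t ^ v)" for c v
        by (cases v) auto
      have "t * D' = (\<Sum>p\<in>closed_walks w m. real (visits S p) * (cyclic_weight w p * t ^ visits S p)) -
         (\<Sum>p\<in>closed_walks w' m. real (visits S p) * (cyclic_weight w' p * t ^ visits S p))"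
        unfolding D'_def right_diff_distrib sum_distrib_left shift ..
      also have "\<dots> = 0"
        using sum_visits_walk_sum[OF fin(1) m S rows(1)] sum_visits_walk_sum[OF fin(2) m S rows(2)] eq
        by simp
      finally show ?thesis .
    qed
    ultimately show ?thesis using t by simp
  qed
  have "D 1 = D 0"
  proof (rule DERIV_isconst_end[of 0 1 D])
    show "continuous_on {0..1} D" unfolding D_def by (intro continuous_intros)
    show "\<And>x. 0 < x \<Longrightarrow> x < 1 \<Longrightarrow> DERIV D x :> 0" using deriv by simp
  qed simp
  then show ?thesis unfolding D_def cyclic_weight_marked by simp
qed

section \<open>Replacing the cusps by finite loops\<close>

definition cusped_states :: "'a set \<Rightarrow> 'i set \<Rightarrow> ('i \<Rightarrow> nat \<Rightarrow> 'a) \<Rightarrow> ('i \<Rightarrow> nat \<Rightarrow> 'a) \<Rightarrow> 'a set" where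
  "cusped_states K I out inn = K \<union> {out a i | a i. a \<in> I} \<union> {inn a i | a i. a \<in> I}"

text \<open>The states form a finite set \<open>K\<close> together with, for each cusp \<open>a \<in> I\<close>, arcs \<open>out a 0, out a 1, \<dots>\<close>
  that lead one after the other into the cusp, and their reverses \<open>inn a i\<close>, which lead back. From
  \<open>out a i\<close> one goes on to \<open>out a (i + 1)\<close> or turns to \<open>inn a i\<close>; having turned, one can only go all the
  way back. The conditions on columns say that a cusp is entered through \<open>out a 0\<close> only.\<close>

locale cusped_weights =
  fixes w :: "'a \<Rightarrow> 'a \<Rightarrow> real" and q :: real and K :: "'a set" and I :: "'i set"
    and out inn :: "'i \<Rightarrow> nat \<Rightarrow> 'a"
  assumes q_gt_1: "q > 1"
    and finite_K: "finite K" and finite_I: "finite I"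
    and states_nonempty: "cusped_states K I out inn \<noteq> {}"
    and out_inject: "\<And>a b i j. a \<in> I \<Longrightarrow> b \<in> I \<Longrightarrow> out a i = out b j \<Longrightarrow> a = b \<and> i = j"
    and inn_inject: "\<And>a b i j. a \<in> I \<Longrightarrow> b \<in> I \<Longrightarrow> inn a i = inn b j \<Longrightarrow> a = b \<and> i = j"
    and out_inn: "\<And>a b i j. a \<in> I \<Longrightarrow> b \<in> I \<Longrightarrow> out a i \<noteq> inn b j"
    and out_K: "\<And>a i. a \<in> I \<Longrightarrow> out a i \<notin> K" and inn_K: "\<And>a i. a \<in> I \<Longrightarrow> inn a i \<notin> K"
    and w_nonneg: "\<And>x y. w x y \<ge> 0"
    and w_support: "\<And>x y. w x y \<noteq> 0 \<Longrightarrow> x \<in> cusped_states K I out inn \<and> y \<in> cusped_states K I out inn"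
    and row_out: "\<And>a i y. a \<in> I \<Longrightarrow>
      w (out a i) y = (if y = out a (Suc i) then 1 else if y = inn a i then q - 1 else 0)"
    and row_inn: "\<And>a i y. a \<in> I \<Longrightarrow> w (inn a (Suc i)) y = (if y = inn a i then q else 0)"
    and col_out: "\<And>a i x. a \<in> I \<Longrightarrow> w x (out a (Suc i)) \<noteq> 0 \<Longrightarrow> x = out a i"
    and col_inn: "\<And>a i x. a \<in> I \<Longrightarrow> w x (inn a (Suc i)) \<noteq> 0 \<Longrightarrow> x = out a (Suc i) \<or> x = inn a (Suc (Suc i))"
    and row_core: "\<And>x. x \<in> K \<union> (\<lambda>a. inn a 0) ` I \<Longrightarrow> (\<Sum>y | w x y \<noteq> 0. w x y) = q"
    and connected: "\<And>x y. x \<in> cusped_states K I out inn \<Longrightarrow> y \<in> cusped_states K I out inn \<Longrightarrow>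
      (x, y) \<in> {(x, y). w x y > 0}\<^sup>*"
begin

text \<open>The arcs that lead out of a cusp at its mouth are included, so that a closed walk cannot avoid the
  core.\<close>

definition core :: "'a set" where
  "core = K \<union> (\<lambda>a. inn a 0) ` I"

definition folded_states :: "'a set" where
  "folded_states = core \<union> (\<lambda>a. out a 0) ` I \<union> (\<lambda>a. out a 1) ` I"

text \<open>A cusp is replaced by a loop of length two attached to its first arc: an excursion that turns back
  after \<open>out a k\<close> corresponds to \<open>k\<close> rounds of the loop, with the same length and the same weight. The
  arc \<open>out a 1\<close> becomes the second half of the loop.\<close>

definition folded :: "'a \<Rightarrow> 'a \<Rightarrow> real" where
  "folded x y = (if x \<in> folded_states \<and> y \<in> folded_states then
     if x \<in> (\<lambda>a. out a 1) ` I then (if \<exists>a\<in>I. x = out a 1 \<and> y = out a 0 then q else 0) else w x y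
     else 0)"

lemma finite_core: "finite core" and finite_folded_states: "finite folded_states"
  unfolding folded_states_def core_def using finite_K finite_I by auto

lemma core_iff:
  assumes "a \<in> I"
  shows "out a i \<notin> core" "inn a i \<in> core \<longleftrightarrow> i = 0"
  using assms out_K inn_K out_inn inn_inject unfolding core_def by blast+

lemma inn_out: "a \<in> I \<Longrightarrow> b \<in> I \<Longrightarrow> inn b j \<noteq> out a i"
  using out_inn by metis

lemma out_neq: "a \<in> I \<Longrightarrow> b \<in> I \<Longrightarrow> i \<noteq> j \<Longrightarrow> out a i \<noteq> out b j"
  using out_inject by blast

lemma folded_states_iff:
  assumes "a \<in> I"
  shows "out a 0 \<in> folded_states" "out a 1 \<in> folded_states" "inn a 0 \<in> folded_states"
    "out a (Suc (Suc i)) \<notin> folded_states" "inn a (Suc i) \<notin> folded_states"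
proof -
  show "out a 0 \<in> folded_states" "out a 1 \<in> folded_states" "inn a 0 \<in> folded_states"
    unfolding folded_states_def core_def using assms by auto
  show "out a (Suc (Suc i)) \<notin> folded_states"
    unfolding folded_states_def using assms core_iff(1)[OF assms] out_neq[OF assms] by auto
  show "inn a (Suc i) \<notin> folded_states"
    unfolding folded_states_def using assms core_iff(2)[OF assms] out_inn[OF _ assms, symmetric] by auto
qed

lemma core_row_support:
  assumes x: "x \<in> core" and y: "w x y \<noteq> 0"
  shows "y \<in> core \<union> (\<lambda>a. out a 0) ` I"
proof -
  consider "y \<in> K" | a i where "a \<in> I" "y = out a i" | a i where "a \<in> I" "y = inn a i"
    using w_support[OF y] unfolding cusped_states_def by auto
  then show ?thesis
  proof cases
    case 2
    then show ?thesis using col_out[of a x] y core_iff(1)[of a] x by (cases i) auto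
  next
    case 3
    show ?thesis
    proof (cases i)
      case 0
      then show ?thesis using 3 unfolding core_def by auto
    next
      case (Suc j)
      then have "x = out a (Suc j) \<or> x = inn a (Suc (Suc j))" using col_inn[OF 3(1)] y 3(2) by simp
      then show ?thesis using core_iff[OF 3(1)] x by auto
    qed
  qed (simp add: core_def)
qed

lemma folded_core: "x \<in> core \<Longrightarrow> folded x y = w x y"
proof -
  assume x: "x \<in> core"
  then have "x \<in> folded_states" "x \<notin> (\<lambda>a. out a 1) ` I"
    using core_iff(1) unfolding folded_states_def by auto
  moreover have "w x y \<noteq> 0 \<Longrightarrow> y \<in> folded_states"
    using core_row_support[OF x] unfolding folded_states_def by blast
  ultimately show ?thesis unfolding folded_def by auto
qed

lemma folded_out_0: "a \<in> I \<Longrightarrow>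
  folded (out a 0) y = (if y = out a 1 then 1 else if y = inn a 0 then q - 1 else 0)"
proof -
  assume a: "a \<in> I"
  have "out a 0 \<notin> (\<lambda>a. out a 1) ` I" using out_neq[OF a, of _ 0 1] by auto
  then show ?thesis unfolding folded_def using folded_states_iff[OF a] row_out[OF a] by auto
qed

lemma folded_out_1: "a \<in> I \<Longrightarrow> folded (out a 1) y = (if y = out a 0 then q else 0)"
proof -
  assume a: "a \<in> I"
  have "(\<exists>b\<in>I. out a 1 = out b 1 \<and> y = out b 0) \<longleftrightarrow> y = out a 0" using out_inject a by blast
  moreover have "out a 1 \<in> (\<lambda>a. out a 1) ` I" using a by blast
  ultimately have "folded (out a 1) y = (if out a 1 \<in> folded_states \<and> y \<in> folded_states
      then if y = out a 0 then q else 0 else 0)"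
    unfolding folded_def by (simp only: if_True)
  then show ?thesis using folded_states_iff(1,2)[OF a] by auto
qed

lemma folded_support: "folded x y \<noteq> 0 \<Longrightarrow> x \<in> folded_states \<and> y \<in> folded_states"
  unfolding folded_def by (auto split: if_splits)

lemma folded_nonneg: "folded x y \<ge> 0"
  unfolding folded_def using w_nonneg q_gt_1 by auto

lemma folded_states_cases:
  assumes "x \<in> folded_states"
  obtains "x \<in> core" | a where "a \<in> I" "x = out a 0" | a where "a \<in> I" "x = out a 1"
  using assms unfolding folded_states_def by auto

lemma folded_row_sum: "x \<in> folded_states \<Longrightarrow> (\<Sum>y\<in>folded_states. folded x y) = q"
proof (erule folded_states_cases)
  assume x: "x \<in> core"
  have "(\<Sum>y\<in>folded_states. folded x y) = (\<Sum>y\<in>folded_states. w x y)" using folded_core[OF x] by simp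
  also have "\<dots> = (\<Sum>y | w x y \<noteq> 0. w x y)"
    using finite_folded_states core_row_support[OF x]
    by (intro sum.mono_neutral_right) (auto simp: folded_states_def)
  finally show ?thesis using row_core x unfolding core_def by simp
next
  fix a assume a: "a \<in> I" "x = out a 0"
  have "(\<Sum>y\<in>folded_states. folded x y) = (\<Sum>y\<in>{out a 1, inn a 0}. folded x y)"
    using finite_folded_states folded_states_iff[OF a(1)] folded_out_0[OF a(1)] unfolding a(2)
    by (intro sum.mono_neutral_right) auto
  then show ?thesis using folded_out_0[OF a(1)] inn_out[OF a(1) a(1)] out_inn[OF a(1) a(1)] unfolding a(2) by simp
next
  fix a assume a: "a \<in> I" "x = out a 1"
  have "(\<Sum>y\<in>folded_states. folded x y) = (\<Sum>y\<in>{out a 0}. folded x y)"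
    using finite_folded_states folded_states_iff[OF a(1)] folded_out_1[OF a(1)] unfolding a(2)
    by (intro sum.mono_neutral_right) auto
  then show ?thesis using folded_out_1[OF a(1)] unfolding a(2) by simp
qed

text \<open>Folding winds a cusp around its loop, in both directions. It maps transitions of positive weight to
  such transitions, so connectedness descends to the folded graph.\<close>

definition fold_map :: "'a \<Rightarrow> 'a" where
  "fold_map x = (if x \<in> core then x else
     if \<exists>a\<in>I. \<exists>i. (x = out a i \<and> even i) \<or> (x = inn a i \<and> odd i)
     then out (SOME a. a \<in> I \<and> (\<exists>i. x = out a i \<or> x = inn a i)) 0
     else out (SOME a. a \<in> I \<and> (\<exists>i. x = out a i \<or> x = inn a i)) 1)"

lemma fold_map_simps:
  assumes a: "a \<in> I"
  shows "fold_map (out a i) = out a (i mod 2)" "fold_map (inn a (Suc i)) = out a (i mod 2)"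
proof -
  have some: "(SOME b. b \<in> I \<and> (\<exists>i. x = out b i \<or> x = inn b i)) = a" if x: "x = out a i \<or> x = inn a i" for x i
  proof (rule some_equality)
    show "a \<in> I \<and> (\<exists>i. x = out a i \<or> x = inn a i)" using a x by blast
    fix b assume "b \<in> I \<and> (\<exists>i. x = out b i \<or> x = inn b i)"
    then obtain j where b: "b \<in> I" "x = out b j \<or> x = inn b j" by blast
    then show "b = a"
      using x out_inject[OF b(1) a, of j i] inn_inject[OF b(1) a, of j i]
        out_inn[OF b(1) a, of j i] out_inn[OF a b(1), of i j] by auto
  qed
  have ev: "(\<exists>b\<in>I. \<exists>j. (out a i = out b j \<and> even j) \<or> (out a i = inn b j \<and> odd j)) \<longleftrightarrow> even i" for i
  proof
    assume "even i"
    then show "\<exists>b\<in>I. \<exists>j. (out a i = out b j \<and> even j) \<or> (out a i = inn b j \<and> odd j)" using a by blast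
  qed (use out_inject[OF a] out_inn[OF a] in auto)
  have ev': "(\<exists>b\<in>I. \<exists>j. (inn a i = out b j \<and> even j) \<or> (inn a i = inn b j \<and> odd j)) \<longleftrightarrow> odd i" for i
  proof
    assume "odd i"
    then show "\<exists>b\<in>I. \<exists>j. (inn a i = out b j \<and> even j) \<or> (inn a i = inn b j \<and> odd j)" using a by blast
  qed (use inn_inject[OF a] inn_out[OF _ a] in auto)
  show "fold_map (out a i) = out a (i mod 2)"
    unfolding fold_map_def ev using core_iff(1)[OF a] some[of "out a i" i] by (auto simp: odd_iff_mod_2_eq_one)
  show "fold_map (inn a (Suc i)) = out a (i mod 2)"
    unfolding fold_map_def ev' using core_iff(2)[OF a, of "Suc i"] some[of "inn a (Suc i)" "Suc i"]
    by (auto simp: odd_iff_mod_2_eq_one)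
qed

lemma fold_map_id: "x \<in> folded_states \<Longrightarrow> fold_map x = x"
  by (erule folded_states_cases) (auto simp: fold_map_simps, simp add: fold_map_def)

lemma fold_map_step:
  assumes "w x y > 0"
  shows "folded (fold_map x) (fold_map y) > 0"
proof -
  have xV: "x \<in> cusped_states K I out inn" using w_support[of x y] assms by auto
  have pos: "0 < q - 1" "0 < q" using q_gt_1 by auto
  have step: "folded (out a (i mod 2)) (out a (Suc i mod 2)) > 0" if "a \<in> I" for a i
    using that pos folded_out_0[OF that] folded_out_1[OF that] by (cases "even i") (auto simp: odd_iff_mod_2_eq_one)
  consider "x \<in> core" | a i where "a \<in> I" "x = out a i" | a i where "a \<in> I" "x = inn a (Suc i)"
  proof -
    have "\<exists>j. i = Suc j" if "inn a i \<notin> core" "a \<in> I" for a i using core_iff(2)[OF that(2), of i] that(1) by (cases i) auto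
    then show ?thesis using xV that unfolding cusped_states_def by (auto simp: core_def) blast
  qed
  then show ?thesis
  proof cases
    case 1
    then have "y \<in> core \<union> (\<lambda>a. out a 0) ` I" using core_row_support[of x y] assms by simp
    then have "fold_map y = y" "fold_map x = x" using 1 fold_map_id unfolding folded_states_def by auto
    then show ?thesis using folded_core[OF 1] assms by simp
  next
    case 2
    then have "y = out a (Suc i) \<or> y = inn a i" using assms row_out[OF 2(1), of i y] by (auto split: if_splits)
    then show ?thesis
    proof
      assume "y = out a (Suc i)"
      then show ?thesis using step[OF 2(1)] fold_map_simps(1)[OF 2(1)] 2(2) by simp
    next
      assume y: "y = inn a i"
      show ?thesis
      proof (cases i)
        case 0
        have "fold_map (inn a 0) = inn a 0" using fold_map_id folded_states_iff(3)[OF 2(1)] by simp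
        then show ?thesis using folded_out_0[OF 2(1)] inn_out[OF 2(1) 2(1)] out_inn[OF 2(1) 2(1)] pos
          fold_map_simps(1)[OF 2(1), of 0] unfolding 2(2) y 0 by simp
      next
        case (Suc j)
        have "folded (out a (Suc j mod 2)) (out a (j mod 2)) > 0"
          using step[OF 2(1), of "Suc j"] by simp
        then show ?thesis using fold_map_simps[OF 2(1)] unfolding 2(2) y Suc by simp
      qed
    qed
  next
    case 3
    then have y: "y = inn a i" using assms row_inn[OF 3(1), of i y] by (auto split: if_splits)
    show ?thesis
    proof (cases i)
      case 0
      have "fold_map (inn a 0) = inn a 0" using fold_map_id folded_states_iff(3)[OF 3(1)] by simp
      then show ?thesis using folded_out_0[OF 3(1)] inn_out[OF 3(1) 3(1)] out_inn[OF 3(1) 3(1)] pos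
        fold_map_simps(2)[OF 3(1), of 0] unfolding 3(2) y 0 by simp
    next
      case (Suc j)
      have "folded (out a (Suc j mod 2)) (out a (j mod 2)) > 0"
        using step[OF 3(1), of "Suc j"] by simp
      then show ?thesis using fold_map_simps[OF 3(1)] unfolding 3(2) y Suc by simp
    qed
  qed
qed

lemma folded_states_subset: "folded_states \<subseteq> cusped_states K I out inn"
  unfolding folded_states_def core_def cusped_states_def by auto

lemma folded_walk_pos:
  assumes "(x, y) \<in> {(x, y). folded x y > 0}\<^sup>*"
  shows "\<exists>n. walk_sum folded n x y > 0"
  using assms
proof (induction rule: converse_rtrancl_induct)
  case base
  then show ?case by (intro exI[of _ 0]) simp
next
  case (step x z)
  then obtain n where n: "walk_sum folded n z y > 0" by blast
  have nn: "walk_sum folded n x y \<ge> 0" for n x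
    by (induction n arbitrary: x) (auto simp: walk_sum.simps(2) intro!: sum_nonneg mult_nonneg_nonneg folded_nonneg)
  have z: "z \<in> folded_states" using step(1) folded_support[of x z] by auto
  have "walk_sum folded (Suc n) x y = (\<Sum>v\<in>folded_states. folded x v * walk_sum folded n v y)"
    using folded_support by (intro walk_sum_Suc finite_folded_states) auto
  also have "\<dots> > 0"
    using step(1) n z finite_folded_states
    by (intro sum_pos2[of folded_states z]) (auto intro!: mult_pos_pos mult_nonneg_nonneg folded_nonneg nn)
  finally show ?case by blast
qed

lemma irreducible_folded: "irreducible_row_constant folded_states folded q"
proof
  show "finite folded_states" by (rule finite_folded_states)
  show "folded_states \<noteq> {}"
  proof -
    obtain x where "x \<in> cusped_states K I out inn" using states_nonempty by auto
    then have "K \<noteq> {} \<or> I \<noteq> {}" unfolding cusped_states_def by auto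
    then show ?thesis unfolding folded_states_def core_def by auto
  qed
  show "folded x y \<noteq> 0 \<Longrightarrow> x \<in> folded_states \<and> y \<in> folded_states" for x y by (rule folded_support)
  show "0 \<le> folded x y" for x y by (rule folded_nonneg)
  show "x \<in> folded_states \<Longrightarrow> sum (folded x) folded_states = q" for x by (rule folded_row_sum)
  show "0 < q" using q_gt_1 by simp
  fix x y assume xy: "x \<in> folded_states" "y \<in> folded_states"
  then have "(x, y) \<in> {(x, y). w x y > 0}\<^sup>*" using connected folded_states_subset by blast
  then have "(fold_map x, fold_map y) \<in> {(x, y). folded x y > 0}\<^sup>*"
    by (induction rule: rtrancl_induct) (auto intro: rtrancl_into_rtrancl fold_map_step)
  then have "(x, y) \<in> {(x, y). folded x y > 0}\<^sup>*"
    unfolding fold_map_id[OF xy(1)] fold_map_id[OF xy(2)] .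
  then show "\<exists>n. 0 < walk_sum folded n x y" by (rule folded_walk_pos)
qed

lemma finite_row: "finite {y. w x y \<noteq> 0}"
proof (cases "x \<in> cusped_states K I out inn")
  case True
  have 1: "finite {y. w x y \<noteq> 0}" if "x \<in> core"
  proof (rule finite_subset)
    show "{y. w x y \<noteq> 0} \<subseteq> core \<union> (\<lambda>a. out a 0) ` I" using core_row_support[OF that] by blast
    show "finite (core \<union> (\<lambda>a. out a 0) ` I)" using finite_core finite_I by simp
  qed
  have 2: "finite {y. w x y \<noteq> 0}" if "a \<in> I" "x = out a i" for a i
    by (rule finite_subset[of _ "{out a (Suc i), inn a i}"]) (auto simp: that row_out split: if_splits)
  have 3: "finite {y. w x y \<noteq> 0}" if "a \<in> I" "x = inn a i" for a i
  proof (cases i)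
    case 0
    then have "x \<in> core" using core_iff(2)[OF that(1), of 0] that(2) by simp
    then show ?thesis by (rule 1)
  next
    case (Suc j)
    then have "w x y = (if y = inn a j then q else 0)" for y
      using row_inn[OF that(1)] that(2) by simp
    then have "{y. w x y \<noteq> 0} \<subseteq> {inn a j}" by auto
    then show ?thesis by (rule finite_subset) simp
  qed
  have "x \<in> core \<or> (\<exists>a\<in>I. \<exists>i. x = out a i \<or> x = inn a i)"
    using True unfolding cusped_states_def core_def by blast
  then show ?thesis by (elim disjE bexE exE) (erule 1, erule (1) 2, erule (1) 3)
next
  case False
  then have "{y. w x y \<noteq> 0} = {}" using w_support by blast
  then show ?thesis by simp
qed

section \<open>Marked walks before and after folding\<close>

lemma marked_walk_out:
  assumes a: "a \<in> I"
  shows "walk_sum (marked core t w) (Suc n) (out a i) y = walk_sum (marked core t w) n (out a (Suc i)) y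
     + (q - 1) * (if i = 0 then t else 1) * walk_sum (marked core t w) n (inn a i) y"
proof -
  have "walk_sum (marked core t w) (Suc n) (out a i) y =
    (\<Sum>z\<in>{out a (Suc i), inn a i}. marked core t w (out a i) z * walk_sum (marked core t w) n z y)"
    by (rule walk_sum_Suc) (auto simp: marked_def row_out[OF a] split: if_splits)
  then show ?thesis using out_inn[OF a a] inn_out[OF a a] core_iff[OF a]
    by (auto simp: marked_def row_out[OF a])
qed

lemma marked_walk_inn:
  assumes a: "a \<in> I"
  shows "walk_sum (marked core t w) (Suc n) (inn a (Suc i)) y =
     q * (if i = 0 then t else 1) * walk_sum (marked core t w) n (inn a i) y"
proof -
  have "walk_sum (marked core t w) (Suc n) (inn a (Suc i)) y =
    (\<Sum>z\<in>{inn a i}. marked core t w (inn a (Suc i)) z * walk_sum (marked core t w) n z y)"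
    by (rule walk_sum_Suc) (auto simp: marked_def row_inn[OF a] split: if_splits)
  then show ?thesis using core_iff[OF a] by (auto simp: marked_def row_inn[OF a])
qed

lemma folded_walk_out_0:
  assumes a: "a \<in> I"
  shows "walk_sum (marked core t folded) (Suc n) (out a 0) y = walk_sum (marked core t folded) n (out a 1) y
     + (q - 1) * t * walk_sum (marked core t folded) n (inn a 0) y"
proof -
  have "walk_sum (marked core t folded) (Suc n) (out a 0) y =
    (\<Sum>z\<in>{out a 1, inn a 0}. marked core t folded (out a 0) z * walk_sum (marked core t folded) n z y)"
    by (rule walk_sum_Suc) (auto simp: marked_def folded_out_0[OF a] split: if_splits)
  then show ?thesis using out_inn[OF a a] inn_out[OF a a] core_iff[OF a]
    by (auto simp: marked_def folded_out_0[OF a])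
qed

lemma folded_walk_out_1:
  assumes a: "a \<in> I"
  shows "walk_sum (marked core t folded) (Suc n) (out a 1) y = q * walk_sum (marked core t folded) n (out a 0) y"
proof -
  have "walk_sum (marked core t folded) (Suc n) (out a 1) y =
    (\<Sum>z\<in>{out a 0}. marked core t folded (out a 1) z * walk_sum (marked core t folded) n z y)"
    by (rule walk_sum_Suc) (auto simp: marked_def folded_out_1[OF a, unfolded One_nat_def] split: if_splits)
  then show ?thesis using core_iff[OF a] by (auto simp: marked_def folded_out_1[OF a, unfolded One_nat_def])
qed

text \<open>A walk from the deeper arc into the core is a walk from the arc before it, moved one arc deeper, with one
  more step of weight \<open>q\<close> on the way back.\<close>

lemma marked_walk_deeper:
  assumes a: "a \<in> I" and y: "y \<in> core"
  shows "walk_sum (marked core t w) (Suc n) (out a (Suc i)) y = q * walk_sum (marked core t w) n (out a i) y"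
proof (induction n arbitrary: i)
  case 0
  have "out a j \<noteq> y" "inn a (Suc j) \<noteq> y" for j using y core_iff[OF a] by auto
  then show ?case by (simp add: marked_walk_out[OF a])
next
  case (Suc n)
  have "walk_sum (marked core t w) (Suc (Suc n)) (out a (Suc i)) y =
     q * walk_sum (marked core t w) n (out a (Suc i)) y
     + (q - 1) * (q * (if i = 0 then t else 1) * walk_sum (marked core t w) n (inn a i) y)"
    unfolding marked_walk_out[OF a, of t "Suc n" "Suc i"] Suc.IH marked_walk_inn[OF a] by simp
  then show ?case unfolding marked_walk_out[OF a, of t n i] by (simp add: algebra_simps)
qed

text \<open>The rows differ only at the arcs \<open>out a 1\<close>. There the original walks have \<open>q\<close> times the weight of
  the walks from \<open>out a 0\<close> that are one step shorter, and this is the row of the folded matrix.\<close>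

lemma marked_walk_folded:
  assumes y: "y \<in> core" and x: "x \<in> folded_states"
  shows "walk_sum (marked core t w) n x y = walk_sum (marked core t folded) n x y"
  using x
proof (induction n arbitrary: x)
  case (Suc n)
  from Suc.prems show ?case
  proof (cases rule: folded_states_cases)
    case 1
    have "walk_sum (marked core t w) (Suc n) x y =
        (\<Sum>z\<in>folded_states. marked core t w x z * walk_sum (marked core t w) n z y)"
      using core_row_support[OF 1] by (intro walk_sum_Suc finite_folded_states) (auto simp: marked_def folded_states_def)
    also have "\<dots> = (\<Sum>z\<in>folded_states. marked core t folded x z * walk_sum (marked core t folded) n z y)"
    proof (rule sum.cong)
      have "marked core t w x z = marked core t folded x z" for z
        using folded_core[OF 1] by (simp add: marked_def)
      then show "marked core t w x z * walk_sum (marked core t w) n z y =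
          marked core t folded x z * walk_sum (marked core t folded) n z y" if "z \<in> folded_states" for z
        using Suc.IH[OF that] by simp
    qed simp
    also have "\<dots> = walk_sum (marked core t folded) (Suc n) x y"
      using folded_support by (intro walk_sum_Suc[symmetric] finite_folded_states) (auto simp: marked_def)
    finally show ?thesis .
  next
    case (2 a)
    have "walk_sum (marked core t w) n (out a 1) y = walk_sum (marked core t folded) n (out a 1) y"
      "walk_sum (marked core t w) n (inn a 0) y = walk_sum (marked core t folded) n (inn a 0) y"
      using Suc.IH folded_states_iff[OF 2(1)] by blast+
    then show ?thesis unfolding 2(2) folded_walk_out_0[OF 2(1)] marked_walk_out[OF 2(1)] by simp
  next
    case (3 a)
    show ?thesis
      using marked_walk_deeper[OF 3(1) y, of t n 0] Suc.IH[OF folded_states_iff(1)[OF 3(1)]]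
      unfolding 3(2) folded_walk_out_1[OF 3(1)] by simp
  qed
qed simp

text \<open>With marking variable \<open>0\<close> only the walks around the loops remain.\<close>

lemma unmarked_loops:
  assumes m: "m > 0"
  shows "(\<Sum>x\<in>folded_states. walk_sum (marked core 0 folded) m x x) =
    (if even m then 2 * real (card I) * q ^ (m div 2) else 0)"
proof -
  let ?W = "walk_sum (marked core 0 folded)"
  have core0: "?W (Suc n) x y = 0" if "y \<in> core" for n x y
  proof (induction n arbitrary: x)
    case 0
    show ?case unfolding walk_sum.simps(2) using that by (intro sum.neutral) (auto simp: marked_def)
  next
    case (Suc n)
    show ?case unfolding walk_sum.simps(2)[of _ "Suc n"] Suc.IH by simp
  qed
  have two: "?W (Suc (Suc n)) (out a 0) y = q * ?W n (out a 0) y"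
    "?W (Suc (Suc n)) (out a 1) y = q * ?W n (out a 1) y" if "a \<in> I" for a n y
    using folded_walk_out_0[OF that] folded_walk_out_1[OF that] by simp_all
  have diag: "?W n (out a 0) (out a 0) = (if even n then q ^ (n div 2) else 0) \<and>
    ?W n (out a 1) (out a 1) = (if even n then q ^ (n div 2) else 0)" if a: "a \<in> I" for a n
  proof (induction n rule: less_induct)
    case (less n)
    have ne: "out a 0 \<noteq> out a 1" using out_inject[OF a a, of 0 1] by auto
    consider "n = 0" | "n = 1" | k where "n = Suc (Suc k)" by (metis One_nat_def not0_implies_Suc)
    then show ?case
    proof cases
      case 2
      have "?W (Suc 0) (out a 0) (out a 0) = 0" "?W (Suc 0) (out a 1) (out a 1) = 0"
        using folded_walk_out_0[OF a, of 0 0] folded_walk_out_1[OF a, of 0 0] ne by auto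
      then show ?thesis using 2 by simp
    next
      case 3
      then show ?thesis using two[OF a, of k] less.IH[of k] by simp
    qed simp
  qed
  have inj: "inj_on (\<lambda>a. out a 0) I" "inj_on (\<lambda>a. out a 1) I" using out_inject by (auto simp: inj_on_def)
  have disj: "core \<inter> (\<lambda>a. out a 0) ` I = {}" "(core \<union> (\<lambda>a. out a 0) ` I) \<inter> (\<lambda>a. out a 1) ` I = {}"
    using core_iff(1) out_neq[of _ _ 0 1] out_neq[of _ _ 1 0] by auto
  have "(\<Sum>x\<in>folded_states. ?W m x x) = (\<Sum>x\<in>core. ?W m x x) + (\<Sum>a\<in>I. ?W m (out a 0) (out a 0))
     + (\<Sum>a\<in>I. ?W m (out a 1) (out a 1))"
    unfolding folded_states_def using finite_core finite_I disj
    by (simp add: sum.union_disjoint sum.reindex[OF inj(1)] sum.reindex[OF inj(2)[unfolded One_nat_def]])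
  moreover have "(\<Sum>x\<in>core. ?W m x x) = 0" using core0 m by (cases m) auto
  ultimately show ?thesis using diag by simp
qed

section \<open>Closed walks in the cusped graph\<close>

text \<open>A closed walk that enters a cusp has to turn there, and after turning at depth \<open>d\<close> it needs \<open>d\<close>
  steps to reach the core. It therefore meets the core, and it stays at depth less than \<open>m\<close>.\<close>

lemma closed_walk_props:
  assumes p: "p \<in> closed_walks w m" and m: "m > 0"
  shows "set p \<subseteq> K \<union> {out a i | a i. a \<in> I \<and> i < m} \<union> {inn a i | a i. a \<in> I \<and> i < m}" "visits core p > 0"
proof -
  define s where "s i = p ! (i mod m)" for i
  have len: "length p = m" using p unfolding closed_walks_def by simp
  have per: "s (i + m) = s i" for i unfolding s_def by simp
  have step: "w (s i) (s (Suc i)) \<noteq> 0" for i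
  proof -
    have "\<forall>j\<in>{..<m}. w (p ! j) (p ! (Suc j mod m)) \<noteq> 0"
      using p len unfolding closed_walks_def cyclic_weight_def by (auto simp: prod_zero_iff)
    moreover have "i mod m < m" using m by simp
    ultimately show ?thesis unfolding s_def by (metis lessThan_iff mod_Suc_eq)
  qed
  have inn_step: "s (i + k) = inn a j" if "a \<in> I" "s i = inn a (j + k)" for a i j k
    using that(2)
  proof (induction k arbitrary: j)
    case (Suc k)
    then have "s (i + k) = inn a (Suc j)" by (metis add_Suc_shift)
    then show ?case using step[of "i + k"] row_inn[OF that(1), of j] by (auto split: if_splits)
  qed simp
  have inn_lt: "d < m" if "a \<in> I" "s i = inn a d" for a i d
  proof (rule ccontr)
    assume "\<not> d < m"
    then have "s (i + m) = inn a (d - m)" using inn_step[OF that(1), of i "d - m" m] that(2) by simp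
    then have "inn a (d - m) = inn a d" using per that(2) by simp
    then show False using inn_inject[OF that(1) that(1)] \<open>\<not> d < m\<close> m by fastforce
  qed
  have out_turn: "\<exists>k j. s (i + k) = inn a j \<and> d \<le> j" if a: "a \<in> I" "s i = out a d" for a i d
  proof (rule ccontr)
    assume no: "\<not> ?thesis"
    have "s (i + k) = out a (d + k)" for k
    proof (induction k)
      case (Suc k)
      have "s (i + Suc k) \<noteq> inn a (d + k)" using no by (meson le_add1)
      then show ?case using step[of "i + k"] Suc row_out[OF a(1), of "d + k"] by (auto split: if_splits)
    qed (simp add: a)
    then have "out a (d + m) = out a d" using per[of i] a(2) by metis
    then show False using out_inject[OF a(1) a(1)] m by fastforce
  qed
  have out_lt: "d < m" if a: "a \<in> I" "s i = out a d" for a i d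
    using out_turn[OF a] inn_lt[OF a(1)] by (meson le_less_trans)
  have in_s: "\<exists>i. x = s i" if "x \<in> set p" for x
    using that len unfolding s_def by (metis in_set_conv_nth mod_less)
  have V: "s i \<in> cusped_states K I out inn" for i using w_support[OF step[of i]] by simp
  show "set p \<subseteq> K \<union> {out a i | a i. a \<in> I \<and> i < m} \<union> {inn a i | a i. a \<in> I \<and> i < m}"
  proof
    fix x assume "x \<in> set p"
    then obtain i where i: "x = s i" using in_s by blast
    then show "x \<in> K \<union> {out a i | a i. a \<in> I \<and> i < m} \<union> {inn a i | a i. a \<in> I \<and> i < m}"
    proof -
      consider "x \<in> K" | a d where "a \<in> I" "s i = out a d" | a d where "a \<in> I" "s i = inn a d"
        using V[of i] i unfolding cusped_states_def by auto
      then show ?thesis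
      proof cases
        case 2
        then show ?thesis using out_lt[OF 2] i by blast
      next
        case 3
        then show ?thesis using inn_lt[OF 3] i by blast
      qed simp
    qed
  qed
  have "\<exists>i. s i \<in> core"
  proof -
    have inn: "\<exists>i. s i \<in> core" if "a \<in> I" "s i = inn a d" for a i d
    proof -
      have "s (i + d) \<in> core" using inn_step[OF that(1), of i 0 d] that core_iff(2)[OF that(1), of 0] by simp
      then show ?thesis by blast
    qed
    consider "s 0 \<in> K" | a d where "a \<in> I" "s 0 = out a d" | a d where "a \<in> I" "s 0 = inn a d"
      using V[of 0] unfolding cusped_states_def by auto
    then show ?thesis
    proof cases
      case 2
      then show ?thesis using out_turn[OF 2] inn[OF 2(1)] by blast
    next
      case 3
      then show ?thesis by (rule inn)
    next
      case 1
      then show ?thesis unfolding core_def by blast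
    qed
  qed
  then obtain i where "p ! (i mod m) \<in> core" unfolding s_def by blast
  then have "i mod m \<in> {j. j < length p \<and> p ! j \<in> core}" using len m by simp
  then show "visits core p > 0" unfolding visits_def by (auto simp: card_gt_0_iff)
qed

text \<open>Marking the visits to the core, the closed walks before and after folding have the same numbers,
  except for those that avoid the core. Before folding there are none; after folding they run around
  a loop.\<close>

theorem closed_walks_count:
  assumes m: "m > 0"
  shows "finite (closed_walks w m)"
    "(\<Sum>p\<in>closed_walks w m. cyclic_weight w p) = (\<Sum>x\<in>folded_states. walk_sum folded m x x)
      - (if even m then 2 * real (card I) * q ^ (m div 2) else 0)"
proof -
  define Um where "Um = K \<union> {out a i | a i. a \<in> I \<and> i < m} \<union> {inn a i | a i. a \<in> I \<and> i < m}"
  have "finite Um"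
  proof -
    have "{out a i | a i. a \<in> I \<and> i < m} = (\<lambda>(a, i). out a i) ` (I \<times> {..<m})"
      "{inn a i | a i. a \<in> I \<and> i < m} = (\<lambda>(a, i). inn a i) ` (I \<times> {..<m})" by auto
    then show ?thesis unfolding Um_def using finite_K finite_I by simp
  qed
  then have "finite {p. set p \<subseteq> Um \<and> length p = m}" by (rule finite_lists_length_eq)
  then show fin: "finite (closed_walks w m)"
    by (rule finite_subset[rotated]) (use closed_walk_props[OF _ m] in \<open>auto simp: Um_def closed_walks_def\<close>)
  have rows': "finite {z. folded x z \<noteq> 0}" for x
    by (rule finite_subset[OF _ finite_folded_states]) (use folded_support in auto)
  note S' = sum_closed_walks[of folded, OF rows' m finite_folded_states conjunct1[OF folded_support]]
  have cmp: "(\<Sum>p\<in>closed_walks w m. cyclic_weight w p) - (\<Sum>p\<in>closed_walks w m. cyclic_weight (marked core 0 w) p) =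
    (\<Sum>p\<in>closed_walks folded m. cyclic_weight folded p) - (\<Sum>p\<in>closed_walks folded m. cyclic_weight (marked core 0 folded) p)"
    using marked_walk_folded unfolding folded_states_def
    by (intro closed_walks_compare fin S'(1) m finite_core finite_row rows') auto
  have X0: "(\<Sum>p\<in>closed_walks w m. cyclic_weight (marked core 0 w) p) = 0"
    using closed_walk_props(2)[OF _ m] by (intro sum.neutral) (auto simp: cyclic_weight_marked)
  have rows0: "finite {z. marked core 0 folded x z \<noteq> 0}" for x
    by (rule finite_subset[OF _ rows'[of x]]) (auto simp: marked_def)
  have "(\<Sum>p\<in>closed_walks folded m. cyclic_weight (marked core 0 folded) p) =
     (\<Sum>p\<in>closed_walks (marked core 0 folded) m. cyclic_weight (marked core 0 folded) p)"
    by (intro sum.mono_neutral_right S'(1)) (auto simp: closed_walks_def cyclic_weight_marked)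
  also have "\<dots> = (\<Sum>x\<in>folded_states. walk_sum (marked core 0 folded) m x x)"
    using folded_support by (intro sum_closed_walks(2) rows0 m finite_folded_states) (auto simp: marked_def)
  finally show "(\<Sum>p\<in>closed_walks w m. cyclic_weight w p) = (\<Sum>x\<in>folded_states. walk_sum folded m x x)
      - (if even m then 2 * real (card I) * q ^ (m div 2) else 0)"
    using cmp X0 unmarked_loops[OF m] S'(2) by simp
qed

end

section \<open>Group actions on regular trees\<close>

locale tree_action =
  fixes \<Gamma> :: "('g, 'm) monoid_scheme" and Y :: "'v pair_pre_digraph" and \<phi> :: "'g \<Rightarrow> 'v \<Rightarrow> 'v" and q :: nat
  assumes q_ge_2: "2 \<le> q"
    and regular_Y: "regular (q + 1) Y"
    and lattice: "tree_lattice \<Gamma> Y \<phi>"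
    and orient: "orientation_preserving \<Gamma> Y \<phi>"
begin

abbreviation X where "X \<equiv> quotient_graph \<Gamma> Y \<phi>"
abbreviation act where "act \<equiv> edge_act \<phi>"
abbreviation orb where "orb e \<equiv> orbit \<Gamma> act e"

lemma tree_Y: "is_tree Y" and hom_\<phi>: "group_hom \<Gamma> (aut_group Y) \<phi>"
  using lattice unfolding tree_lattice_def by auto

lemma arc_verts: "(x, y) \<in> parcs Y \<Longrightarrow> x \<in> pverts Y \<and> y \<in> pverts Y"
  and arc_sym: "(x, y) \<in> parcs Y \<Longrightarrow> (y, x) \<in> parcs Y"
proof -
  have b: "pair_bidirected_digraph Y" using tree_Y unfolding is_tree_def by auto
  then have wf: "pair_wf_digraph Y" and sy: "pair_sym_digraph Y"
    unfolding pair_bidirected_digraph_def pair_loopfree_digraph_def by auto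
  show "(x, y) \<in> parcs Y \<Longrightarrow> x \<in> pverts Y \<and> y \<in> pverts Y"
    using pair_wf_digraph.in_arcsD1[OF wf] pair_wf_digraph.in_arcsD2[OF wf] by blast
  have "symmetric (with_proj Y)" using pair_sym_digraph.pair_sym_arcs[OF sy] .
  then have "sym (parcs Y)" unfolding symmetric_def arcs_ends_def arc_to_ends_def by simp
  then show "(x, y) \<in> parcs Y \<Longrightarrow> (y, x) \<in> parcs Y" by (rule symD)
qed

lemma swap_arc: "e \<in> parcs Y \<Longrightarrow> prod.swap e \<in> parcs Y"
  using arc_sym by (cases e) auto

lemma group_\<Gamma>: "group \<Gamma>"
  using hom_\<phi> unfolding group_hom_def by simp

lemma \<phi>_aut: "g \<in> carrier \<Gamma> \<Longrightarrow> \<phi> g \<in> carrier (aut_group Y)"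
  using hom_\<phi> unfolding group_hom_def group_hom_axioms_def by (meson hom_in_carrier)

lemma \<phi>_Bij: "g \<in> carrier \<Gamma> \<Longrightarrow> \<phi> g \<in> Bij (pverts Y)"
  using \<phi>_aut unfolding aut_group_def by auto

lemma \<phi>_vert: "g \<in> carrier \<Gamma> \<Longrightarrow> x \<in> pverts Y \<Longrightarrow> \<phi> g x \<in> pverts Y"
  using \<phi>_Bij unfolding Bij_def by (auto dest: bij_betwE)

lemma \<phi>_mult: "g \<in> carrier \<Gamma> \<Longrightarrow> h \<in> carrier \<Gamma> \<Longrightarrow> x \<in> pverts Y \<Longrightarrow> \<phi> (g \<otimes>\<^bsub>\<Gamma>\<^esub> h) x = \<phi> g (\<phi> h x)"
proof -
  assume g: "g \<in> carrier \<Gamma>" "h \<in> carrier \<Gamma>" and x: "x \<in> pverts Y"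
  have "\<phi> (g \<otimes>\<^bsub>\<Gamma>\<^esub> h) = \<phi> g \<otimes>\<^bsub>aut_group Y\<^esub> \<phi> h"
    using g hom_\<phi> unfolding group_hom_def group_hom_axioms_def by (meson hom_mult)
  also have "\<dots> = compose (pverts Y) (\<phi> g) (\<phi> h)"
    using \<phi>_Bij g unfolding aut_group_def BijGroup_def by simp
  finally show ?thesis using x by (simp add: compose_def)
qed

lemma \<phi>_one: "x \<in> pverts Y \<Longrightarrow> \<phi> \<one>\<^bsub>\<Gamma>\<^esub> x = x"
proof -
  assume x: "x \<in> pverts Y"
  have "\<phi> \<one>\<^bsub>\<Gamma>\<^esub> = \<one>\<^bsub>aut_group Y\<^esub>" using group_hom.hom_one[OF hom_\<phi>] .
  then show ?thesis using x unfolding aut_group_def BijGroup_def by simp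
qed

lemma act_arc: "g \<in> carrier \<Gamma> \<Longrightarrow> e \<in> parcs Y \<Longrightarrow> act g e \<in> parcs Y"
  using \<phi>_aut[of g] arc_verts[of "fst e" "snd e"] unfolding aut_group_def edge_act_def by (cases e) auto

lemma fst_act [simp]: "fst (act g e) = \<phi> g (fst e)" and snd_act [simp]: "snd (act g e) = \<phi> g (snd e)"
  and act_pair [simp]: "act g (x, y) = (\<phi> g x, \<phi> g y)"
  and act_swap: "act g (prod.swap e) = prod.swap (act g e)"
  unfolding edge_act_def by (cases e; simp)+

lemma act_mult: "g \<in> carrier \<Gamma> \<Longrightarrow> h \<in> carrier \<Gamma> \<Longrightarrow> e \<in> parcs Y \<Longrightarrow> act (g \<otimes>\<^bsub>\<Gamma>\<^esub> h) e = act g (act h e)"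
  using \<phi>_mult arc_verts by (cases e) auto

lemma act_one: "e \<in> parcs Y \<Longrightarrow> act \<one>\<^bsub>\<Gamma>\<^esub> e = e"
  using \<phi>_one arc_verts by (cases e) auto

lemmas one_in = group.is_monoid[OF group_\<Gamma>, THEN monoid.one_closed]
  and mult_in = group.is_monoid[OF group_\<Gamma>, THEN monoid.m_closed]
  and inv_in = group.inv_closed[OF group_\<Gamma>]

lemma act_inv: "g \<in> carrier \<Gamma> \<Longrightarrow> e \<in> parcs Y \<Longrightarrow> act (inv\<^bsub>\<Gamma>\<^esub> g) (act g e) = e"
  using act_mult[of "inv\<^bsub>\<Gamma>\<^esub> g" g e] act_one inv_in group.l_inv[OF group_\<Gamma>] by metis

lemma \<phi>_inv: "g \<in> carrier \<Gamma> \<Longrightarrow> x \<in> pverts Y \<Longrightarrow> \<phi> (inv\<^bsub>\<Gamma>\<^esub> g) (\<phi> g x) = x"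
  using \<phi>_mult[of "inv\<^bsub>\<Gamma>\<^esub> g" g x] \<phi>_one inv_in group.l_inv[OF group_\<Gamma>] by metis

lemma orb_self: "e \<in> parcs Y \<Longrightarrow> e \<in> orb e"
  using act_one[of e] one_in unfolding orbit_def by force

lemma act_in_orb: "g \<in> carrier \<Gamma> \<Longrightarrow> act g e \<in> orb e"
  unfolding orbit_def by auto

lemma orb_act: "g \<in> carrier \<Gamma> \<Longrightarrow> e \<in> parcs Y \<Longrightarrow> orb (act g e) = orb e"
proof -
  assume g: "g \<in> carrier \<Gamma>" and e: "e \<in> parcs Y"
  have 1: "orb (act h e) \<subseteq> orb e" if "h \<in> carrier \<Gamma>" "e \<in> parcs Y" for h e
    using act_mult[OF _ that(1) that(2), symmetric] mult_in that unfolding orbit_def by fastforce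
  have "orb e = orb (act (inv\<^bsub>\<Gamma>\<^esub> g) (act g e))" using act_inv[OF g e] by simp
  also have "\<dots> \<subseteq> orb (act g e)" by (rule 1[OF inv_in[OF g] act_arc[OF g e]])
  finally show ?thesis using 1[OF g e] by blast
qed

lemma orb_cong: "e' \<in> orb e \<Longrightarrow> e \<in> parcs Y \<Longrightarrow> orb e' = orb e"
  using orb_act unfolding orbit_def by blast

lemma orb_arcs: "e' \<in> orb e \<Longrightarrow> e \<in> parcs Y \<Longrightarrow> e' \<in> parcs Y"
  using act_arc unfolding orbit_def by blast

lemma arcs_X: "arcs X = orb ` parcs Y"
  unfolding quotient_graph_def orbits_def by auto

lemma arc_X_rep:
  assumes "E \<in> arcs X" "e \<in> E"
  shows "e \<in> parcs Y" "E = orb e"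
  using assms orb_cong orb_arcs unfolding arcs_X by blast+

lemma arc_X_nonempty: "E \<in> arcs X \<Longrightarrow> \<exists>e. e \<in> E"
  using orb_self unfolding arcs_X by blast

lemma fst_orb: "fst ` orb e = orbit \<Gamma> \<phi> (fst e)" and snd_orb: "snd ` orb e = orbit \<Gamma> \<phi> (snd e)"
  unfolding orbit_def by force+

lemma tail_X: "tail X E = fst ` E" and head_X: "head X E = snd ` E"
  unfolding quotient_graph_def by simp_all

lemma orbV_self: "x \<in> pverts Y \<Longrightarrow> x \<in> orbit \<Gamma> \<phi> x"
  using \<phi>_one[of x] one_in unfolding orbit_def by force

lemma orbV_cong: "y \<in> orbit \<Gamma> \<phi> x \<Longrightarrow> x \<in> pverts Y \<Longrightarrow> \<exists>g\<in>carrier \<Gamma>. y = \<phi> g x \<and> x = \<phi> (inv\<^bsub>\<Gamma>\<^esub> g) y"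
  using \<phi>_inv unfolding orbit_def by force

lemma converse_orb: "converse (orb e) = orb (prod.swap e)"
proof -
  have "(a, b) \<in> converse (orb e) \<longleftrightarrow> (a, b) \<in> orb (prod.swap e)" for a b
    unfolding orbit_def edge_act_def by (cases e) auto
  then show ?thesis by auto
qed

lemma converse_arc: "E \<in> arcs X \<Longrightarrow> converse E \<in> arcs X"
  using swap_arc unfolding arcs_X by (auto simp: converse_orb)

lemma tail_converse: "tail X (converse E) = head X E" and head_converse: "head X (converse E) = tail X E"
  unfolding tail_X head_X by force+

section \<open>Weights\<close>

definition out_at :: "('v \<times> 'v) set \<Rightarrow> 'v \<Rightarrow> ('v \<times> 'v) set" where
  "out_at E x = {e \<in> E. fst e = x}"

abbreviation wt where "wt \<equiv> edge_weight \<Gamma> \<phi>"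

lemma star_finite: "x \<in> pverts Y \<Longrightarrow> finite {e \<in> parcs Y. fst e = x}"
  and star_card: "x \<in> pverts Y \<Longrightarrow> card {e \<in> parcs Y. fst e = x} = q + 1"
  using regular_Y unfolding regular_def locally_finite_def valency_def out_degree_def out_arcs_def by auto

lemma out_at_finite: "E \<in> arcs X \<Longrightarrow> x \<in> pverts Y \<Longrightarrow> finite (out_at E x)"
  using arc_X_rep(1) by (intro finite_subset[OF _ star_finite[of x]]) (auto simp: out_at_def)

lemma card_out_at_act:
  assumes E: "E \<in> arcs X" and x: "x \<in> pverts Y" and g: "g \<in> carrier \<Gamma>"
  shows "card (out_at E (\<phi> g x)) = card (out_at E x)"
proof -
  have le: "card (out_at E x) \<le> card (out_at E (\<phi> g x))" if x: "x \<in> pverts Y" and g: "g \<in> carrier \<Gamma>" for x g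
  proof (rule card_inj_on_le[of "act g"])
    show "inj_on (act g) (out_at E x)"
      by (rule inj_on_inverseI[of _ "act (inv\<^bsub>\<Gamma>\<^esub> g)"]) (use act_inv[OF g] arc_X_rep(1)[OF E] in \<open>auto simp: out_at_def\<close>)
    show "act g ` out_at E x \<subseteq> out_at E (\<phi> g x)"
    proof
      fix e' assume "e' \<in> act g ` out_at E x"
      then obtain e where e: "e \<in> E" "fst e = x" "e' = act g e" unfolding out_at_def by auto
      have "e' \<in> E" using act_in_orb[OF g, of e] arc_X_rep(2)[OF E e(1)] e(3) by simp
      then show "e' \<in> out_at E (\<phi> g x)" using e unfolding out_at_def by simp
    qed
    show "finite (out_at E (\<phi> g x))" using out_at_finite[OF E \<phi>_vert[OF g x]] .
  qed
  have "card (out_at E (\<phi> g x)) \<le> card (out_at E (\<phi> (inv\<^bsub>\<Gamma>\<^esub> g) (\<phi> g x)))"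
    by (rule le[OF \<phi>_vert[OF g x] inv_in[OF g]])
  then show ?thesis using le[OF x g] \<phi>_inv[OF g x] by simp
qed

text \<open>The stabiliser orbit that defines the weight consists of the lifts of the edge at one lift of its
  origin, and the group permutes the lifts of the origin transitively.\<close>

lemma weight_eq_card:
  assumes E: "E \<in> arcs X" and x: "x \<in> pverts Y" "orbit \<Gamma> \<phi> x = tail X E"
  shows "wt E = card (out_at E x)" "out_at E x \<noteq> {}"
proof -
  define e where "e = (SOME e. e \<in> E)"
  have e: "e \<in> E" unfolding e_def using arc_X_nonempty[OF E] by (rule someI_ex)
  note rep = arc_X_rep[OF E e]
  have fe: "fst e \<in> pverts Y" using rep(1) arc_verts[of "fst e" "snd e"] by simp
  have "orbit (\<Gamma>\<lparr>carrier := stabilizer \<Gamma> \<phi> (fst e)\<rparr>) act e = out_at E (fst e)"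
    unfolding orbit_def stabilizer_def out_at_def rep(2) by (auto simp: orbit_def)
  then have w: "wt E = card (out_at E (fst e))"
    unfolding edge_weight_def tree_edge_weight_def e_def[symmetric] by simp
  have "x \<in> orbit \<Gamma> \<phi> (fst e)" using orbV_self[OF x(1)] x(2) unfolding tail_X rep(2) fst_orb by simp
  then obtain g where g: "g \<in> carrier \<Gamma>" "x = \<phi> g (fst e)" using orbV_cong fe by blast
  show "wt E = card (out_at E x)" unfolding w g(2) using card_out_at_act[OF E fe g(1)] by simp
  have "act g e \<in> out_at E x" using act_in_orb[OF g(1), of e] rep(2) g(2) unfolding out_at_def by simp
  then show "out_at E x \<noteq> {}" by blast
qed

lemma orb_weight: "(x, y) \<in> parcs Y \<Longrightarrow> wt (orb (x, y)) = card (out_at (orb (x, y)) x)"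
  by (intro weight_eq_card(1)) (auto simp: arcs_X tail_X fst_orb arc_verts)

lemma tail_rep: "E \<in> arcs X \<Longrightarrow> \<exists>x\<in>pverts Y. tail X E = orbit \<Gamma> \<phi> x"
proof -
  assume E: "E \<in> arcs X"
  obtain e where e: "e \<in> E" using arc_X_nonempty[OF E] by blast
  note rep = arc_X_rep[OF E e]
  have "fst e \<in> pverts Y" using rep(1) arc_verts[of "fst e" "snd e"] by simp
  then show ?thesis unfolding tail_X rep(2) fst_orb by blast
qed

lemma out_arcs_rep:
  assumes x: "x \<in> pverts Y"
  shows "out_arcs X (orbit \<Gamma> \<phi> x) = orb ` {e \<in> parcs Y. fst e = x}"
proof (intro equalityI subsetI)
  fix E assume "E \<in> out_arcs X (orbit \<Gamma> \<phi> x)"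
  then have E: "E \<in> arcs X" "tail X E = orbit \<Gamma> \<phi> x" by auto
  obtain e where "e \<in> out_at E x" using weight_eq_card(2)[OF E(1) x E(2)[symmetric]] by blast
  then have "e \<in> E" "fst e = x" unfolding out_at_def by auto
  then show "E \<in> orb ` {e \<in> parcs Y. fst e = x}" using arc_X_rep[OF E(1), of e] by blast
next
  fix E assume "E \<in> orb ` {e \<in> parcs Y. fst e = x}"
  then obtain e where e: "e \<in> parcs Y" "fst e = x" "E = orb e" by blast
  then have "tail X E = orbit \<Gamma> \<phi> x" unfolding tail_X by (simp only: fst_orb)
  then show "E \<in> out_arcs X (orbit \<Gamma> \<phi> x)" using e arcs_X by auto
qed

lemma finite_out_arcs: "x \<in> pverts Y \<Longrightarrow> finite (out_arcs X (orbit \<Gamma> \<phi> x))"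
  using out_arcs_rep star_finite by simp

lemma weight_pos: "E \<in> arcs X \<Longrightarrow> wt E \<ge> 1"
proof -
  assume E: "E \<in> arcs X"
  obtain x where x: "x \<in> pverts Y" "tail X E = orbit \<Gamma> \<phi> x" using tail_rep[OF E] by blast
  show ?thesis using weight_eq_card[OF E x(1) x(2)[symmetric]] out_at_finite[OF E x(1)]
    by (metis One_nat_def Suc_leI card_gt_0_iff)
qed

lemma weight_sum: "x \<in> pverts Y \<Longrightarrow> (\<Sum>E\<in>out_arcs X (orbit \<Gamma> \<phi> x). wt E) = q + 1"
proof -
  assume x: "x \<in> pverts Y"
  have "(\<Sum>E\<in>out_arcs X (orbit \<Gamma> \<phi> x). wt E) = (\<Sum>E\<in>out_arcs X (orbit \<Gamma> \<phi> x). card {e \<in> {e \<in> parcs Y. fst e = x}. orb e = E})"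
  proof (rule sum.cong)
    fix E assume "E \<in> out_arcs X (orbit \<Gamma> \<phi> x)"
    then have E: "E \<in> arcs X" "tail X E = orbit \<Gamma> \<phi> x" by auto
    have rep: "e \<in> parcs Y" "E = orb e" if "e \<in> E" for e using arc_X_rep[OF E(1) that] .
    have "out_at E x = {e \<in> {e \<in> parcs Y. fst e = x}. orb e = E}"
    proof (intro equalityI subsetI)
      fix e assume "e \<in> out_at E x"
      then show "e \<in> {e \<in> {e \<in> parcs Y. fst e = x}. orb e = E}"
        using rep[of e] unfolding out_at_def by simp
    next
      fix e assume "e \<in> {e \<in> {e \<in> parcs Y. fst e = x}. orb e = E}"
      then show "e \<in> out_at E x" using orb_self[of e] unfolding out_at_def by simp
    qed
    then show "wt E = card {e \<in> {e \<in> parcs Y. fst e = x}. orb e = E}"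
      using weight_eq_card(1)[OF E(1) x E(2)[symmetric]] by simp
  qed simp
  also have "\<dots> = card {e \<in> parcs Y. fst e = x}"
    unfolding out_arcs_rep[OF x] using sum.image_gen[OF star_finite[OF x], of "\<lambda>_. 1::nat" orb] by simp
  finally show ?thesis using star_card[OF x] by simp
qed

lemma weight_le_two:
  assumes x: "x \<in> pverts Y" and E: "E \<in> arcs X" "tail X E = orbit \<Gamma> \<phi> x"
    and F: "F \<in> arcs X" "tail X F = orbit \<Gamma> \<phi> x" and ne: "E \<noteq> F"
  shows "wt E + wt F \<le> q + 1"
proof -
  have "(\<Sum>G\<in>{E, F}. wt G) \<le> (\<Sum>G\<in>out_arcs X (orbit \<Gamma> \<phi> x). wt G)"
    using E F finite_out_arcs[OF x] by (intro sum_mono2) auto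
  then show ?thesis using ne unfolding weight_sum[OF x] by simp
qed

text \<open>The matrix of \<open>T\<close>, with real entries, and extended by \<open>0\<close> to all pairs of sets.\<close>

definition w :: "('v \<times> 'v) set \<Rightarrow> ('v \<times> 'v) set \<Rightarrow> real" where
  "w E E' = (if E \<in> arcs X \<and> E' \<in> arcs X \<and> head X E = tail X E' then of_int (trans_weight \<Gamma> \<phi> E E') else 0)"

lemma trans_weight_nonneg: "E' \<in> arcs X \<Longrightarrow> trans_weight \<Gamma> \<phi> E E' \<ge> 0"
  using weight_pos[of E'] unfolding trans_weight_def by (auto simp del: converse_iff)

lemma w_nonneg: "w E E' \<ge> 0"
  unfolding w_def using trans_weight_nonneg by simp

lemma head_rep: "E \<in> arcs X \<Longrightarrow> \<exists>x\<in>pverts Y. head X E = orbit \<Gamma> \<phi> x"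
  using tail_rep[OF converse_arc] by (simp add: tail_converse)

lemma w_row_sum:
  assumes E: "E \<in> arcs X"
  shows "finite (out_arcs X (head X E))" "(\<Sum>E'\<in>out_arcs X (head X E). w E E') = q"
proof -
  obtain x where x: "x \<in> pverts Y" "head X E = orbit \<Gamma> \<phi> x" using head_rep[OF E] by blast
  show fin: "finite (out_arcs X (head X E))" unfolding x(2) by (rule finite_out_arcs[OF x(1)])
  have conv: "converse E \<in> out_arcs X (head X E)" using converse_arc[OF E] by (simp add: tail_converse)
  have "(\<Sum>E'\<in>out_arcs X (head X E). w E E') = (\<Sum>E'\<in>out_arcs X (head X E). real (wt E') - (if E' = converse E then 1 else 0))"
    using E by (intro sum.cong) (auto simp: w_def trans_weight_def)
  also have "\<dots> = real (\<Sum>E'\<in>out_arcs X (head X E). wt E') - 1"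
    using fin conv by (simp add: sum_subtractf)
  finally show "(\<Sum>E'\<in>out_arcs X (head X E). w E E') = q" unfolding x(2) weight_sum[OF x(1)] by simp
qed

lemma w_support: "w E E' \<noteq> 0 \<Longrightarrow> E \<in> arcs X \<and> E' \<in> arcs X \<and> E' \<in> out_arcs X (head X E)"
  unfolding w_def by (auto split: if_splits)

lemma w_le_q: "w E E' \<le> q"
proof (cases "w E E' = 0")
  case False
  note s = w_support[OF False]
  have "w E E' \<le> (\<Sum>E'\<in>out_arcs X (head X E). w E E')"
    using s w_row_sum(1) w_nonneg by (intro member_le_sum) auto
  then show ?thesis using w_row_sum(2) s by simp
qed simp

section \<open>Connectedness\<close>

text \<open>A non-backtracking step in the tree has positive weight: if it backtracks in the quotient,
  then the edge has at least two lifts.\<close>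

lemma w_pos_nonbacktracking:
  assumes xy: "(y, x) \<in> parcs Y" "(x, z) \<in> parcs Y" "z \<noteq> y"
  shows "w (orb (y, x)) (orb (x, z)) > 0"
proof -
  have arcs: "orb (y, x) \<in> arcs X" "orb (x, z) \<in> arcs X" using xy unfolding arcs_X by auto
  have adj: "head X (orb (y, x)) = tail X (orb (x, z))" unfolding head_X tail_X fst_orb snd_orb by simp
  have "trans_weight \<Gamma> \<phi> (orb (y, x)) (orb (x, z)) > 0"
  proof (cases "orb (x, z) = converse (orb (y, x))")
    case True
    then have "orb (x, z) = orb (x, y)" by (simp add: converse_orb)
    then have "(x, y) \<in> out_at (orb (x, z)) x" "(x, z) \<in> out_at (orb (x, z)) x"
      using orb_self[OF arc_sym[OF xy(1)]] orb_self[OF xy(2)] unfolding out_at_def by auto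
    then have "card {(x, y), (x, z)} \<le> card (out_at (orb (x, z)) x)"
      using out_at_finite[OF arcs(2)] arc_verts[OF xy(2)] by (intro card_mono) auto
    then show ?thesis using True xy(3) orb_weight[OF xy(2)] unfolding trans_weight_def by simp
  next
    case False
    then show ?thesis using weight_pos[OF arcs(2)] unfolding trans_weight_def by simp
  qed
  then show ?thesis unfolding w_def using arcs adj by simp
qed

definition stable :: "('v \<times> 'v) set set \<Rightarrow> bool" where
  "stable M \<longleftrightarrow> M \<subseteq> arcs X \<and> (\<forall>E\<in>M. \<forall>E'. w E E' > 0 \<longrightarrow> E' \<in> M)"

lemma other_neighbours:
  assumes "x \<in> pverts Y"
  shows "\<exists>z. (x, z) \<in> parcs Y \<and> z \<noteq> y \<and> z \<noteq> y'"
proof (rule ccontr)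
  assume "\<not> ?thesis"
  then have "{e \<in> parcs Y. fst e = x} \<subseteq> {(x, y), (x, y')}" by auto
  then have "card {e \<in> parcs Y. fst e = x} \<le> card {(x, y), (x, y')}" by (intro card_mono) auto
  also have "\<dots> \<le> 2" by (simp add: card_insert_if)
  finally show False using star_card[OF assms] q_ge_2 by simp
qed

lemma reachable_Y: "u \<in> pverts Y \<Longrightarrow> v \<in> pverts Y \<Longrightarrow> (u, v) \<in> (parcs Y)\<^sup>*"
proof -
  assume uv: "u \<in> pverts Y" "v \<in> pverts Y"
  have "Digraph_Component.connected (with_proj Y)" using tree_Y unfolding is_tree_def by auto
  then have "u \<rightarrow>\<^sup>*\<^bsub>with_proj (mk_symmetric (with_proj Y))\<^esub> v"
    using uv unfolding connected_def by (auto simp: mk_symmetric_def)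
  then have "(u, v) \<in> (arcs_ends (with_proj (mk_symmetric (with_proj Y))))\<^sup>*" by (rule reachable_rtranclI)
  moreover have "arcs_ends (with_proj (mk_symmetric (with_proj Y))) \<subseteq> parcs Y"
    using arc_sym by (auto simp: mk_symmetric_def arcs_ends_def arc_to_ends_def)
  ultimately show ?thesis by (meson rtrancl_mono subsetD)
qed

text \<open>Since every vertex has at least three neighbours, a partition of the edges of \<open>X\<close> that is
  respected by non-backtracking steps does not separate an edge from its reverse, hence not two
  edges with a common vertex.\<close>

lemma stable_partition_trivial:
  assumes M: "stable M" and N: "stable N" and un: "arcs X = M \<union> N" and disj: "M \<inter> N = {}"
  shows "M = {} \<or> N = {}"
proof -
  define c where "c e \<longleftrightarrow> orb e \<in> M" for e
  have step: "c (y, x) \<longleftrightarrow> c (x, z)" if "(y, x) \<in> parcs Y" "(x, z) \<in> parcs Y" "z \<noteq> y" for x y z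
  proof -
    have "orb (y, x) \<in> M \<union> N" using un that(1) arcs_X by blast
    then show ?thesis using w_pos_nonbacktracking[OF that] M N disj unfolding stable_def c_def by blast
  qed
  have rev: "c (y, x) \<longleftrightarrow> c (x, y)" if yx: "(y, x) \<in> parcs Y" for x y
  proof -
    have x: "x \<in> pverts Y" using arc_verts[OF yx] by simp
    obtain z where z: "(x, z) \<in> parcs Y" "z \<noteq> y" using other_neighbours[OF x] by blast
    obtain z' where z': "(x, z') \<in> parcs Y" "z' \<noteq> y" "z' \<noteq> z" using other_neighbours[OF x] by metis
    show ?thesis using step[OF yx z] step[OF arc_sym[OF z'(1)] z(1)] step[OF arc_sym[OF z'(1)] arc_sym[OF yx]] z' z by auto
  qed
  have star: "c (x, y) \<longleftrightarrow> c (x, z)" if "(x, y) \<in> parcs Y" "(x, z) \<in> parcs Y" for x y z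
    using step[OF arc_sym[OF that(1)] that(2)] rev[OF that(1)] by (cases "y = z") auto
  have path: "c (u, u') \<longleftrightarrow> c (v, v')" if "(u, v) \<in> (parcs Y)\<^sup>*" "(u, u') \<in> parcs Y" "(v, v') \<in> parcs Y" for u u' v v'
    using that
  proof (induction arbitrary: v' rule: rtrancl_induct)
    case base
    then show ?case using star by blast
  next
    case (step y z)
    have "c (u, u') \<longleftrightarrow> c (y, z)" by (rule step.IH[OF step.prems(1) step.hyps(2)])
    also have "\<dots> \<longleftrightarrow> c (z, y)" by (rule rev[OF step.hyps(2)])
    also have "\<dots> \<longleftrightarrow> c (z, v')" by (rule star[OF arc_sym[OF step.hyps(2)] step.prems(2)])
    finally show ?case .
  qed
  have "c e \<longleftrightarrow> c f" if "e \<in> parcs Y" "f \<in> parcs Y" for e f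
  proof -
    obtain u u' v v' where ef: "e = (u, u')" "f = (v, v')" by (metis surj_pair)
    have "(u, v) \<in> (parcs Y)\<^sup>*" using that arc_verts unfolding ef by (blast intro: reachable_Y)
    then show ?thesis using path that unfolding ef by blast
  qed
  then have "(\<forall>E\<in>arcs X. E \<in> M) \<or> (\<forall>E\<in>arcs X. E \<notin> M)" unfolding arcs_X c_def by blast
  then show ?thesis using un disj by blast
qed

section \<open>The invariant measure and irreducibility\<close>

abbreviation stab where "stab e \<equiv> stabilizer \<Gamma> act e"

lemma finite_stab: "e \<in> parcs Y \<Longrightarrow> finite (stab e)"
  using lattice unfolding tree_lattice_def by auto

lemma stab_pos: "e \<in> parcs Y \<Longrightarrow> card (stab e) > 0"
  using finite_stab one_in act_one unfolding stabilizer_def by (fastforce simp: card_gt_0_iff)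

lemma stab_swap: "stab (prod.swap e) = stab e"
  unfolding stabilizer_def by (cases e) auto

lemma translates_card:
  assumes e: "e \<in> parcs Y" and f: "f \<in> orb e"
  shows "finite {g \<in> carrier \<Gamma>. act g e = f}" "card {g \<in> carrier \<Gamma>. act g e = f} = card (stab e)"
proof -
  obtain k where k: "k \<in> carrier \<Gamma>" "f = act k e" using f unfolding orbit_def by auto
  have inj: "inj_on (\<lambda>h. k \<otimes>\<^bsub>\<Gamma>\<^esub> h) (stab e)"
  proof -
    interpret group \<Gamma> by (rule group_\<Gamma>)
    show ?thesis using k(1) unfolding inj_on_def stabilizer_def by auto
  qed
  have img: "(\<lambda>h. k \<otimes>\<^bsub>\<Gamma>\<^esub> h) ` stab e = {g \<in> carrier \<Gamma>. act g e = f}"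
  proof (intro equalityI subsetI)
    fix g assume "g \<in> {g \<in> carrier \<Gamma>. act g e = f}"
    then have g: "g \<in> carrier \<Gamma>" "act g e = act k e" using k by auto
    have "inv\<^bsub>\<Gamma>\<^esub> k \<otimes>\<^bsub>\<Gamma>\<^esub> g \<in> stab e"
      unfolding stabilizer_def using g k act_mult[OF inv_in[OF k(1)] g(1) e] act_inv[OF k(1) e] mult_in inv_in by simp
    moreover have "g = k \<otimes>\<^bsub>\<Gamma>\<^esub> (inv\<^bsub>\<Gamma>\<^esub> k \<otimes>\<^bsub>\<Gamma>\<^esub> g)"
      using group.inv_solve_left[OF group_\<Gamma> _ k(1) g(1)] mult_in[OF inv_in[OF k(1)] g(1)] by metis
    ultimately show "g \<in> (\<lambda>h. k \<otimes>\<^bsub>\<Gamma>\<^esub> h) ` stab e" by blast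
  next
    fix g assume "g \<in> (\<lambda>h. k \<otimes>\<^bsub>\<Gamma>\<^esub> h) ` stab e"
    then obtain h where h: "h \<in> carrier \<Gamma>" "act h e = e" "g = k \<otimes>\<^bsub>\<Gamma>\<^esub> h"
      unfolding stabilizer_def by blast
    then show "g \<in> {g \<in> carrier \<Gamma>. act g e = f}"
      using act_mult[OF k(1) h(1) e] mult_in[OF k(1) h(1)] k(2) by simp
  qed
  show "finite {g \<in> carrier \<Gamma>. act g e = f}" unfolding img[symmetric] using finite_stab[OF e] by simp
  show "card {g \<in> carrier \<Gamma>. act g e = f} = card (stab e)"
    unfolding img[symmetric] using card_image[OF inj] .
qed

lemma stab_card_orb:
  assumes e: "e \<in> parcs Y" and f: "f \<in> orb e"
  shows "card (stab f) = card (stab e)"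
proof -
  have fe: "f \<in> parcs Y" "e \<in> orb f" using orb_arcs[OF f e] orb_cong[OF f e] orb_self[OF e] by auto
  have "card {g \<in> carrier \<Gamma>. act g e = f} = card {g \<in> carrier \<Gamma>. act g f = e}"
  proof (rule bij_betw_same_card[of "\<lambda>g. inv\<^bsub>\<Gamma>\<^esub> g"], rule bij_betw_byWitness[where f' = "\<lambda>g. inv\<^bsub>\<Gamma>\<^esub> g"])
    show "(\<lambda>g. inv\<^bsub>\<Gamma>\<^esub> g) ` {g \<in> carrier \<Gamma>. act g e = f} \<subseteq> {g \<in> carrier \<Gamma>. act g f = e}"
      using act_inv[OF _ e] inv_in by auto
    show "(\<lambda>g. inv\<^bsub>\<Gamma>\<^esub> g) ` {g \<in> carrier \<Gamma>. act g f = e} \<subseteq> {g \<in> carrier \<Gamma>. act g e = f}"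
      using act_inv[OF _ fe(1)] inv_in by auto
  qed (use group.inv_inv[OF group_\<Gamma>] in auto)
  then show ?thesis using translates_card(2)[OF e f] translates_card(2)[OF fe] by simp
qed

text \<open>Orbit-stabiliser theorem for the stabiliser of the origin, acting on the edges there.\<close>

lemma weight_times_stab:
  assumes e: "(x, y) \<in> parcs Y"
  shows "wt (orb (x, y)) * card (stab (x, y)) = card (stabilizer \<Gamma> \<phi> x)"
proof -
  have E: "orb (x, y) \<in> arcs X" using e unfolding arcs_X by blast
  have "stabilizer \<Gamma> \<phi> x = (\<Union>f\<in>out_at (orb (x, y)) x. {g \<in> carrier \<Gamma>. act g (x, y) = f})"
    using act_in_orb unfolding stabilizer_def out_at_def by fastforce
  then have "card (stabilizer \<Gamma> \<phi> x) = (\<Sum>f\<in>out_at (orb (x, y)) x. card {g \<in> carrier \<Gamma>. act g (x, y) = f})"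
    using out_at_finite[OF E] arc_verts[OF e] translates_card(1)[OF e]
    by (simp add: out_at_def) (subst card_UN_disjoint, auto)
  also have "\<dots> = (\<Sum>f\<in>out_at (orb (x, y)) x. card (stab (x, y)))"
    using translates_card(2)[OF e] by (intro sum.cong) (auto simp: out_at_def)
  finally show ?thesis using orb_weight[OF e] by simp
qed

definition stab_order :: "('v \<times> 'v) set \<Rightarrow> nat" where
  "stab_order E = card (stab (SOME e. e \<in> E))"

lemma stab_order_orb: "e \<in> parcs Y \<Longrightarrow> stab_order (orb e) = card (stab e)"
  unfolding stab_order_def using stab_card_orb someI[of "\<lambda>f. f \<in> orb e" e] orb_self by blast

lemma stab_order_pos: "E \<in> arcs X \<Longrightarrow> stab_order E > 0"
  using stab_order_orb stab_pos unfolding arcs_X by auto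

lemma stab_order_converse: "E \<in> arcs X \<Longrightarrow> stab_order (converse E) = stab_order E"
  using stab_order_orb swap_arc stab_swap unfolding arcs_X by (auto simp: converse_orb)

lemma weight_stab_order:
  assumes E: "E \<in> arcs X" and F: "F \<in> arcs X" and tail: "tail X E = tail X F"
  shows "wt E * stab_order E = wt F * stab_order F"
proof -
  obtain x where x: "x \<in> pverts Y" "tail X E = orbit \<Gamma> \<phi> x" using tail_rep[OF E] by blast
  obtain e f where e: "e \<in> out_at E x" and f: "f \<in> out_at F x"
    using weight_eq_card(2)[OF E x(1)] weight_eq_card(2)[OF F x(1)] x(2) tail by auto
  have eq: "wt G * stab_order G = card (stabilizer \<Gamma> \<phi> x)" if "G \<in> arcs X" "g \<in> out_at G x" for G g
  proof -
    have g: "g \<in> G" "fst g = x" using that(2) unfolding out_at_def by auto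
    note rep = arc_X_rep[OF that(1) g(1)]
    obtain y where y: "g = (x, y)" using g(2) by (cases g) auto
    show ?thesis using weight_times_stab[of x y] rep stab_order_orb[of "(x, y)"] unfolding y by simp
  qed
  show ?thesis using eq[OF E e] eq[OF F f] by simp
qed

text \<open>The invariant measure of the operator; for a tree lattice its total mass is finite.\<close>

definition \<mu> :: "('v \<times> 'v) set \<Rightarrow> real" where
  "\<mu> E = 1 / real (stab_order E)"

lemma \<mu>_pos: "E \<in> arcs X \<Longrightarrow> \<mu> E > 0"
  unfolding \<mu>_def using stab_order_pos by simp

lemma \<mu>_summable: "\<mu> summable_on arcs X"
  using lattice unfolding tree_lattice_def \<mu>_def stab_order_def quotient_graph_def by simp

text \<open>By the orbit-stabiliser theorem \<open>\<mu> F \<cdot> wt E' = wt F \<cdot> \<mu> E'\<close> for edges \<open>E'\<close> and \<open>F\<close> with the same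
  origin, so the sum becomes \<open>\<mu> E'\<close> times the sum \<open>q + 1\<close> of the weights at the origin, minus the
  backtracking term \<open>\<mu> E'\<close>.\<close>

lemma \<mu>_invariant:
  assumes E': "E' \<in> arcs X"
  shows "finite {E \<in> arcs X. head X E = tail X E'}"
    "(\<Sum>E\<in>{E \<in> arcs X. head X E = tail X E'}. \<mu> E * w E E') = q * \<mu> E'"
proof -
  obtain x where x: "x \<in> pverts Y" "tail X E' = orbit \<Gamma> \<phi> x" using tail_rep[OF E'] by blast
  have conv: "converse (converse E) = E" for E :: "('v \<times> 'v) set" by simp
  have img: "{E \<in> arcs X. head X E = tail X E'} = converse ` out_arcs X (tail X E')"
  proof (intro equalityI subsetI)
    fix E assume "E \<in> {E \<in> arcs X. head X E = tail X E'}"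
    then have "converse E \<in> out_arcs X (tail X E')" using converse_arc by (simp add: tail_converse)
    then show "E \<in> converse ` out_arcs X (tail X E')" using conv[of E] by (metis imageI)
  qed (auto simp: head_converse converse_arc)
  have fin: "finite (out_arcs X (tail X E'))" unfolding x(2) by (rule finite_out_arcs[OF x(1)])
  show "finite {E \<in> arcs X. head X E = tail X E'}" unfolding img using fin by simp
  have "(\<Sum>E\<in>{E \<in> arcs X. head X E = tail X E'}. \<mu> E * w E E') =
      (\<Sum>F\<in>out_arcs X (tail X E'). \<mu> (converse F) * w (converse F) E')"
    unfolding img by (subst sum.reindex) (auto simp: inj_on_def)
  also have "\<dots> = (\<Sum>F\<in>out_arcs X (tail X E'). real (wt F) * \<mu> E' - (if F = E' then \<mu> E' else 0))"
  proof (rule sum.cong)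
    fix F assume "F \<in> out_arcs X (tail X E')"
    then have F: "F \<in> arcs X" "tail X F = tail X E'" by auto
    have 1: "\<mu> (converse F) = \<mu> F" unfolding \<mu>_def using stab_order_converse[OF F(1)] by simp
    have 2: "w (converse F) E' = real (wt E') - (if F = E' then 1 else 0)"
      using converse_arc[OF F(1)] E' F by (auto simp: w_def trans_weight_def head_converse)
    have 3: "\<mu> F * real (wt E') = real (wt F) * \<mu> E'"
    proof -
      have "real (wt E') * real (stab_order E') = real (wt F) * real (stab_order F)"
        using weight_stab_order[OF E' F(1)] F(2) by (metis of_nat_mult)
      then show ?thesis unfolding \<mu>_def using stab_order_pos[OF F(1)] stab_order_pos[OF E'] by (simp add: field_simps)
    qed
    show "\<mu> (converse F) * w (converse F) E' = real (wt F) * \<mu> E' - (if F = E' then \<mu> E' else 0)"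
      unfolding 1 2 right_diff_distrib 3 by simp
  qed simp
  also have "\<dots> = real (\<Sum>F\<in>out_arcs X (tail X E'). wt F) * \<mu> E' - \<mu> E'"
    using fin E' by (simp add: sum_subtractf sum_distrib_right)
  also have "\<dots> = q * \<mu> E'" unfolding x(2) weight_sum[OF x(1)] by (simp add: algebra_simps)
  finally show "(\<Sum>E\<in>{E \<in> arcs X. head X E = tail X E'}. \<mu> E * w E E') = q * \<mu> E'" .
qed

text \<open>No mass flows out of a stable set, so, the total mass being finite and the measure
  invariant, none flows in.\<close>

lemma stable_complement:
  assumes M: "stable M"
  shows "stable (arcs X - M)"
proof -
  define a where "a = (\<lambda>(E, E'). \<mu> E * w E E')"
  have MX: "M \<subseteq> arcs X" using M unfolding stable_def by simp
  have a_nonneg: "a p \<ge> 0" if "fst p \<in> arcs X" for p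
    unfolding a_def using \<mu>_pos[OF that] w_nonneg by (auto simp: case_prod_unfold)
  have row: "((\<lambda>E'. a (E, E')) has_sum (q * \<mu> E)) M" if E: "E \<in> M" for E
  proof (rule has_sum_finite_neutralI[of "{E' \<in> out_arcs X (head X E). w E E' \<noteq> 0}"])
    have EX: "E \<in> arcs X" using E MX by auto
    show "finite {E' \<in> out_arcs X (head X E). w E E' \<noteq> 0}" 
      by (rule finite_subset[OF _ w_row_sum(1)[OF EX]]) blast
    show "{E' \<in> out_arcs X (head X E). w E E' \<noteq> 0} \<subseteq> M"
      using M E w_nonneg unfolding stable_def by (auto simp: less_le)
    show "a (E, E') = 0" if "E' \<in> M - {E' \<in> out_arcs X (head X E). w E E' \<noteq> 0}" for E'
      using that w_support[of E E'] unfolding a_def by auto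
    have "(\<Sum>E'\<in>{E' \<in> out_arcs X (head X E). w E E' \<noteq> 0}. a (E, E')) = (\<Sum>E'\<in>out_arcs X (head X E). \<mu> E * w E E')"
      using w_row_sum(1)[OF EX] by (intro sum.mono_neutral_cong_left) (auto simp: a_def)
    then show "q * \<mu> E = (\<Sum>E'\<in>{E' \<in> out_arcs X (head X E). w E E' \<noteq> 0}. a (E, E'))"
      using w_row_sum(2)[OF EX] by (simp add: sum_distrib_left[symmetric] mult.commute)
  qed
  \<comment> \<open>Summed by rows, the flow from \<open>M\<close> to \<open>M\<close> is \<open>q\<close> times the mass of \<open>M\<close>, since nothing leaves.
    Summed by columns, it falls short of that by whatever flows in from outside.\<close>
  define c where "c E' = (\<Sum>E\<in>{E \<in> M. head X E = tail X E'}. \<mu> E * w E E')" for E'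
  have fin_col: "finite {E \<in> M. head X E = tail X E'}" if "E' \<in> arcs X" for E'
    by (rule finite_subset[OF _ \<mu>_invariant(1)[OF that]]) (use MX in auto)
  have col: "((\<lambda>E. a (E, E')) has_sum c E') M" if E': "E' \<in> M" for E'
  proof (rule has_sum_finite_neutralI[of "{E \<in> M. head X E = tail X E'}"])
    show "finite {E \<in> M. head X E = tail X E'}" using fin_col E' MX by auto
    show "a (E, E') = 0" if "E \<in> M - {E \<in> M. head X E = tail X E'}" for E
      using that w_support[of E E'] unfolding a_def by auto
  qed (auto simp: c_def a_def)
  have sumM: "(\<lambda>E. q * \<mu> E) summable_on M"
    using summable_on_subset_banach[OF \<mu>_summable MX] by (intro summable_on_cmult_right)
  have "(\<lambda>p. norm (a p)) summable_on Sigma M (\<lambda>_. M)"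
  proof (rule Infinite_Sum.abs_summable_on_Sigma_iff[THEN iffD2], intro conjI ballI)
    fix E assume E: "E \<in> M"
    have "(\<lambda>E'. norm (a (E, E'))) summable_on M \<longleftrightarrow> (\<lambda>E'. a (E, E')) summable_on M"
      using a_nonneg E MX by (intro summable_on_cong) auto
    then show "(\<lambda>E'. norm (a (E, E'))) summable_on M" using row[OF E] unfolding summable_on_def by blast
  next
    have "norm (infsum (\<lambda>E'. norm (a (E, E'))) M) = q * \<mu> E" if E: "E \<in> M" for E
    proof -
      have "infsum (\<lambda>E'. norm (a (E, E'))) M = infsum (\<lambda>E'. a (E, E')) M"
        using a_nonneg E MX by (intro infsum_cong) auto
      also have "\<dots> = q * \<mu> E" using row[OF E] by (rule infsumI)
      finally show ?thesis using \<mu>_pos[of E] E MX by (auto simp: abs_mult)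
    qed
    then show "(\<lambda>E. norm (infsum (\<lambda>E'. norm (a (E, E'))) M)) summable_on M"
      using sumM by (subst summable_on_cong) auto
  qed
  then have "a summable_on Sigma M (\<lambda>_. M)" by (rule abs_summable_summable)
  then obtain S where S: "(a has_sum S) (M \<times> M)" unfolding summable_on_def by blast
  have rows: "((\<lambda>E. q * \<mu> E) has_sum S) M" by (rule has_sum_SigmaD[OF S row])
  have "((\<lambda>p. a (prod.swap p)) has_sum S) (M \<times> M)"
    using has_sum_reindex_bij_betw[of prod.swap "M \<times> M" "M \<times> M" a S] S
    by (simp add: bij_betw_def product_swap)
  then have cols: "(c has_sum S) M" by (rule has_sum_SigmaD) (use col in simp)
  have nn: "\<mu> F * w F E' \<ge> 0" if "F \<in> arcs X" for F E'
    using \<mu>_pos[OF that] w_nonneg[of F E'] by simp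
  have le: "c E' + \<mu> E * w E E' \<le> q * \<mu> E'" if E: "E \<in> arcs X - M" "w E E' > 0" and E': "E' \<in> arcs X" for E E'
  proof -
    have adj: "head X E = tail X E'" using w_support[of E E'] E(2) by auto
    have "c E' + \<mu> E * w E E' = (\<Sum>F\<in>insert E {E \<in> M. head X E = tail X E'}. \<mu> F * w F E')"
      unfolding c_def using E(1) fin_col[OF E'] by simp
    also have "\<dots> \<le> (\<Sum>F\<in>{E \<in> arcs X. head X E = tail X E'}. \<mu> F * w F E')"
    proof (rule sum_mono2[OF \<mu>_invariant(1)[OF E']])
      show "insert E {E \<in> M. head X E = tail X E'} \<subseteq> {E \<in> arcs X. head X E = tail X E'}"
        using E(1) adj MX by blast
    qed (use nn in blast)
    finally show ?thesis unfolding \<mu>_invariant(2)[OF E'] .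
  qed
  have c_le: "c E' \<le> q * \<mu> E'" if E': "E' \<in> M" for E'
  proof -
    have "c E' \<le> (\<Sum>F\<in>{E \<in> arcs X. head X E = tail X E'}. \<mu> F * w F E')"
      unfolding c_def
    proof (rule sum_mono2)
      show "finite {E \<in> arcs X. head X E = tail X E'}" using \<mu>_invariant(1) E' MX by blast
      show "{E \<in> M. head X E = tail X E'} \<subseteq> {E \<in> arcs X. head X E = tail X E'}" using MX by blast
    qed (use nn in blast)
    also have "\<dots> = q * \<mu> E'" using \<mu>_invariant(2) E' MX by blast
    finally show ?thesis .
  qed
  have "((\<lambda>E'. q * \<mu> E' + - c E') has_sum (S + - S)) M"
    using cols by (intro has_sum_add rows) (simp add: has_sum_uminus)
  then have zero: "q * \<mu> E' + - c E' = 0" if "E' \<in> M" for E'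
    using that c_le by (intro nonneg_has_sum_le_0D[of "\<lambda>E'. real q * \<mu> E' + - c E'" M "S + - S"]) auto
  have "E' \<notin> M" if E: "E \<in> arcs X - M" "w E E' > 0" for E E'
  proof
    assume E': "E' \<in> M"
    have "\<mu> E * w E E' > 0" using \<mu>_pos[of E] E by simp
    moreover have "c E' + \<mu> E * w E E' \<le> q * \<mu> E'" using le[OF E] E' MX by blast
    ultimately show False using zero[OF E'] by linarith
  qed
  then show ?thesis unfolding stable_def using w_support by (metis DiffI Diff_subset less_irrefl)
qed

text \<open>The set of edges that can be reached from a given one is stable, hence so is its complement, and a
  partition into stable sets is trivial.\<close>

lemma irreducible_X:
  assumes E: "E \<in> arcs X" and F: "F \<in> arcs X"
  shows "(E, F) \<in> {(x, y). w x y > 0}\<^sup>*"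
proof -
  define M where "M = {F \<in> arcs X. (E, F) \<in> {(x, y). w x y > 0}\<^sup>*}"
  have "stable M" unfolding stable_def M_def
    using w_support by (auto intro: rtrancl_into_rtrancl) (metis less_irrefl)
  then have "M = {} \<or> arcs X - M = {}"
    by (intro stable_partition_trivial stable_complement) (auto simp: M_def)
  moreover have "E \<in> M" unfolding M_def using E by simp
  ultimately show ?thesis using F unfolding M_def by blast
qed

lemma arcs_X_nonempty: "arcs X \<noteq> {}"
proof -
  have "Digraph_Component.connected (with_proj Y)" using tree_Y unfolding is_tree_def by auto
  then obtain x where "x \<in> pverts Y" unfolding connected_def strongly_connected_def by (auto simp: mk_symmetric_def)
  then show ?thesis using other_neighbours[of x] unfolding arcs_X by blast
qed

section \<open>Rays in the tree\<close>

text \<open>Reduced paths, the empty path included.\<close>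

definition rpath :: "('v \<times> 'v) list \<Rightarrow> bool" where
  "rpath p \<longleftrightarrow> set p \<subseteq> parcs Y \<and> successively (\<lambda>e f. snd e = fst f \<and> f \<noteq> prod.swap e) p"

lemma rpath_not_closed: "rpath p \<Longrightarrow> p \<noteq> [] \<Longrightarrow> fst (hd p) \<noteq> snd (last p)"
proof -
  assume p: "rpath p" "p \<noteq> []"
  then have "graph_path (with_proj Y) p" "reduced p"
    unfolding rpath_def graph_path_def reduced_def by (auto simp: successively_conv_nth)
  then show ?thesis using tree_Y unfolding is_tree_def by blast
qed

lemma rpath_append: "p \<noteq> [] \<Longrightarrow> p' \<noteq> [] \<Longrightarrow> rpath (p @ p') \<longleftrightarrow>
   rpath p \<and> rpath p' \<and> snd (last p) = fst (hd p') \<and> hd p' \<noteq> prod.swap (last p)"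
  unfolding rpath_def by (auto simp: successively_append_iff)

lemma rpath_reverse: "rpath p \<Longrightarrow> rpath (rev (map prod.swap p))"
  unfolding rpath_def using swap_arc
  by (auto simp: successively_rev successively_map elim!: successively_mono)

text \<open>If the last edges differ, then the first path followed by the reverse of the second is a closed
  reduced path, which a tree does not contain; otherwise the last edges can be removed.\<close>

lemma rpath_unique:
  assumes "rpath p" "rpath p'" "p \<noteq> []" "p' \<noteq> []" "fst (hd p) = fst (hd p')" "snd (last p) = snd (last p')"
  shows "p = p'"
  using assms
proof (induction p arbitrary: p' rule: rev_induct)
  case (snoc e xs)
  obtain ys f where p': "p' = ys @ [f]" using snoc.prems(4) by (metis rev_exhaust)
  show ?case
  proof (cases "e = f")
    case True
    have one: False if "rpath (zs @ [e])" "zs \<noteq> []" "fst (hd zs) = fst e" for zs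
      using that rpath_not_closed[of zs] rpath_append[of zs "[e]"] by simp
    consider "xs = []" "ys = []" | "xs = []" "ys \<noteq> []" | "xs \<noteq> []" "ys = []" | "xs \<noteq> []" "ys \<noteq> []" by blast
    then show ?thesis
    proof cases
      case 2
      then show ?thesis using one[of ys] snoc.prems unfolding p' True by simp
    next
      case 3
      then show ?thesis using one[of xs] snoc.prems unfolding p' True by simp
    next
      case 4
      have "xs = ys"
        using snoc.prems 4 rpath_append[of xs "[e]"] rpath_append[of ys "[e]"] unfolding p' True
        by (intro snoc.IH) auto
      then show ?thesis unfolding p' True by simp
    qed (use p' True in simp)
  next
    case False
    let ?q = "(xs @ [e]) @ rev (map prod.swap p')"
    have "hd (rev (map prod.swap p')) = prod.swap f" unfolding p' by simp
    moreover have "prod.swap f \<noteq> prod.swap e" using False by (cases e; cases f) auto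
    ultimately have "rpath ?q"
      using snoc.prems rpath_reverse[OF snoc.prems(2)] unfolding p'
      by (subst rpath_append) auto
    then have "fst (hd ?q) \<noteq> snd (last ?q)" by (rule rpath_not_closed) simp
    moreover have "last ?q = prod.swap (hd p')" using snoc.prems(4) by (simp add: last_rev hd_map)
    moreover have "hd ?q = hd (xs @ [e])" by (cases xs) auto
    ultimately show ?thesis using snoc.prems(5) by simp
  qed
qed simp

lemma raysD:
  assumes "r \<in> rays Y"
  shows "r j \<in> parcs Y" "snd (r j) = fst (r (Suc j))" "r (Suc j) \<noteq> prod.swap (r j)"
  using assms unfolding rays_def by auto

lemma rpath_ray: "r \<in> rays Y \<Longrightarrow> rpath (map r [0..<n])"
  unfolding rpath_def successively_conv_nth using raysD[of r] by auto

lemma ray_unique: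
  assumes s: "s \<in> rays Y" and t: "t \<in> rays Y" and start: "fst (s 0) = fst (t 0)"
    and merge: "\<And>j. s (j + a) = t (j + b)"
  shows "s = t"
proof -
  have "map s [0..<Suc a] = map t [0..<Suc b]"
  proof (rule rpath_unique[OF rpath_ray[OF s] rpath_ray[OF t]])
    show "fst (hd (map s [0..<Suc a])) = fst (hd (map t [0..<Suc b]))"
      using start by (simp add: hd_map del: upt_Suc)
    show "snd (last (map s [0..<Suc a])) = snd (last (map t [0..<Suc b]))"
      using merge[of 0] by simp
  qed auto
  note eq = this
  have ab: "a = b" using arg_cong[OF eq, of length] by simp
  show "s = t"
  proof
    fix j
    show "s j = t j"
    proof (cases "j \<le> a")
      case True
      then have "map s [0..<Suc a] ! j = s j" "map t [0..<Suc b] ! j = t j"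
        using ab by (simp_all del: upt_Suc)
      then show ?thesis using eq by simp
    next
      case False
      then show ?thesis using merge[of "j - a"] ab by simp
    qed
  qed
qed

lemma ray_equiv_iff:
  "(r, s) \<in> ray_equiv Y \<longleftrightarrow> r \<in> rays Y \<and> s \<in> rays Y \<and> (\<exists>a b. \<forall>j. r (j + a) = s (j + b))"
proof -
  have "(\<exists>N::nat. \<exists>k::int. \<forall>j\<ge>N. int j + k \<ge> 0 \<and> r (nat (int j + k)) = s j) \<longleftrightarrow> (\<exists>a b. \<forall>j. r (j + a) = s (j + b))"
  proof
    assume "\<exists>N::nat. \<exists>k::int. \<forall>j\<ge>N. int j + k \<ge> 0 \<and> r (nat (int j + k)) = s j"
    then obtain N :: nat and k :: int where Nk: "\<And>j. j \<ge> N \<Longrightarrow> int j + k \<ge> 0 \<and> r (nat (int j + k)) = s j" by blast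
    have "r (j + nat (int N + k)) = s (j + N)" for j
    proof -
      have "0 \<le> int N + k" using Nk[of N] by simp
      then have "nat (int (j + N) + k) = j + nat (int N + k)" by arith
      then show ?thesis using Nk[of "j + N"] by simp
    qed
    then show "\<exists>a b. \<forall>j. r (j + a) = s (j + b)" by blast
  next
    assume "\<exists>a b. \<forall>j. r (j + a) = s (j + b)"
    then obtain a b where ab: "\<And>j. r (j + a) = s (j + b)" by blast
    have "int j + (int a - int b) \<ge> 0 \<and> r (nat (int j + (int a - int b))) = s j" if "j \<ge> b" for j
    proof -
      have "nat (int j + (int a - int b)) = (j - b) + a" using that by simp
      then show ?thesis using ab[of "j - b"] that by simp
    qed
    then show "\<exists>N::nat. \<exists>k::int. \<forall>j\<ge>N. int j + k \<ge> 0 \<and> r (nat (int j + k)) = s j" by blast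
  qed
  then show ?thesis unfolding ray_equiv_def by simp
qed

lemma boundary_class:
  assumes c: "c \<in> tree_boundary Y"
  shows "c \<noteq> {}" "s \<in> c \<Longrightarrow> s \<in> rays Y" "s \<in> c \<Longrightarrow> t \<in> c \<Longrightarrow> \<exists>a b. \<forall>j. s (j + a) = t (j + b)"
    "s \<in> c \<Longrightarrow> t \<in> rays Y \<Longrightarrow> (\<And>j. s (j + a) = t (j + b)) \<Longrightarrow> t \<in> c"
proof -
  obtain r0 where r0: "r0 \<in> rays Y" "c = ray_equiv Y `` {r0}"
    using c unfolding tree_boundary_def by (auto elim: quotientE)
  have mem: "s \<in> c \<longleftrightarrow> s \<in> rays Y \<and> (\<exists>a b. \<forall>j. r0 (j + a) = s (j + b))" for s
    using r0 by (auto simp: ray_equiv_iff)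
  show "c \<noteq> {}" using mem[of r0] r0(1) by blast
  show "s \<in> c \<Longrightarrow> s \<in> rays Y" using mem by blast
  show "\<exists>a b. \<forall>j. s (j + a) = t (j + b)" if st: "s \<in> c" "t \<in> c"
  proof -
    obtain a b a' b' where h: "\<And>j. r0 (j + a) = s (j + b)" "\<And>j. r0 (j + a') = t (j + b')"
      using mem st by blast
    have "s (j + (a' + b)) = t (j + (a + b'))" for j
      using h(1)[of "j + a'"] h(2)[of "j + a"] by (simp add: add_ac)
    then show ?thesis by blast
  qed
  show "t \<in> c" if st: "s \<in> c" "t \<in> rays Y" "\<And>j. s (j + a) = t (j + b)"
  proof -
    obtain a' b' where h: "\<And>j. r0 (j + a') = s (j + b')" using mem st(1) by blast
    have "r0 (j + (a' + a)) = t (j + (b' + b))" for j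
      using h[of "j + a"] st(3)[of "j + b'"] by (simp add: add_ac)
    then show ?thesis using mem st(2) by blast
  qed
qed

text \<open>Moving the starting point along an edge removes the first edge of the ray or prepends one.\<close>

lemma boundary_ray_from:
  assumes c: "c \<in> tree_boundary Y" and z: "z \<in> pverts Y"
  shows "\<exists>s\<in>c. fst (s 0) = z"
proof -
  obtain r where r: "r \<in> c" using boundary_class(1)[OF c] by blast
  have rr: "r \<in> rays Y" by (rule boundary_class(2)[OF c r])
  have "fst (r 0) \<in> pverts Y" using raysD(1)[OF rr, of 0] arc_verts[of "fst (r 0)" "snd (r 0)"] by simp
  then have "(fst (r 0), z) \<in> (parcs Y)\<^sup>*" using z by (rule reachable_Y)
  then show ?thesis
  proof (induction rule: rtrancl_induct)
    case base
    then show ?case using r by blast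
  next
    case (step y z)
    then obtain s where s: "s \<in> c" "fst (s 0) = y" by blast
    have sr: "s \<in> rays Y" by (rule boundary_class(2)[OF c s(1)])
    show ?case
    proof (cases "s 0 = (y, z)")
      case True
      define t where "t j = s (Suc j)" for j
      have "t \<in> rays Y" using sr unfolding rays_def t_def by auto
      then have "t \<in> c" by (rule boundary_class(4)[OF c s(1), of _ 1 0]) (simp add: t_def)
      moreover have "fst (t 0) = z" using raysD(2)[OF sr, of 0] True unfolding t_def by simp
      ultimately show ?thesis by blast
    next
      case False
      define t where "t j = (case j of 0 \<Rightarrow> (z, y) | Suc i \<Rightarrow> s i)" for j
      have "t \<in> rays Y" unfolding rays_def
      proof (intro CollectI allI)
        fix j
        show "t j \<in> parcs Y \<and> snd (t j) = fst (t (Suc j)) \<and> t (Suc j) \<noteq> prod.swap (t j)"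
          using raysD[OF sr] s(2) arc_sym[OF step.hyps(2)] False unfolding t_def by (cases j) auto
      qed
      then have "t \<in> c" by (rule boundary_class(4)[OF c s(1), of _ 0 1]) (simp add: t_def)
      then show ?thesis by (intro bexI[of _ t]) (simp_all add: t_def)
    qed
  qed
qed

text \<open>Vertices have at least two neighbours, so an edge can be prolonged backwards without backtracking.\<close>

lemma backward_path:
  assumes "e \<in> parcs Y"
  shows "\<exists>p. p m = e \<and> (\<forall>j\<le>m. p j \<in> parcs Y) \<and> (\<forall>j<m. snd (p j) = fst (p (Suc j)) \<and> p (Suc j) \<noteq> prod.swap (p j))"
proof (induction m)
  case 0
  show ?case using assms by (intro exI[of _ "\<lambda>_. e"]) simp
next
  case (Suc m)
  then obtain p where p: "p m = e" "\<forall>j\<le>m. p j \<in> parcs Y"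
    "\<forall>j<m. snd (p j) = fst (p (Suc j)) \<and> p (Suc j) \<noteq> prod.swap (p j)" by blast
  obtain u v where uv: "p 0 = (u, v)" by (metis surj_pair)
  have "(u, v) \<in> parcs Y" using p(2) uv by (metis le0)
  then obtain u' where u': "(u, u') \<in> parcs Y" "u' \<noteq> v" using other_neighbours[of u v v] arc_verts by blast
  define p' where "p' j = (case j of 0 \<Rightarrow> (u', u) | Suc i \<Rightarrow> p i)" for j
  have "p' (Suc m) = e" using p(1) unfolding p'_def by simp
  moreover have "\<forall>j\<le>Suc m. p' j \<in> parcs Y" using p(2) arc_sym[OF u'(1)] unfolding p'_def by (auto split: nat.split)
  moreover have "\<forall>j<Suc m. snd (p' j) = fst (p' (Suc j)) \<and> p' (Suc j) \<noteq> prod.swap (p' j)"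
    using p(3) uv u'(2) unfolding p'_def by (auto split: nat.split)
  ultimately show ?case by blast
qed

section \<open>Cusps\<close>

text \<open>Transitivity on one horocycle spreads to all horocycles further inside the cusp. An edge that
  leads to a vertex of the ray \<open>r\<close> is prolonged backwards to a ray that starts on the given
  horocycle and later joins \<open>r\<close>. A group element that fixes the end \<open>c\<close> and moves one starting point
  to another moves the whole ray, because a ray in a tree is determined by its starting point and
  its end.\<close>

lemma cusp_transitive:
  assumes cusp: "is_cusp \<Gamma> Y \<phi> c" and r: "r \<in> c"
  obtains b where "\<And>n y. n \<ge> b \<Longrightarrow> (y, fst (r (Suc n))) \<in> parcs Y \<Longrightarrow> y \<noteq> snd (r (Suc n)) \<Longrightarrow>
     \<exists>g\<in>carrier \<Gamma>. act g (r n) = (y, fst (r (Suc n))) \<and> (\<forall>j>n. act g (r j) = r j)"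
proof -
  have c: "c \<in> tree_boundary Y" using cusp unfolding is_cusp_def by simp
  obtain H where H: "H \<in> horocycles Y c" "\<forall>x\<in>H. \<forall>y\<in>H. \<exists>g\<in>carrier \<Gamma>. \<phi> g \<in> N_stab Y c \<and> \<phi> g x = y"
    using cusp unfolding is_cusp_def by blast
  obtain z where z: "z \<in> pverts Y" "H = same_horocycle c `` {z}"
    using H(1) unfolding horocycles_def by (auto elim: quotientE)
  obtain s where s: "s \<in> c" "fst (s 0) = z" using boundary_ray_from[OF c z(1)] by blast
  have sr: "s \<in> rays Y" by (rule boundary_class(2)[OF c s(1)])
  obtain a b where ab: "\<And>j. s (j + a) = r (j + b)" using boundary_class(3)[OF c s(1) r] by blast
  show thesis
  proof
    fix n y assume n: "n \<ge> b" and y: "(y, fst (r (Suc n))) \<in> parcs Y" "y \<noteq> snd (r (Suc n))"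
    define m where "m = n - b + a"
    have sr_eq: "s (m + i) = r (n + i)" for i using ab[of "n - b + i"] n unfolding m_def by (simp add: add_ac)
    define e where "e = (y, fst (r (Suc n)))"
    obtain p where p: "p m = e" "\<forall>j\<le>m. p j \<in> parcs Y"
      "\<forall>j<m. snd (p j) = fst (p (Suc j)) \<and> p (Suc j) \<noteq> prod.swap (p j)"
      using backward_path[of e m] y(1) unfolding e_def by blast
    define t where "t j = (if j \<le> m then p j else s j)" for j
    have sm: "s (Suc m) = r (Suc n)" using sr_eq[of 1] by simp
    have t: "t \<in> rays Y" unfolding rays_def
    proof (intro CollectI allI)
      fix j
      consider "j < m" | "j = m" | "j > m" by linarith
      then show "t j \<in> parcs Y \<and> snd (t j) = fst (t (Suc j)) \<and> t (Suc j) \<noteq> prod.swap (t j)"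
      proof cases
        case 2
        have "r (Suc n) \<noteq> (fst (r (Suc n)), y)" using y(2) by (metis snd_conv)
        then show ?thesis using 2 p(1,2) sm y(1) unfolding t_def e_def by simp
      qed (use p raysD[OF sr] in \<open>auto simp: t_def\<close>)
    qed
    have tc: "t \<in> c" by (rule boundary_class(4)[OF c s(1) t, of "Suc m" "Suc m"]) (simp add: t_def)
    have "(z, fst (t 0)) \<in> same_horocycle c" unfolding same_horocycle_def
    proof (intro CollectI case_prodI bexI conjI exI)
      show "fst (s (Suc m)) = fst (t (Suc m))" unfolding t_def by simp
    qed (use s tc in auto)
    moreover have "(z, z) \<in> same_horocycle c" unfolding same_horocycle_def using s by blast
    ultimately have "z \<in> H" "fst (t 0) \<in> H" unfolding z(2) by auto
    then obtain g where g: "g \<in> carrier \<Gamma>" "\<phi> g \<in> N_stab Y c" "\<phi> g z = fst (t 0)" using H(2) by blast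
    have "(\<lambda>r j. map_prod (\<phi> g) (\<phi> g) (r j)) ` c = c" using g(2) unfolding N_stab_def P_stab_def by auto
    then have gs: "(\<lambda>j. act g (s j)) \<in> c" using s(1) unfolding edge_act_def by blast
    obtain a' b' where ab': "\<And>j. act g (s (j + a')) = t (j + b')" using boundary_class(3)[OF c gs tc] by blast
    have gst: "(\<lambda>j. act g (s j)) = t"
      by (rule ray_unique[OF boundary_class(2)[OF c gs] t _ ab']) (simp add: s(2) g(3))
    have "act g (r n) = e" using fun_cong[OF gst, of m] sr_eq[of 0] p(1) unfolding t_def by simp
    moreover have "act g (r j) = r j" if "j > n" for j
    proof -
      have "\<not> m + (j - n) \<le> m" using that by linarith
      then have "t (m + (j - n)) = s (m + (j - n))" unfolding t_def by (simp only: if_False)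
      then show ?thesis using fun_cong[OF gst, of "m + (j - n)"] sr_eq[of "j - n"] that by simp
    qed
    ultimately show "\<exists>g\<in>carrier \<Gamma>. act g (r n) = (y, fst (r (Suc n))) \<and> (\<forall>j>n. act g (r j) = r j)"
      using g(1) unfolding e_def by blast
  qed
qed

lemma inner_neighbours:
  fixes n :: nat
  assumes r: "r \<in> rays Y"
  defines "Z \<equiv> {y. (y, fst (r (Suc n))) \<in> parcs Y \<and> y \<noteq> snd (r (Suc n))}"
  shows "finite Z" "card Z = q"
proof -
  define x where "x = fst (r (Suc n))"
  have rx: "r (Suc n) = (x, snd (r (Suc n)))" unfolding x_def by simp
  have x: "x \<in> pverts Y" using raysD(1)[OF r, of "Suc n"] arc_verts[of x "snd (r (Suc n))"] rx by simp
  have img: "(\<lambda>y. (x, y)) ` Z = {e \<in> parcs Y. fst e = x} - {r (Suc n)}"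
  proof (intro equalityI subsetI)
    fix e assume "e \<in> {e \<in> parcs Y. fst e = x} - {r (Suc n)}"
    then obtain y where y: "e = (x, y)" "(x, y) \<in> parcs Y" "(x, y) \<noteq> r (Suc n)" by (cases e) auto
    then have "y \<in> Z" using arc_sym[OF y(2)] rx unfolding Z_def x_def[symmetric] by auto
    then show "e \<in> (\<lambda>y. (x, y)) ` Z" using y(1) by blast
  next
    fix e assume "e \<in> (\<lambda>y. (x, y)) ` Z"
    then obtain y where y: "e = (x, y)" "(y, x) \<in> parcs Y" "y \<noteq> snd (r (Suc n))"
      unfolding Z_def x_def[symmetric] by blast
    have "(x, y) \<noteq> r (Suc n)" using y(3) by (metis snd_conv)
    then show "e \<in> {e \<in> parcs Y. fst e = x} - {r (Suc n)}" using arc_sym[OF y(2)] y(1) by simp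
  qed
  have inj: "inj_on (\<lambda>y. (x, y)) Z" by (auto simp: inj_on_def)
  have fin: "finite ((\<lambda>y. (x, y)) ` Z)" unfolding img using star_finite[OF x] by simp
  then show "finite Z" using inj by (rule finite_imageD)
  have "r (Suc n) \<in> {e \<in> parcs Y. fst e = x}" using raysD(1)[OF r, of "Suc n"] unfolding x_def by simp
  then have "card ((\<lambda>y. (x, y)) ` Z) = q" unfolding img using star_card[OF x] star_finite[OF x] by simp
  then show "card Z = q" using card_image[OF inj] by simp
qed

text \<open>Unlike the stabilisers of the edges \<open>r n\<close>, these subgroups increase with \<open>n\<close> by definition.\<close>

definition ray_fixer :: "(nat \<Rightarrow> 'v \<times> 'v) \<Rightarrow> nat \<Rightarrow> 'g set" where
  "ray_fixer r n = {g \<in> carrier \<Gamma>. \<forall>j\<ge>n. act g (r j) = r j}"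

lemma ray_fixer_stab: "ray_fixer r n \<subseteq> stab (r n)"
  unfolding ray_fixer_def stabilizer_def by auto

text \<open>There are \<open>q\<close> edges that can take the place of \<open>r n\<close> before \<open>r (n + 1)\<close>, and the group elements that
  move \<open>r n\<close> to them and fix the rest of the ray give \<open>q\<close> disjoint translates of the fixer of
  the ray from \<open>r n\<close> on inside the next fixer.\<close>

lemma stab_unbounded:
  assumes r: "r \<in> rays Y"
    and trans: "\<And>n y. n \<ge> b \<Longrightarrow> (y, fst (r (Suc n))) \<in> parcs Y \<Longrightarrow> y \<noteq> snd (r (Suc n)) \<Longrightarrow>
     \<exists>g\<in>carrier \<Gamma>. act g (r n) = (y, fst (r (Suc n))) \<and> (\<forall>j>n. act g (r j) = r j)"
  shows "card (stab (r (b + k))) \<ge> 2 ^ k"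
proof -
  have fin: "finite (ray_fixer r n)" for n
    by (rule finite_subset[OF ray_fixer_stab finite_stab[OF raysD(1)[OF r]]])
  have grow: "q * card (ray_fixer r n) \<le> card (ray_fixer r (Suc n))" if n: "n \<ge> b" for n
  proof -
    define Z where "Z = {y. (y, fst (r (Suc n))) \<in> parcs Y \<and> y \<noteq> snd (r (Suc n))}"
    have "\<forall>y\<in>Z. \<exists>g\<in>carrier \<Gamma>. act g (r n) = (y, fst (r (Suc n))) \<and> (\<forall>j>n. act g (r j) = r j)"
      using trans[OF n] unfolding Z_def by blast
    then obtain g where g: "\<And>y. y \<in> Z \<Longrightarrow> g y \<in> carrier \<Gamma> \<and> act (g y) (r n) = (y, fst (r (Suc n))) \<and> (\<forall>j>n. act (g y) (r j) = r j)"
      by metis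
    have "card (Z \<times> ray_fixer r n) \<le> card (ray_fixer r (Suc n))"
    proof (rule card_inj_on_le[of "\<lambda>(y, h). g y \<otimes>\<^bsub>\<Gamma>\<^esub> h"])
      show "inj_on (\<lambda>(y, h). g y \<otimes>\<^bsub>\<Gamma>\<^esub> h) (Z \<times> ray_fixer r n)"
      proof (rule inj_onI, clarify)
        fix y h y' h'
        assume y: "y \<in> Z" "y' \<in> Z" and h: "h \<in> ray_fixer r n" "h' \<in> ray_fixer r n"
          and eq: "g y \<otimes>\<^bsub>\<Gamma>\<^esub> h = g y' \<otimes>\<^bsub>\<Gamma>\<^esub> h'"
        have hc: "h \<in> carrier \<Gamma>" "h' \<in> carrier \<Gamma>" "act h (r n) = r n" "act h' (r n) = r n"
          using h unfolding ray_fixer_def by auto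
        have "act (g y \<otimes>\<^bsub>\<Gamma>\<^esub> h) (r n) = (y, fst (r (Suc n)))" "act (g y' \<otimes>\<^bsub>\<Gamma>\<^esub> h') (r n) = (y', fst (r (Suc n)))"
          using act_mult[OF _ hc(1) raysD(1)[OF r]] act_mult[OF _ hc(2) raysD(1)[OF r]] g[OF y(1)] g[OF y(2)] hc by simp_all
        then have yy: "y = y'" using eq by simp
        interpret group \<Gamma> by (rule group_\<Gamma>)
        show "y = y' \<and> h = h'" using eq yy g[OF y(1)] hc by simp
      qed
      show "(\<lambda>(y, h). g y \<otimes>\<^bsub>\<Gamma>\<^esub> h) ` (Z \<times> ray_fixer r n) \<subseteq> ray_fixer r (Suc n)"
      proof clarify
        fix y h assume y: "y \<in> Z" and h: "h \<in> ray_fixer r n"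
        have hc: "h \<in> carrier \<Gamma>" "\<And>j. j \<ge> n \<Longrightarrow> act h (r j) = r j" using h unfolding ray_fixer_def by auto
        have "act (g y \<otimes>\<^bsub>\<Gamma>\<^esub> h) (r j) = r j" if "j \<ge> Suc n" for j
          using act_mult[OF _ hc(1) raysD(1)[OF r]] g[OF y] hc(2)[of j] that by simp
        then show "g y \<otimes>\<^bsub>\<Gamma>\<^esub> h \<in> ray_fixer r (Suc n)" unfolding ray_fixer_def using mult_in g[OF y] hc(1) by simp
      qed
    qed (rule fin)
    then show ?thesis using inner_neighbours[OF r, of n] by (simp add: card_cartesian_product Z_def)
  qed
  have "2 ^ k \<le> card (ray_fixer r (b + k))"
  proof (induction k)
    case 0
    have "\<one>\<^bsub>\<Gamma>\<^esub> \<in> ray_fixer r b" unfolding ray_fixer_def using one_in act_one raysD(1)[OF r] by simp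
    then show ?case using fin[of b] by (simp add: Suc_le_eq card_gt_0_iff) blast
  next
    case (Suc k)
    have "2 ^ Suc k \<le> q * card (ray_fixer r (b + k))" using Suc q_ge_2 by (simp add: mult_mono)
    then show ?case using grow[of "b + k"] by simp
  qed
  also have "\<dots> \<le> card (stab (r (b + k)))"
    by (rule card_mono[OF finite_stab[OF raysD(1)[OF r]] ray_fixer_stab])
  finally show ?thesis .
qed

text \<open>Far out in a cusp there is one edge going further out, of weight \<open>1\<close>, and one edge going
  back, of weight \<open>q\<close>, so that the stabilisers grow by the factor \<open>q\<close>. Otherwise the image of the
  ray would go back and forth along a single edge, and the stabilisers would be bounded.\<close>

lemma cusp_section_weights:
  assumes cusp: "is_cusp \<Gamma> Y \<phi> c" and r: "r \<in> c"
  defines "E \<equiv> \<lambda>n. orb (r n)"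
  shows "\<exists>N. \<forall>n\<ge>N. wt (E n) = 1 \<and> wt (converse (E n)) = q \<and> E (Suc n) \<noteq> converse (E n)
     \<and> stab_order (E (Suc n)) = q * stab_order (E n)"
proof -
  have "c \<in> tree_boundary Y" using cusp unfolding is_cusp_def by simp
  then have rr: "r \<in> rays Y" using r by (rule boundary_class(2))
  obtain b where trans: "\<And>n y. n \<ge> b \<Longrightarrow> (y, fst (r (Suc n))) \<in> parcs Y \<Longrightarrow> y \<noteq> snd (r (Suc n)) \<Longrightarrow>
     \<exists>g\<in>carrier \<Gamma>. act g (r n) = (y, fst (r (Suc n))) \<and> (\<forall>j>n. act g (r j) = r j)"
    using cusp_transitive[OF cusp r] by blast
  have EX: "E n \<in> arcs X" "converse (E n) \<in> arcs X" for n
    using raysD(1)[OF rr, of n] converse_arc unfolding E_def arcs_X by blast+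
  have vert: "fst (r n) \<in> pverts Y" for n using raysD(1)[OF rr, of n] arc_verts[of "fst (r n)" "snd (r n)"] by simp
  have tailE: "tail X (E n) = orbit \<Gamma> \<phi> (fst (r n))" for n unfolding E_def tail_X fst_orb ..
  have tailC: "tail X (converse (E n)) = orbit \<Gamma> \<phi> (fst (r (Suc n)))" for n
    unfolding tail_converse E_def head_X snd_orb raysD(2)[OF rr] ..
  define Z where "Z n = {y. (y, fst (r (Suc n))) \<in> parcs Y \<and> y \<noteq> snd (r (Suc n))}" for n
  have backward: "(\<lambda>y. (fst (r (Suc n)), y)) ` Z n \<subseteq> out_at (converse (E n)) (fst (r (Suc n)))" if n: "n \<ge> b" for n
  proof
    fix e assume "e \<in> (\<lambda>y. (fst (r (Suc n)), y)) ` Z n"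
    then obtain y where y: "e = (fst (r (Suc n)), y)" "(y, fst (r (Suc n))) \<in> parcs Y" "y \<noteq> snd (r (Suc n))"
      unfolding Z_def by blast
    obtain g where "g \<in> carrier \<Gamma>" "act g (r n) = (y, fst (r (Suc n)))" using trans[OF n y(2,3)] by blast
    then have "(y, fst (r (Suc n))) \<in> E n" using act_in_orb[of g "r n"] unfolding E_def by simp
    then show "e \<in> out_at (converse (E n)) (fst (r (Suc n)))" unfolding out_at_def y(1) by simp
  qed
  have wtC: "wt (converse (E n)) = card (out_at (converse (E n)) (fst (r (Suc n))))" for n
    by (rule weight_eq_card(1)[OF EX(2) vert tailC[symmetric]])
  have wtE: "wt (E n) = card (out_at (E n) (fst (r n)))" for n
    by (rule weight_eq_card(1)[OF EX(1) vert tailE[symmetric]])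
  have cardZ: "card ((\<lambda>y. (x, y)) ` Z n) = q" "finite ((\<lambda>y. (x, y)) ` Z n)" for n and x :: 'v
  proof -
    have "inj_on (\<lambda>y. (x, y)) (Z n)" by (auto simp: inj_on_def)
    then show "card ((\<lambda>y. (x, y)) ` Z n) = q" using inner_neighbours(2)[OF rr, of n] unfolding Z_def by (simp add: card_image)
    show "finite ((\<lambda>y. (x, y)) ` Z n)" using inner_neighbours(1)[OF rr, of n] unfolding Z_def by simp
  qed
  have wC: "wt (converse (E n)) \<ge> q" if n: "n \<ge> b" for n
    using card_mono[OF out_at_finite[OF EX(2) vert] backward[OF n]] cardZ(1) unfolding wtC by simp
  have full: "wt (converse (E n)) \<ge> q + 1" if n: "n \<ge> b" and eq: "E (Suc n) = converse (E n)" for n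
  proof -
    let ?x = "fst (r (Suc n))"
    have "r (Suc n) \<in> out_at (converse (E n)) ?x"
    proof -
      have "r (Suc n) \<in> E (Suc n)" unfolding E_def by (rule orb_self[OF raysD(1)[OF rr]])
      then show ?thesis unfolding eq out_at_def by simp
    qed
    then have "insert (r (Suc n)) ((\<lambda>y. (?x, y)) ` Z n) \<subseteq> out_at (converse (E n)) ?x" using backward[OF n] by blast
    then have "card (insert (r (Suc n)) ((\<lambda>y. (?x, y)) ` Z n)) \<le> wt (converse (E n))"
      unfolding wtC by (intro card_mono out_at_finite EX vert)
    moreover have "r (Suc n) \<notin> (\<lambda>y. (?x, y)) ` Z n"
    proof
      assume "r (Suc n) \<in> (\<lambda>y. (?x, y)) ` Z n"
      then obtain y where y: "y \<in> Z n" "r (Suc n) = (?x, y)" by (elim imageE)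
      have "snd (r (Suc n)) = y" by (subst y(2)) simp
      then show False using y(1) unfolding Z_def by simp
    qed
    ultimately show ?thesis using cardZ by simp
  qed
  have two: "wt (E (Suc n)) + wt (converse (E n)) \<le> q + 1" if "E (Suc n) \<noteq> converse (E n)" for n
    by (rule weight_le_two[OF vert EX(1) tailE EX(2) tailC that])
  have turn: "E (Suc (Suc n)) = converse (E (Suc n))" if n: "n > b" and eq: "E (Suc n) = converse (E n)" for n
  proof -
    obtain k where k: "n = Suc k" "k \<ge> b" using n by (cases n) auto
    have eq': "E n = converse (E (Suc n))" using eq by simp
    have "wt (E n) \<ge> q" using wC[of "Suc n"] n unfolding eq' by simp
    have "E n = converse (E k)"
    proof (rule ccontr)
      assume "E n \<noteq> converse (E k)"
      then have "wt (E n) + wt (converse (E k)) \<le> q + 1" using two[of k] unfolding k(1) by simp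
      then show False using \<open>wt (E n) \<ge> q\<close> wC[OF k(2)] q_ge_2 by simp
    qed
    then have "wt (E n) \<ge> q + 1" using full[OF k(2)] unfolding k(1) by simp
    then have "wt (converse (E (Suc n))) \<ge> q + 1" unfolding eq' .
    then show ?thesis using two[of "Suc n"] weight_pos[OF EX(1), of "Suc (Suc n)"] by fastforce
  qed
  have straight: "E (Suc n) \<noteq> converse (E n)" if n: "n > b" for n
  proof
    assume eq: "E (Suc n) = converse (E n)"
    have all: "E (Suc (n + k)) = converse (E (n + k))" for k
      by (induction k) (use eq turn n in auto)
    have const: "stab_order (E (n + k)) = stab_order (E n)" for k
    proof (induction k)
      case (Suc k)
      then show ?case using all[of k] stab_order_converse[OF EX(1), of "n + k"] by simp
    qed simp
    define k where "k = stab_order (E n)"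
    have "2 ^ ((n - b) + k) \<le> card (stab (r (b + ((n - b) + k))))" by (rule stab_unbounded[OF rr trans])
    also have "\<dots> = stab_order (E (n + k))"
      using n stab_order_orb[OF raysD(1)[OF rr]] unfolding E_def by simp
    also have "\<dots> = k" unfolding const k_def ..
    also have "k < 2 ^ k" by (rule less_exp)
    also have "(2::nat) ^ k \<le> 2 ^ ((n - b) + k)" by (intro power_increasing) auto
    finally show False by simp
  qed
  have main: "wt (E (Suc n)) = 1 \<and> wt (converse (E n)) = q" if n: "n > b" for n
    using two[OF straight[OF n]] wC[of n] weight_pos[OF EX(1), of "Suc n"] n by simp
  \<comment> \<open>The weight of \<open>E n\<close> is determined at the turn before it, hence the additional step.\<close>
  have "wt (E n) = 1 \<and> wt (converse (E n)) = q \<and> E (Suc n) \<noteq> converse (E n)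
     \<and> stab_order (E (Suc n)) = q * stab_order (E n)" if n: "n \<ge> Suc (Suc b)" for n
  proof -
    obtain k where k: "n = Suc k" "k > b" using n by (cases n) auto
    have "wt (E (Suc n)) * stab_order (E (Suc n)) = wt (converse (E n)) * stab_order (converse (E n))"
      by (rule weight_stab_order[OF EX]) (simp only: tailE tailC)
    then show ?thesis using main[of n] main[OF k(2)] straight[of n] n stab_order_converse[OF EX(1), of n]
      unfolding k(1) by simp
  qed
  then show ?thesis by blast
qed

section \<open>The quotient as a finite graph with cusps attached\<close>

lemma out_arcs_two:
  assumes E: "E \<in> arcs X" and E': "E' \<in> arcs X" "tail X E' = head X E" "E' \<noteq> converse E"
    and wt: "wt E' + wt (converse E) = q + 1"
  shows "out_arcs X (head X E) = {E', converse E}"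
proof -
  obtain x where x: "x \<in> pverts Y" "head X E = orbit \<Gamma> \<phi> x" using head_rep[OF E] by blast
  have sub: "{E', converse E} \<subseteq> out_arcs X (head X E)" using E' converse_arc[OF E] by (simp add: tail_converse)
  have "out_arcs X (head X E) \<subseteq> {E', converse E}"
  proof
    fix G assume G: "G \<in> out_arcs X (head X E)"
    show "G \<in> {E', converse E}"
    proof (rule ccontr)
      assume "G \<notin> {E', converse E}"
      then have "wt G + (wt E' + wt (converse E)) = (\<Sum>H\<in>insert G {E', converse E}. wt H)" using E'(3) by simp
      also have "\<dots> \<le> (\<Sum>H\<in>out_arcs X (head X E). wt H)"
        using G sub by (intro sum_mono2 w_row_sum(1)[OF E]) auto
      also have "\<dots> = q + 1" unfolding x(2) by (rule weight_sum[OF x(1)])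
      finally show False using wt weight_pos[of G] G by simp
    qed
  qed
  then show ?thesis using sub by blast
qed

text \<open>The arcs that lead outwards far in a cusp carry an injective successor map, under which the order of
  the stabiliser is multiplied by \<open>q\<close>. Going backwards, the order decreases, so the arcs decompose into
  chains that start with an arc that is not a successor. There are finitely many chains, and unlike
  the images of the given rays, they cannot overlap.\<close>

lemma cusp_decomposition:
  assumes cusp: "cuspidal \<Gamma> Y \<phi>"
  obtains K :: "('v \<times> 'v) set set" and I :: "('v \<times> 'v) set set" and out inn
  where "cusped_weights w (real q) K I out inn"
proof -
  obtain F :: "('v set, ('v \<times> 'v) set) pre_digraph" and S where F: "fin_digraph F" and finS: "finite S"
    and S0: "\<forall>r\<in>S. \<exists>c. r \<in> c \<and> is_cusp \<Gamma> Y \<phi> c \<and> periodic_end Y c"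
    and arcsX: "arcs X = arcs F \<union> (\<Union>r\<in>S. \<Union>j. {orb (r j), converse (orb (r j))})"
    using cusp unfolding cuspidal_def by (elim exE conjE) (rule that, assumption+)
  have S: "\<forall>r\<in>S. \<exists>c. r \<in> c \<and> is_cusp \<Gamma> Y \<phi> c" using S0 by blast
  have finF: "finite (arcs F)" by (rule fin_digraph.finite_arcs[OF F])
  have ray: "r \<in> rays Y" if "r \<in> S" for r
    using S that boundary_class(2) unfolding is_cusp_def by blast
  have "\<forall>r\<in>S. \<exists>N. \<forall>n\<ge>N. wt (orb (r n)) = 1 \<and> wt (converse (orb (r n))) = q
     \<and> orb (r (Suc n)) \<noteq> converse (orb (r n)) \<and> stab_order (orb (r (Suc n))) = q * stab_order (orb (r n))"
    using S cusp_section_weights by blast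
  then obtain N where N: "\<And>r n. r \<in> S \<Longrightarrow> n \<ge> N r \<Longrightarrow> wt (orb (r n)) = 1 \<and> wt (converse (orb (r n))) = q
     \<and> orb (r (Suc n)) \<noteq> converse (orb (r n)) \<and> stab_order (orb (r (Suc n))) = q * stab_order (orb (r n))"
    by metis
  define D where "D = {orb (r n) | r n. r \<in> S \<and> n \<ge> N r}"
  have DX: "E \<in> arcs X" if "E \<in> D" for E using that unfolding D_def arcsX by blast
  have D_wt: "wt E = 1" "wt (converse E) = q" if "E \<in> D" for E
    using that N unfolding D_def by blast+
  define succ where "succ E E' \<longleftrightarrow> E' \<in> D \<and> E' \<noteq> converse E \<and> tail X E' = head X E \<and> stab_order E' = q * stab_order E" for E E'
  have succ_ray: "succ (orb (r n)) (orb (r (Suc n)))" if "r \<in> S" "n \<ge> N r" for r n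
  proof -
    have "tail X (orb (r (Suc n))) = head X (orb (r n))"
      unfolding tail_X head_X fst_orb snd_orb raysD(2)[OF ray[OF that(1)]] ..
    moreover have "orb (r (Suc n)) \<in> D" unfolding D_def using that le_SucI by blast
    ultimately show ?thesis using N[OF that] unfolding succ_def by simp
  qed
  define \<sigma> where "\<sigma> E = (SOME E'. succ E E')" for E
  have succ_\<sigma>: "succ E (\<sigma> E)" if "E \<in> D" for E
  proof -
    have "\<exists>E'. succ E E'" using that succ_ray unfolding D_def by blast
    then show ?thesis unfolding \<sigma>_def by (rule someI_ex)
  qed
  have \<sigma>D: "\<sigma> E \<in> D" and \<sigma>_ne: "\<sigma> E \<noteq> converse E" and \<sigma>_tail: "tail X (\<sigma> E) = head X E"
    and \<sigma>_stab: "stab_order (\<sigma> E) = q * stab_order E" if "E \<in> D" for E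
    using succ_\<sigma>[OF that] unfolding succ_def by auto
  have out_\<sigma>: "out_arcs X (head X E) = {\<sigma> E, converse E}" if "E \<in> D" for E
    by (rule out_arcs_two[OF DX[OF that] DX[OF \<sigma>D[OF that]] \<sigma>_tail[OF that] \<sigma>_ne[OF that]])
      (simp add: D_wt that \<sigma>D)
  have conv_inj: "converse E = converse E' \<Longrightarrow> E = E'" for E E' :: "('v \<times> 'v) set"
    by (metis converse_converse)
  have \<sigma>_unique: "E' = \<sigma> E" if "E \<in> D" "succ E E'" for E E'
    using out_\<sigma>[OF that(1)] that(2) DX unfolding succ_def by auto
  have \<sigma>_inj: "E = E'" if "E \<in> D" "E' \<in> D" "\<sigma> E = \<sigma> E'" for E E'
  proof -
    have head: "head X E = head X E'" using \<sigma>_tail that by metis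
    have "converse E' \<in> out_arcs X (head X E')" unfolding out_\<sigma>[OF that(2)] by blast
    then have "converse E' \<in> {\<sigma> E, converse E}" unfolding head[symmetric] out_\<sigma>[OF that(1)] .
    moreover have "converse E' \<noteq> \<sigma> E" using \<sigma>_ne[OF that(2)] that(3) by metis
    ultimately show ?thesis using conv_inj by blast
  qed
  define I where "I = D - \<sigma> ` D"
  define out where "out a j = (\<sigma> ^^ j) a" for a and j :: nat
  define inn where "inn a j = converse (out a j)" for a j
  define K where "K = arcs X - D - converse ` D"
  have out_Suc: "out a (Suc j) = \<sigma> (out a j)" for a j unfolding out_def by simp
  have outD: "out a j \<in> D" if "a \<in> I" for a j
    by (induction j) (use that \<sigma>D in \<open>auto simp: out_Suc\<close>, simp add: out_def I_def)
  have chain: "\<exists>a\<in>I. \<exists>j. E = out a j" if "E \<in> D" for E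
    using that
  proof (induction "stab_order E" arbitrary: E rule: less_induct)
    case less
    show ?case
    proof (cases "E \<in> \<sigma> ` D")
      case True
      then obtain G where G: "G \<in> D" "E = \<sigma> G" by blast
      have "stab_order G < stab_order E"
        using \<sigma>_stab[OF G(1)] stab_order_pos[OF DX[OF G(1)]] q_ge_2 unfolding G(2) by simp
      then obtain a j where "a \<in> I" "G = out a j" using less.hyps G(1) by blast
      then show ?thesis using G(2) out_Suc by metis
    next
      case False
      then have "E \<in> I" "E = out E 0" using less.prems unfolding I_def out_def by auto
      then show ?thesis by blast
    qed
  qed
  have out_inj: "a = b \<and> i = j" if "a \<in> I" "b \<in> I" "out a i = out b j" for a b i j
    using that
  proof (induction i arbitrary: j)
    case 0
    show ?case
    proof (cases j)
      case (Suc j')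
      then have "a \<in> \<sigma> ` D" using 0 outD[OF 0(2)] out_Suc unfolding out_def[of a 0] by auto
      then show ?thesis using 0(1) unfolding I_def by blast
    qed (use 0 in \<open>simp add: out_def\<close>)
  next
    case (Suc i)
    show ?case
    proof (cases j)
      case 0
      then have "b \<in> \<sigma> ` D" using Suc.prems outD[OF Suc.prems(1)] out_Suc[of a i] unfolding out_def[of b 0]
        by (metis "0" funpow_0 image_eqI out_def)
      then show ?thesis using Suc.prems(2) unfolding I_def by blast
    next
      case (Suc j')
      then have "out a i = out b j'"
        using \<sigma>_inj[OF outD[OF Suc.prems(1)] outD[OF Suc.prems(2)]] Suc.prems(3) out_Suc by metis
      then show ?thesis using Suc.IH[OF Suc.prems(1,2)] Suc by blast
    qed
  qed
  have finI: "finite I"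
  proof (rule finite_subset)
    show "I \<subseteq> (\<lambda>r. orb (r (N r))) ` S"
    proof
      fix E assume E: "E \<in> I"
      then obtain r n where rn: "r \<in> S" "n \<ge> N r" "E = orb (r n)" unfolding I_def D_def by blast
      have "n = N r"
      proof (rule ccontr)
        assume "n \<noteq> N r"
        then obtain k where k: "n = Suc k" "k \<ge> N r" using rn(2) by (cases n) auto
        have "orb (r k) \<in> D" unfolding D_def using rn(1) k(2) by blast
        then have "E \<in> \<sigma> ` D" using \<sigma>_unique[OF _ succ_ray[OF rn(1) k(2)]] rn(3) unfolding k(1) by blast
        then show False using E unfolding I_def by blast
      qed
      then show "E \<in> (\<lambda>r. orb (r (N r))) ` S" using rn by blast
    qed
  qed (use finS in simp)
  have finK: "finite K"
  proof (rule finite_subset)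
    show "K \<subseteq> arcs F \<union> (\<Union>r\<in>S. \<Union>j<N r. {orb (r j), converse (orb (r j))})"
    proof
      fix E assume E: "E \<in> K"
      show "E \<in> arcs F \<union> (\<Union>r\<in>S. \<Union>j<N r. {orb (r j), converse (orb (r j))})"
      proof (cases "E \<in> arcs F")
        case False
        then obtain r j where rj: "r \<in> S" "E = orb (r j) \<or> E = converse (orb (r j))"
          using E unfolding K_def arcsX by blast
        have "j < N r"
        proof (rule ccontr)
          assume "\<not> j < N r"
          then have "N r \<le> j" by simp
          then have "orb (r j) \<in> D" unfolding D_def using rj(1) by blast
          then show False using E rj(2) unfolding K_def by blast
        qed
        then show ?thesis using rj by blast
      qed simp
    qed
    show "finite (arcs F \<union> (\<Union>r\<in>S. \<Union>j<N r. {orb (r j), converse (orb (r j))}))" using finF finS by simp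
  qed
  have innX: "inn a j \<in> arcs X" if "a \<in> I" for a j
    unfolding inn_def by (rule converse_arc[OF DX[OF outD[OF that]]])
  have states: "cusped_states K I out inn = arcs X"
  proof (intro equalityI subsetI)
    fix E assume "E \<in> cusped_states K I out inn"
    then show "E \<in> arcs X" using DX outD innX unfolding cusped_states_def K_def by blast
  next
    fix E assume E: "E \<in> arcs X"
    consider "E \<in> D" | E' where "E' \<in> D" "E = converse E'" | "E \<in> K" using E unfolding K_def by blast
    then show "E \<in> cusped_states K I out inn"
    proof cases
      case 1
      then show ?thesis using chain unfolding cusped_states_def by blast
    next
      case 2
      then show ?thesis using chain[OF 2(1)] unfolding cusped_states_def inn_def by blast
    next
      case 3
      then show ?thesis unfolding cusped_states_def by blast
    qed
  qed
  have w_out: "w E y = (if y = \<sigma> E then 1 else if y = converse E then real q - 1 else 0)" if E: "E \<in> D" for E y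
  proof -
    have "w E (\<sigma> E) = 1" using DX[OF E] DX[OF \<sigma>D[OF E]] \<sigma>_tail[OF E] \<sigma>_ne[OF E] D_wt(1)[OF \<sigma>D[OF E]]
      unfolding w_def trans_weight_def by simp
    moreover have "w E (converse E) = real q - 1"
      using DX[OF E] converse_arc[OF DX[OF E]] D_wt(2)[OF E] unfolding w_def trans_weight_def by (simp add: tail_converse)
    moreover have "w E y = 0" if "y \<noteq> \<sigma> E" "y \<noteq> converse E"
      using w_support[of E y] out_\<sigma>[OF E] that by blast
    ultimately show ?thesis by auto
  qed
  have w_inn: "w (converse (\<sigma> G)) y = (if y = converse G then real q else 0)" if G: "G \<in> D" for G y
  proof -
    have arcs: "converse (\<sigma> G) \<in> arcs X" "\<sigma> G \<in> arcs X" "converse G \<in> arcs X"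
      using DX[OF G] DX[OF \<sigma>D[OF G]] converse_arc by auto
    have head: "head X (converse (\<sigma> G)) = head X G" unfolding head_converse by (rule \<sigma>_tail[OF G])
    have "w (converse (\<sigma> G)) (\<sigma> G) = 0"
      using arcs head \<sigma>_tail[OF G] D_wt(1)[OF \<sigma>D[OF G]] unfolding w_def trans_weight_def by simp
    moreover have "w (converse (\<sigma> G)) (converse G) = real q"
    proof -
      have "converse G \<noteq> converse (converse (\<sigma> G))" using \<sigma>_ne[OF G] by simp
      then show ?thesis using arcs head D_wt(2)[OF G] unfolding w_def trans_weight_def by (simp add: tail_converse)
    qed
    moreover have "w (converse (\<sigma> G)) y = 0" if "y \<noteq> \<sigma> G" "y \<noteq> converse G"
      using w_support[of "converse (\<sigma> G)" y] out_\<sigma>[OF G] that unfolding head by blast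
    ultimately show ?thesis by auto
  qed
  have "cusped_weights w (real q) K I out inn"
  proof
    show "1 < real q" using q_ge_2 by simp
    show "finite K" "finite I" by fact+
    show "cusped_states K I out inn \<noteq> {}" unfolding states by (rule arcs_X_nonempty)
    show "a = b \<and> i = j" if "a \<in> I" "b \<in> I" "out a i = out b j" for a b i j by (rule out_inj[OF that])
    show "a = b \<and> i = j" if "a \<in> I" "b \<in> I" "inn a i = inn b j" for a b i j
      by (rule out_inj[OF that(1,2) conv_inj[OF that(3)[unfolded inn_def]]])
    show "out a i \<noteq> inn b j" if "a \<in> I" "b \<in> I" for a b i j
      using D_wt(1)[OF outD[OF that(1)], of i] D_wt(2)[OF outD[OF that(2)], of j] q_ge_2
      unfolding inn_def by auto
    show "out a i \<notin> K" "inn a i \<notin> K" if "a \<in> I" for a i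
      using outD[OF that, of i] unfolding K_def inn_def by auto
    show "0 \<le> w x y" for x y by (rule w_nonneg)
    show "w x y \<noteq> 0 \<Longrightarrow> x \<in> cusped_states K I out inn \<and> y \<in> cusped_states K I out inn" for x y
      unfolding states using w_support by blast
    show "w (out a i) y = (if y = out a (Suc i) then 1 else if y = inn a i then real q - 1 else 0)" if "a \<in> I" for a i y
      unfolding out_Suc inn_def by (rule w_out[OF outD[OF that]])
    show "w (inn a (Suc i)) y = (if y = inn a i then real q else 0)" if "a \<in> I" for a i y
      unfolding inn_def out_Suc by (rule w_inn[OF outD[OF that]])
    show "x = out a i" if a: "a \<in> I" and nz: "w x (out a (Suc i)) \<noteq> 0" for a i x
    proof -
      let ?G = "out a i"
      have G: "?G \<in> D" by (rule outD[OF a])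
      have s: "x \<in> arcs X" "head X x = head X ?G"
        using w_support[OF nz] \<sigma>_tail[OF G] unfolding out_Suc by auto
      then have "converse x \<in> {\<sigma> ?G, converse ?G}" using converse_arc unfolding out_\<sigma>[OF G, symmetric] by (simp add: tail_converse)
      moreover have "converse x \<noteq> \<sigma> ?G"
      proof
        assume "converse x = \<sigma> ?G"
        then have x: "x = converse (\<sigma> ?G)" by (metis converse_converse)
        have "\<sigma> ?G \<noteq> converse ?G" by (rule \<sigma>_ne[OF G])
        then have "w (converse (\<sigma> ?G)) (\<sigma> ?G) = 0" unfolding w_inn[OF G] by simp
        then show False using nz unfolding x out_Suc by simp
      qed
      ultimately show ?thesis using conv_inj by blast
    qed
    show "x = out a (Suc i) \<or> x = inn a (Suc (Suc i))" if a: "a \<in> I" and nz: "w x (inn a (Suc i)) \<noteq> 0" for a i x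
    proof -
      let ?G = "out a (Suc i)"
      have G: "?G \<in> D" by (rule outD[OF a])
      have s: "x \<in> arcs X" "head X x = head X ?G"
        using w_support[OF nz] unfolding inn_def by (auto simp: tail_converse)
      then have "converse x \<in> {\<sigma> ?G, converse ?G}" using converse_arc unfolding out_\<sigma>[OF G, symmetric] by (simp add: tail_converse)
      then show ?thesis unfolding inn_def out_Suc[of a "Suc i"] by (metis conv_inj converse_converse insertE singletonD)
    qed
    show "(\<Sum>y | w x y \<noteq> 0. w x y) = real q" if "x \<in> K \<union> (\<lambda>a. inn a 0) ` I" for x
    proof -
      have x: "x \<in> arcs X" using that innX unfolding K_def by blast
      have "(\<Sum>y | w x y \<noteq> 0. w x y) = (\<Sum>y\<in>out_arcs X (head X x). w x y)"
        using w_support by (intro sum.mono_neutral_left w_row_sum(1)[OF x]) blast+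
      then show ?thesis using w_row_sum(2)[OF x] by simp
    qed
    show "(x, y) \<in> {(x, y). 0 < w x y}\<^sup>*" if "x \<in> cusped_states K I out inn" "y \<in> cusped_states K I out inn" for x y
      using that unfolding states by (rule irreducible_X)
  qed
  then show thesis by (rule that)
qed

section \<open>The operator T\<close>

lemma lookup_T: 
  assumes E: "E \<in> arcs X"
  shows "Poly_Mapping.lookup (T_op \<Gamma> Y \<phi> (Poly_Mapping.single E 1)) E' = of_real (w E E')"
proof -
  have id: "Poly_Mapping.map ((*) 1) p = p" for p :: "('v \<times> 'v) set \<Rightarrow>\<^sub>0 complex"
    by (rule poly_mapping_eqI) (simp add: Poly_Mapping.map.rep_eq when_def)
  have "T_op \<Gamma> Y \<phi> (Poly_Mapping.single E 1) = T_edge \<Gamma> Y \<phi> E"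
    unfolding T_op_def by (simp add: id)
  then have "Poly_Mapping.lookup (T_op \<Gamma> Y \<phi> (Poly_Mapping.single E 1)) E' =
      (\<Sum>E''\<in>out_arcs X (head X E). if E'' = E' then of_int (trans_weight \<Gamma> \<phi> E E') else 0)"
    unfolding T_edge_def by (auto simp: lookup_sum lookup_single when_def intro!: sum.cong)
  also have "\<dots> = of_real (w E E')"
    using w_row_sum(1)[OF E] E by (auto simp: w_def)
  finally show ?thesis .
qed

lemma T_matrix_nonneg: "E \<in> arcs X \<Longrightarrow> T_matrix \<Gamma> Y \<phi> E' E \<in> \<real>\<^sub>\<ge>\<^sub>0"
  unfolding T_matrix_def by (simp add: lookup_T w_nonneg)

lemma T_connected_X: "T_connected \<Gamma> Y \<phi>"
proof -
  have "stable M" if M: "T_stable \<Gamma> Y \<phi> M" for M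
    unfolding stable_def
  proof (intro conjI ballI allI impI)
    show "M \<subseteq> arcs X" using M unfolding T_stable_def by blast
    fix E E' assume E: "E \<in> M" "0 < w E E'"
    then have "E' \<in> Poly_Mapping.keys (T_op \<Gamma> Y \<phi> (Poly_Mapping.single E 1))"
      using \<open>M \<subseteq> arcs X\<close> by (auto simp: in_keys_iff lookup_T)
    then show "E' \<in> M" using M E(1) unfolding T_stable_def by blast
  qed
  then show ?thesis unfolding T_connected_def
    by (intro allI impI, elim conjE) (rule stable_partition_trivial)
qed

section \<open>The zeta function of a cuspidal tree lattice\<close>

lemma path_weight_cyclic:
  assumes "closed_path X p"
  shows "of_int (path_weight \<Gamma> \<phi> p) = cyclic_weight w p"
proof -
  have "trans_weight \<Gamma> \<phi> (p ! j) (p ! (Suc j mod length p)) = w (p ! j) (p ! (Suc j mod length p))"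
    if "j < length p" for j
  proof -
    have "Suc j mod length p < length p" using that by (cases p) auto
    then have "p ! j \<in> arcs X" "p ! (Suc j mod length p) \<in> arcs X"
      using assms that unfolding closed_path_iff by (meson nth_mem subsetD)+
    then show ?thesis using assms that unfolding closed_path_iff w_def by simp
  qed
  then show ?thesis unfolding path_weight_def cyclic_weight_def by (simp add: of_int_prod)
qed

lemma closed_path_weight_bounds:
  assumes "closed_path X p"
  shows "path_weight \<Gamma> \<phi> p \<ge> 0" "path_weight \<Gamma> \<phi> p \<le> real q ^ length p"
proof -
  have "0 \<le> cyclic_weight w p" unfolding cyclic_weight_def by (intro prod_nonneg w_nonneg ballI)
  then show "path_weight \<Gamma> \<phi> p \<ge> 0" using path_weight_cyclic[OF assms] by linarith
  have "cyclic_weight w p \<le> (\<Prod>j<length p. real q)" unfolding cyclic_weight_def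
    by (intro prod_mono conjI w_nonneg w_le_q)
  then show "path_weight \<Gamma> \<phi> p \<le> real q ^ length p" using path_weight_cyclic[OF assms] by simp
qed

lemma closed_walks_closed_paths:
  assumes m: "m > 0"
  shows "closed_walks w m = {p. closed_path X p \<and> length p = m \<and> path_weight \<Gamma> \<phi> p \<noteq> 0}"
proof (intro equalityI subsetI)
  fix p assume "p \<in> closed_walks w m"
  then have p: "length p = m" "cyclic_weight w p \<noteq> 0" unfolding closed_walks_def by auto
  then have nz: "w (p ! j) (p ! (Suc j mod length p)) \<noteq> 0" if "j < length p" for j
    using that unfolding cyclic_weight_def by (simp add: prod_zero_iff)
  have "closed_path X p" unfolding closed_path_iff
  proof (intro conjI allI impI subsetI)
    show "p \<noteq> []" using p(1) m by auto
    show "E \<in> arcs X" if "E \<in> set p" for E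
      using that nz w_support by (metis in_set_conv_nth)
    show "head X (p ! i) = tail X (p ! (Suc i mod length p))" if "i < length p" for i
      using w_support[OF nz[OF that]] by simp
  qed
  then show "p \<in> {p. closed_path X p \<and> length p = m \<and> path_weight \<Gamma> \<phi> p \<noteq> 0}"
    using p path_weight_cyclic[of p] by auto
next
  fix p assume "p \<in> {p. closed_path X p \<and> length p = m \<and> path_weight \<Gamma> \<phi> p \<noteq> 0}"
  then have p: "closed_path X p" "length p = m" "path_weight \<Gamma> \<phi> p \<noteq> 0" by auto
  then show "p \<in> closed_walks w m" using path_weight_cyclic[OF p(1)] unfolding closed_walks_def by force
qed

definition cusp_roots :: "nat \<Rightarrow> complex multiset" where
  "cusp_roots s = replicate_mset s (of_real (sqrt q)) + replicate_mset s (- of_real (sqrt q))"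

lemma cusp_roots_power_sum:
  "(\<Sum>b\<in>#cusp_roots s. b ^ m) = of_real (if even m then 2 * real s * real q ^ (m div 2) else 0)"
proof -
  have rep: "(\<Sum>b\<in>#replicate_mset s c. b ^ m) = of_nat s * c ^ m" for c :: complex
    by (induction s) (auto simp: algebra_simps)
  have "complex_of_real (sqrt q) ^ m = of_real (real q ^ (m div 2))" if ev: "even m"
  proof -
    obtain k where k: "m = 2 * k" using ev by (rule evenE)
    have "sqrt (real q) ^ m = (sqrt (real q) ^ 2) ^ k" unfolding k by (rule power_mult)
    then have "sqrt (real q) ^ m = real q ^ (m div 2)" using k by simp
    then show ?thesis by (metis of_real_power)
  qed
  then show ?thesis unfolding cusp_roots_def by (simp add: rep algebra_simps)
qed

lemma cusp_roots_norm: "b \<in># cusp_roots s \<Longrightarrow> cmod b = sqrt q"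
  unfolding cusp_roots_def by (auto split: if_splits)

lemma sqrt_q_less: "sqrt (real q) < real q"
proof -
  have "real q < real q ^ 2" using q_ge_2 by (simp add: power2_eq_square)
  then show ?thesis by (intro real_less_lsqrt) auto
qed

text \<open>The eigenvalues of the folded matrix describe the zeta function only up to the factors of the loops,
  which are the \<open>1 \<plusminus> \<surd>q u\<close>.\<close>

lemma zeta_main:
  assumes cusp: "cuspidal \<Gamma> Y \<phi>"
  obtains \<Lambda> :: "complex multiset" and s h :: nat and L \<rho> :: real
  where "\<forall>\<^sub>F u in nhds 0. zeta \<Gamma> Y \<phi> u = (\<Prod>b\<in>#cusp_roots s. 1 - b * u) / (\<Prod>a\<in>#\<Lambda>. 1 - a * u)"
    "\<forall>a. a \<in># \<Lambda> \<longrightarrow> cmod a \<le> q" "of_nat q \<in># \<Lambda>" "h > 0" "0 < \<rho>" "\<rho> < 1"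
    "\<forall>m. cmod ((\<Sum>a\<in>#\<Lambda>. a ^ m) - (if h dvd m then of_nat h * of_nat q ^ m else 0)) \<le> L * (\<rho> * q) ^ m"
proof -
  obtain K I :: "('v \<times> 'v) set set" and out inn where cw: "cusped_weights w (real q) K I out inn"
    using cusp_decomposition[OF cusp] by blast
  define U where "U = cusped_weights.folded_states K I out inn"
  define f where "f = cusped_weights.folded w (real q) K I out inn"
  have irr: "irreducible_row_constant U f (real q)"
    unfolding U_def f_def by (rule cusped_weights.irreducible_folded[OF cw])
  obtain \<Lambda> :: "complex multiset" where \<Lambda>:
    "\<And>m. of_real (\<Sum>x\<in>U. walk_sum f m x x) = (\<Sum>e\<in>#\<Lambda>. e ^ m)"
    "\<And>e. e \<in># \<Lambda> \<Longrightarrow> cmod e \<le> real q" "of_real (real q) \<in># \<Lambda>"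
    using irreducible_row_constant.trace_eigenvalues[OF irr] by blast
  obtain h L \<rho> where h: "h > 0" "0 < \<rho>" "\<rho> < 1"
    "\<And>m. \<bar>(\<Sum>x\<in>U. walk_sum f m x x) - (if h dvd m then real h * real q ^ m else 0)\<bar> \<le> L * (\<rho> * real q) ^ m"
    using irreducible_row_constant.trace_asymptotics[OF irr] by blast
  define s where "s = card I"
  have count: "of_int (\<Sum>p\<in>{p. closed_path X p \<and> length p = m \<and> path_weight \<Gamma> \<phi> p \<noteq> 0}. path_weight \<Gamma> \<phi> p) =
      (\<Sum>a\<in>#\<Lambda>. a ^ m) - (\<Sum>b\<in>#cusp_roots s. b ^ m)" if m: "m > 0" for m
  proof -
    let ?P = "{p. closed_path X p \<and> length p = m \<and> path_weight \<Gamma> \<phi> p \<noteq> 0}"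
    have "real_of_int (\<Sum>p\<in>?P. path_weight \<Gamma> \<phi> p) = (\<Sum>p\<in>closed_walks w m. cyclic_weight w p)"
      unfolding closed_walks_closed_paths[OF m] of_int_sum by (intro sum.cong) (auto simp: path_weight_cyclic)
    also have "\<dots> = (\<Sum>x\<in>U. walk_sum f m x x) - (if even m then 2 * real (card I) * real q ^ (m div 2) else 0)"
      unfolding U_def f_def by (rule cusped_weights.closed_walks_count(2)[OF cw m])
    finally have "complex_of_real (real_of_int (\<Sum>p\<in>?P. path_weight \<Gamma> \<phi> p)) =
      of_real (\<Sum>x\<in>U. walk_sum f m x x) - of_real (if even m then 2 * real (card I) * real q ^ (m div 2) else 0)"
      by (simp only: of_real_diff)
    then show ?thesis unfolding \<Lambda>(1) cusp_roots_power_sum s_def by (simp only: of_real_of_int_eq)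
  qed
  have zeta: "zeta \<Gamma> Y \<phi> u = (\<Prod>b\<in>#cusp_roots s. 1 - b * u) / (\<Prod>a\<in>#\<Lambda>. 1 - a * u)" if u: "cmod u * real q < 1" for u
  proof (rule zeta_rational[where q = "real q"])
    show "finite {p. closed_path X p \<and> length p = m \<and> path_weight \<Gamma> \<phi> p \<noteq> 0}" if "m > 0" for m
      unfolding closed_walks_closed_paths[OF that, symmetric] by (rule cusped_weights.closed_walks_count(1)[OF cw that])
    show "cmod a \<le> real q" if "a \<in># \<Lambda> + cusp_roots s" for a
      using that \<Lambda>(2) cusp_roots_norm sqrt_q_less by fastforce
    show "0 < real q" using q_ge_2 by simp
  qed (use closed_path_weight_bounds count u in auto)
  have "\<forall>\<^sub>F u in nhds 0. cmod u * real q < 1"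
    using eventually_small[of "{#of_nat q#}"] by (simp add: norm_mult mult.commute)
  then have "\<forall>\<^sub>F u in nhds 0. zeta \<Gamma> Y \<phi> u = (\<Prod>b\<in>#cusp_roots s. 1 - b * u) / (\<Prod>a\<in>#\<Lambda>. 1 - a * u)"
    by eventually_elim (rule zeta)
  moreover have "cmod ((\<Sum>a\<in>#\<Lambda>. a ^ m) - (if h dvd m then of_nat h * of_nat q ^ m else 0)) \<le> L * (\<rho> * q) ^ m" for m
  proof -
    have "(\<Sum>a\<in>#\<Lambda>. a ^ m) - (if h dvd m then of_nat h * of_nat q ^ m else 0) =
      of_real ((\<Sum>x\<in>U. walk_sum f m x x) - (if h dvd m then real h * real q ^ m else 0))"
      unfolding \<Lambda>(1)[symmetric] by simp
    then show ?thesis using h(4)[of m] by (simp only: norm_of_real)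
  qed
  ultimately show thesis using that[of s \<Lambda> h \<rho> L] \<Lambda>(2,3) h by simp
qed

text \<open>The eigenvalue \<open>q\<close> of the folded matrix is the largest one and it is not cancelled, because the
  numbers \<open>b\<^sub>k\<close> have modulus \<open>\<surd>q < q\<close>. By uniqueness the reduced factorisation obtained from the
  folded matrix is the only one.\<close>

lemma zeta_factorization_max:
  assumes cusp: "cuspidal \<Gamma> Y \<phi>"
  shows "\<exists>A B. zeta_factorization \<Gamma> Y \<phi> A B"
    "zeta_factorization \<Gamma> Y \<phi> A B \<Longrightarrow> A \<noteq> {#} \<and> Max (cmod ` set_mset A) = real q"
proof -
  obtain \<Lambda> :: "complex multiset" and s h :: nat and L \<rho> :: real where main:
    "\<forall>\<^sub>F u in nhds 0. zeta \<Gamma> Y \<phi> u = (\<Prod>b\<in>#cusp_roots s. 1 - b * u) / (\<Prod>a\<in>#\<Lambda>. 1 - a * u)"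
    "\<forall>a. a \<in># \<Lambda> \<longrightarrow> cmod a \<le> q" "of_nat q \<in># \<Lambda>" "h > 0" "0 < \<rho>" "\<rho> < 1"
    "\<forall>m. cmod ((\<Sum>a\<in>#\<Lambda>. a ^ m) - (if h dvd m then of_nat h * of_nat q ^ m else 0)) \<le> L * (\<rho> * q) ^ m"
    by (rule zeta_main[OF cusp]) (rule that, assumption+)
  define A1 where "A1 = filter_mset (\<lambda>a. a \<noteq> 0) \<Lambda>"
  define B1 where "B1 = filter_mset (\<lambda>a. a \<noteq> 0) (cusp_roots s)"
  define A0 where "A0 = A1 - A1 \<inter># B1"
  define B0 where "B0 = B1 - A1 \<inter># B1"
  have ev0: "\<forall>\<^sub>F u in nhds 0. zeta \<Gamma> Y \<phi> u = (\<Prod>b\<in>#B0. 1 - b * u) / (\<Prod>a\<in>#A0. 1 - a * u)"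
    using reduce_factorization[OF main(1)] unfolding A0_def B0_def A1_def B1_def .
  have zero: "0 \<notin># A0" "0 \<notin># B0"
    unfolding A0_def B0_def A1_def B1_def by (auto dest: in_diffD)
  have disj: "A0 \<inter># B0 = {#}"
    unfolding A0_def B0_def by (intro multiset_eqI) (auto simp: min_def)
  have fac: "zeta_factorization \<Gamma> Y \<phi> A0 B0" unfolding zeta_factorization_def using zero disj ev0 by blast
  then show "\<exists>A B. zeta_factorization \<Gamma> Y \<phi> A B" by blast
  assume AB: "zeta_factorization \<Gamma> Y \<phi> A B"
  have AB': "0 \<notin># A" "0 \<notin># B" "A \<inter># B = {#}"
    "\<forall>\<^sub>F u in nhds 0. zeta \<Gamma> Y \<phi> u = (\<Prod>b\<in>#B. 1 - b * u) / (\<Prod>a\<in>#A. 1 - a * u)"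
    using AB unfolding zeta_factorization_def by blast+
  have A: "A = A0"
    by (rule reduced_factorization_unique[OF AB'(1,2) zero AB'(3) disj AB'(4) ev0])
  have le: "cmod a \<le> real q" if "a \<in># A0" for a
    using that main(2) unfolding A0_def A1_def by (auto dest: in_diffD)
  have "of_nat q \<notin># cusp_roots s"
  proof
    assume "of_nat q \<in># cusp_roots s"
    then have "cmod (of_nat q) = sqrt q" by (rule cusp_roots_norm)
    then show False using sqrt_q_less by simp
  qed
  then have "count B1 (of_nat q) = 0" unfolding B1_def by (simp add: not_in_iff)
  moreover have "count A1 (of_nat q) > 0" unfolding A1_def using main(3) q_ge_2 by simp
  ultimately have "count A0 (of_nat q) > 0" unfolding A0_def by simp
  then have qA: "of_nat q \<in># A0" by simp
  have "Max (cmod ` set_mset A0) = real q"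
  proof (rule Max_eqI)
    show "real q \<in> cmod ` set_mset A0" using qA by (intro image_eqI[of _ _ "of_nat q"]) auto
  qed (use le in auto)
  then show "A \<noteq> {#} \<and> Max (cmod ` set_mset A) = real q" using qA unfolding A by auto
qed

text \<open>The number \<open>\<Delta>\<close> is the period of the folded matrix. The contribution \<open>2 s q\<^sup>m\<^sup>/\<^sup>2\<close> of the cusps is
  absorbed by the error term, whose rate is the larger one of \<open>\<surd>q\<close> and the rate of convergence of
  the traces.\<close>

lemma prime_geodesic_theorem:
  assumes cusp: "cuspidal \<Gamma> Y \<phi>"
  shows "\<exists>\<Delta>>0. \<exists>\<epsilon>>0. \<epsilon> < real q \<and>
     (\<lambda>m. N_coeff \<Gamma> Y \<phi> m - of_nat \<Delta> * indicator {n. \<Delta> dvd n} m * of_nat q ^ m)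
       \<in> O(\<lambda>m. of_real ((real q - \<epsilon>) ^ m))"
proof -
  obtain \<Lambda> :: "complex multiset" and s h :: nat and L \<rho> :: real where main:
    "\<forall>\<^sub>F u in nhds 0. zeta \<Gamma> Y \<phi> u = (\<Prod>b\<in>#cusp_roots s. 1 - b * u) / (\<Prod>a\<in>#\<Lambda>. 1 - a * u)"
    "\<forall>a. a \<in># \<Lambda> \<longrightarrow> cmod a \<le> q" "of_nat q \<in># \<Lambda>" "h > 0" "0 < \<rho>" "\<rho> < 1"
    "\<forall>m. cmod ((\<Sum>a\<in>#\<Lambda>. a ^ m) - (if h dvd m then of_nat h * of_nat q ^ m else 0)) \<le> L * (\<rho> * q) ^ m"
    by (rule zeta_main[OF cusp]) (rule that, assumption+)
  define R where "R = max (\<rho> * q) (sqrt q)"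
  have q0: "real q > 0" using q_ge_2 by simp
  have R: "0 < R" "R < q" unfolding R_def using sqrt_q_less main(6) q0 by (auto simp: less_max_iff_disj)
  have L0: "L \<ge> 0"
  proof -
    have "0 \<le> L * (\<rho> * q) ^ 0" using main(7)[rule_format, of 0] norm_ge_zero order_trans by blast
    then show ?thesis by simp
  qed
  have bound: "cmod (N_coeff \<Gamma> Y \<phi> m - of_nat h * indicator {n. h dvd n} m * of_nat q ^ m) \<le> (L + 2 * real s) * R ^ m"
    if m: "m > 0" for m
  proof -
    have N: "N_coeff \<Gamma> Y \<phi> m = (\<Sum>a\<in>#\<Lambda>. a ^ m) - (\<Sum>b\<in>#cusp_roots s. b ^ m)"
      unfolding N_coeff_def by (rule log_derivative_coefficients[OF main(1) m])
    have "N_coeff \<Gamma> Y \<phi> m - of_nat h * indicator {n. h dvd n} m * of_nat q ^ m =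
      ((\<Sum>a\<in>#\<Lambda>. a ^ m) - (if h dvd m then of_nat h * of_nat q ^ m else 0)) - (\<Sum>b\<in>#cusp_roots s. b ^ m)"
      unfolding N by (simp add: indicator_def)
    then have "cmod (N_coeff \<Gamma> Y \<phi> m - of_nat h * indicator {n. h dvd n} m * of_nat q ^ m) \<le>
      cmod ((\<Sum>a\<in>#\<Lambda>. a ^ m) - (if h dvd m then of_nat h * of_nat q ^ m else 0)) + cmod (\<Sum>b\<in>#cusp_roots s. b ^ m)"
      by (simp only: norm_triangle_ineq4)
    also have "\<dots> \<le> L * (\<rho> * q) ^ m + cmod (\<Sum>b\<in>#cusp_roots s. b ^ m)"
      by (intro add_right_mono main(7)[rule_format])
    also have "L * (\<rho> * q) ^ m \<le> L * R ^ m"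
      using L0 main(5) q0 unfolding R_def by (intro mult_left_mono power_mono) auto
    also have "cmod (\<Sum>b\<in>#cusp_roots s. b ^ m) \<le> 2 * real s * R ^ m"
    proof (cases "even m")
      case True
      then obtain k where k: "m = 2 * k" by (rule evenE)
      have "real q ^ k = sqrt q ^ m" unfolding k power_mult by simp
      also have "\<dots> \<le> R ^ m" unfolding R_def by (intro power_mono) auto
      finally have "2 * real s * real q ^ k \<le> 2 * real s * R ^ m" by (intro mult_left_mono) auto
      moreover have "cmod (\<Sum>b\<in>#cusp_roots s. b ^ m) = 2 * real s * real q ^ k"
        unfolding cusp_roots_power_sum norm_of_real using k by simp
      ultimately show ?thesis by simp
    next
      case False
      then show ?thesis unfolding cusp_roots_power_sum using R by simp
    qed
    finally show ?thesis by (simp add: algebra_simps)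
  qed
  have "(\<lambda>m. N_coeff \<Gamma> Y \<phi> m - of_nat h * indicator {n. h dvd n} m * of_nat q ^ m)
       \<in> O(\<lambda>m. of_real ((real q - (real q - R)) ^ m))"
  proof (rule bigoI)
    show "\<forall>\<^sub>F m in sequentially. norm (N_coeff \<Gamma> Y \<phi> m - of_nat h * indicator {n. h dvd n} m * of_nat q ^ m)
        \<le> (L + 2 * real s) * norm (complex_of_real ((real q - (real q - R)) ^ m))"
      using eventually_gt_at_top[of 0]
    proof eventually_elim
      case (elim m)
      have "norm (complex_of_real ((real q - (real q - R)) ^ m)) = R ^ m"
        unfolding norm_of_real using R(1) by simp
      then show ?case using bound[OF elim] by (simp only:)
    qed
  qed
  then show ?thesis using main(4) R by (intro exI[of _ h] conjI exI[of _ "real q - R"]) auto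
qed

end

theorem theorem8p1:
  fixes \<Gamma> :: "('g, 'm) monoid_scheme"
    and Y :: "'v pair_pre_digraph"
    and \<phi> :: "'g \<Rightarrow> 'v \<Rightarrow> 'v"
    and q :: nat
  assumes "2 \<le> q"
    and "regular (q + 1) Y"
    and "uniform Y"
    and "tree_lattice \<Gamma> Y \<phi>"
    and "orientation_preserving \<Gamma> Y \<phi>"
    and "cuspidal \<Gamma> Y \<phi>"
  shows
    "(fin_digraph (quotient_graph \<Gamma> Y \<phi>) \<longrightarrow>
        (\<forall>E\<in>arcs (quotient_graph \<Gamma> Y \<phi>). \<forall>E'\<in>arcs (quotient_graph \<Gamma> Y \<phi>).
           T_matrix \<Gamma> Y \<phi> E' E \<in> \<real>\<^sub>\<ge>\<^sub>0) \<and>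
        T_connected \<Gamma> Y \<phi>) \<and>
     ((\<exists>A B. zeta_factorization \<Gamma> Y \<phi> A B) \<and>
      (\<forall>A B. zeta_factorization \<Gamma> Y \<phi> A B \<longrightarrow>
         A \<noteq> {#} \<and> Max (cmod ` set_mset A) = real q)) \<and>
     (\<exists>\<Delta>>0. \<exists>\<epsilon>>0. \<epsilon> < real q \<and>
        (\<lambda>m. N_coeff \<Gamma> Y \<phi> m - of_nat \<Delta> * indicator {n. \<Delta> dvd n} m * of_nat q ^ m)
          \<in> O(\<lambda>m. of_real ((real q - \<epsilon>) ^ m)))"
proof -
  interpret tree_action \<Gamma> Y \<phi> q by unfold_locales (fact assms)+
  show ?thesis
    using T_matrix_nonneg T_connected_X zeta_factorization_max[OF assms(6)] prime_geodesic_theorem[OF assms(6)]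
    by (intro conjI impI ballI allI) blast+
qed

end
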